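(* Let $(Z_n)_{n\ge0}$ be the single-unit process of the context with $$f(x)=\frac{1}{1+\exp(-\theta(x-x^* ))},\qquad x^*\in(0,1),\ \theta>0 .$$ Call the system predictable if there is a deterministic point $z_\infty$ such that $Z_n\to z_\infty$ almost surely. (A) Let $x^*=1/2$. If $\theta\le4$, then the system is predictable and the unique limit configuration is $1/2$, i.e. $Z_n\to1/2$ almost surely. If $\theta>4$, then $Z_n$ converges almost surely, but the system is not predictable, and there are two possible limit configurations (values of the almost sure limit); they belong to $(0,\widehat x_1]\cup[\widehat x_2,1)\subset(0,1)\setminus\{1/2\}$ and are symmetric with respect to $1/2$, where $\widehat x_1<1/2<\widehat x_2=1-\widehat x_1$ are the solutions of $f'=1$. (B) Let $x^*\ne1/2$. Consider the conditions: U1) $\theta/4\le1$; U2) $\max\{f'(0),f'(1)\}\ge1$; U3) $\max\{f'(0),f'(1)\}<1<\theta/4$ and either $f(\widehat x_1)>\widehat x_1$ or $f(\widehat x_2)<\widehat x_2$, where $\widehat x_1\in(0,x^* )$ and $\widehat x_2=2x^*-\widehat x_1\in(x^*,1)$ are the solutions of $f'=1$. If one of U1), U2), U3) holds, then the system is predictable, and the limit configuration belongs to $(0,1)\setminus\{x^*,1/2\}$; more precisely, it is strictly smaller than $1/2$ when $x^*>1/2$ and strictly greater than $1/2$ when $x^*<1/2$. Otherwise, $Z_n$ converges almost surely, but the system is not predictable, and there are two possible limit configurations, both in $(0,1)\setminus\{x^*,1/2\}$: one belongs to $(0,\widehat x_1]\setminus\{1/2\}\subset(0,x^* )\setminus\{1/2\}$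 and the other to $[\widehat x_2,1)\setminus\{1/2\}\subset(x^*,1)\setminus\{1/2\}$, with $\widehat{x}_1,\widehat{x}_2$ as in U3); moreover one of them is strictly smaller than $1/2$ and the other strictly greater than $1/2$.
   Context: Single-unit process (case $N=1$, $\alpha=\beta=0$): $(r_n)_{n\ge0}$ is a deterministic sequence in $[0,1]$ with $\lim_{n\to\infty}nr_n=1$; $Z_0$ is a random variable with values in $[0,1]$; for $n\ge0$, $Z_{n+1}=(1-r_n)Z_n+r_nI_{n+1}$ with $I_{n+1}\in\{0,1\}$ and $P(I_{n+1}=1\mid\mathcal{F}_n)=f(Z_n)$, where $\mathcal{F}_n=\sigma(Z_0,I_1,\dots,I_n)$. *)

theory Defs
  imports "HOL-Probability.Probability"
begin

text \<open>The \<sigma>-algebra generated by \<open>Z\<^sub>0, I\<^sub>1, \<dots>, I\<^sub>n\<close>; the variable \<open>I 0\<close> plays no role.\<close>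

definition history ::
  "'a measure \<Rightarrow> (nat \<Rightarrow> 'a \<Rightarrow> real) \<Rightarrow> (nat \<Rightarrow> 'a \<Rightarrow> real) \<Rightarrow> nat \<Rightarrow> 'a measure" where
  "history M Z I n =
     sigma (space M) (\<Union>X \<in> insert (Z 0) (I ` {1..n}). sets (vimage_algebra (space M) X borel))"

locale single_unit_process = prob_space M
  for M :: "'a measure" +
  fixes r :: "nat \<Rightarrow> real"
    and f :: "real \<Rightarrow> real"
    and Z :: "nat \<Rightarrow> 'a \<Rightarrow> real"
    and I :: "nat \<Rightarrow> 'a \<Rightarrow> real"
  assumes r_range: "r n \<in> {0..1}"
    and r_asymp: "(\<lambda>n. real n * r n) \<longlonglongrightarrow> 1"
    and Z0_measurable: "Z 0 \<in> borel_measurable M"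
    and Z0_range: "\<omega> \<in> space M \<Longrightarrow> Z 0 \<omega> \<in> {0..1}"
    and I_measurable: "I (Suc n) \<in> borel_measurable M"
    and I_range: "\<omega> \<in> space M \<Longrightarrow> I (Suc n) \<omega> \<in> {0, 1}"
    and Z_Suc: "\<omega> \<in> space M \<Longrightarrow> Z (Suc n) \<omega> = (1 - r n) * Z n \<omega> + r n * I (Suc n) \<omega>"
    and I_cond_prob:
      "AE \<omega> in M. real_cond_exp M (history M Z I n)
         (indicator {\<omega> \<in> space M. I (Suc n) \<omega> = 1}) \<omega> = f (Z n \<omega>)"

definition logistic :: "real \<Rightarrow> real \<Rightarrow> real \<Rightarrow> real" where
  "logistic \<theta> c x = 1 / (1 + exp (- \<theta> * (x - c)))"

definition predictable :: "'a measure \<Rightarrow> (nat \<Rightarrow> 'a \<Rightarrow> real) \<Rightarrow> bool" where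
  "predictable M Z \<longleftrightarrow> (\<exists>z. AE \<omega> in M. (\<lambda>n. Z n \<omega>) \<longlonglongrightarrow> z)"

text \<open>
  The values taken with positive probability by the limit of \<open>Z\<^sub>n\<close>. This set alone does not say
  that the limit is almost surely one of these values; that has to be stated in addition.
\<close>

definition limit_configs :: "'a measure \<Rightarrow> (nat \<Rightarrow> 'a \<Rightarrow> real) \<Rightarrow> real set" where
  "limit_configs M Z = {z. measure M {\<omega> \<in> space M. (\<lambda>n. Z n \<omega>) \<longlonglongrightarrow> z} > 0}"

text \<open>
  The solutions of \<open>f' = 1\<close> to the left and to the right of \<open>c\<close>. They are meaningful only where
  these solutions exist and are unique.
\<close>

definition xhat1 :: "real \<Rightarrow> real \<Rightarrow> real" where
  "xhat1 \<theta> c = (THE x. x \<in> {0<..<c} \<and> deriv (logistic \<theta> c) x = 1)"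

definition xhat2 :: "real \<Rightarrow> real \<Rightarrow> real" where
  "xhat2 \<theta> c = (THE x. x \<in> {c<..<1} \<and> deriv (logistic \<theta> c) x = 1)"

definition U1 :: "real \<Rightarrow> real \<Rightarrow> bool" where
  "U1 \<theta> c \<longleftrightarrow> \<theta> / 4 \<le> 1"

definition U2 :: "real \<Rightarrow> real \<Rightarrow> bool" where
  "U2 \<theta> c \<longleftrightarrow> max (deriv (logistic \<theta> c) 0) (deriv (logistic \<theta> c) 1) \<ge> 1"

definition U3 :: "real \<Rightarrow> real \<Rightarrow> bool" where
  "U3 \<theta> c \<longleftrightarrow>
     max (deriv (logistic \<theta> c) 0) (deriv (logistic \<theta> c) 1) < 1 \<and> 1 < \<theta> / 4 \<and>
     (logistic \<theta> c (xhat1 \<theta> c) > xhat1 \<theta> c \<or> logistic \<theta> c (xhat2 \<theta> c) < xhat2 \<theta> c)"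

end

theory Submission
  imports Defs "HOL-Real_Asymp.Real_Asymp"
begin

text \<open>
  Write \<open>Z (n + 1) = Z n + r n * (f (Z n) - Z n) + r n * \<xi> n\<close> with bounded martingale differences
  \<open>\<xi> n\<close>. As \<open>r\<^sup>2\<close> is summable, \<open>\<Sum>n. r n * \<xi> n\<close> converges almost surely (Kolmogorov's inequality), so
  \<open>Z\<close> shadows an Euler scheme for \<open>x' = f x - x\<close>; as \<open>r\<close> is not summable, it converges to a fixed point
  of \<open>f\<close>. Since \<open>f'\<close> increases up to \<open>c\<close> and decreases afterwards, \<open>f x - x\<close> has one zero under
  U1, U2, U3; otherwise its zeros are \<open>a\<close> at or below \<open>c - d\<close>, \<open>b\<close> at or above \<open>c + d\<close>, where \<open>c - d\<close> and
  \<open>c + d\<close> solve \<open>f' = 1\<close>, and possibly one with slope above \<open>1\<close> between them, which is almost surely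
  not the limit. The process stays below \<open>c - d\<close> with positive probability, also when \<open>a = c - d\<close> is
  a tangency, because there the drift towards \<open>c - d\<close> is so weak that the noise dies out before
  \<open>c - d\<close> is reached; hence \<open>a\<close> is a limit with positive probability, and by the reflection
  \<open>x \<mapsto> 1 - x\<close> so is \<open>b\<close>.
\<close>

section \<open>Perturbed Euler schemes\<close>

text \<open>The negation of U3 gives only weak inequalities between \<open>f x\<close> and
  \<open>x\<close> at the two solutions of \<open>f' = 1\<close>, so tangencies belong to the
  bistable case, where stability of the linearisation decides nothing. The barrier argument
  therefore asks only for drift at most \<open>(B - x) / 16\<close> just below \<open>B\<close>;
  this holds at any point \<open>B\<close> of slope 1 with \<open>f B \<le> B\<close>, tangent or
  not. The steep fixed point has to be expelled by the noise itself, since a path placed exactly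
  there feels no drift. The input is a conditional variance bounded below: on the unit interval
  \<open>f\<close> stays in a compact part of (0,1). It is exploited through one bounded test
  function with its maximum at the fixed point, whose mean the noise lowers. The probabilistic part
  is stated for an arbitrary filtration and response function, so that \<open>1 - Z\<close> is again
  an instance and only left-hand limits need a proof. The analytic part rests on
  \<open>f' = \<theta> * (f * (1 - f))\<close>, which turns U2 and U3 into the position of
  \<open>c - d\<close> and \<open>c + d\<close> relative to 0 and 1 and the sign of
  \<open>f x - x\<close> there.\<close>

lemma convergent_if_dense_levels_decided:
  fixes y :: "nat \<Rightarrow> real"
  assumes bdd: "\<And>n. \<bar>y n\<bar> \<le> K"
    and dec: "\<And>u v. u < v \<Longrightarrow> \<exists>x. u < x \<and> x < v \<and>
           ((\<forall>\<^sub>F n in sequentially. x \<le> y n) \<or> (\<forall>\<^sub>F n in sequentially. y n \<le> x))"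
  shows "convergent y"
proof -
  define S where "S = {x. \<forall>\<^sub>F n in sequentially. x \<le> y n}"
  have "- K \<in> S"
    unfolding S_def using bdd by (auto intro!: always_eventually simp: abs_le_iff minus_le_iff)
  then have ne: "S \<noteq> {}" by auto
  have "x \<le> K" if x: "x \<in> S" for x
  proof -
    obtain n where "x \<le> y n"
      using x unfolding S_def eventually_sequentially by blast
    then show ?thesis using bdd[of n] by linarith
  qed
  then have ub: "bdd_above S" by (rule bdd_aboveI)
  \<comment> \<open>A decided level just above \<open>Sup S\<close> is not in \<open>S\<close>, so
    it can only be decided from above.\<close>
  have "y \<longlonglongrightarrow> Sup S"
  proof (rule order_tendstoI)
    fix a assume "a < Sup S"
    then obtain x where "x \<in> S" "a < x"
      using less_cSup_iff[OF ne ub] by blast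
    then show "\<forall>\<^sub>F n in sequentially. a < y n"
      unfolding S_def by (auto elim: eventually_mono)
  next
    fix a assume "Sup S < a"
    then obtain x where x: "Sup S < x" "x < a"
      "(\<forall>\<^sub>F n in sequentially. x \<le> y n) \<or> (\<forall>\<^sub>F n in sequentially. y n \<le> x)"
      using dec by blast
    have "x \<notin> S" using x(1) cSup_upper[OF _ ub] by fastforce
    then have "\<forall>\<^sub>F n in sequentially. y n \<le> x" using x(3) unfolding S_def by blast
    then show "\<forall>\<^sub>F n in sequentially. y n < a"
      using x(2) by (auto elim: eventually_mono)
  qed
  then show ?thesis by (rule convergentI)
qed

text \<open>Positive drift near \<open>x\<close> makes \<open>x\<close> a one-way gate. From just
  above \<open>x\<close> the drift pushes up, and from further away a single step is too short to
  return below \<open>x\<close>. So either \<open>y\<close> passes the gate once and stays above, or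
  it remains below from some time on.\<close>

lemma Euler_scheme_decides_level:
  fixes y z r :: "nat \<Rightarrow> real" and h :: "real \<Rightarrow> real"
  assumes rec: "\<And>n. y (Suc n) = y n + r n * h (z n)"
    and close: "(\<lambda>n. z n - y n) \<longlonglongrightarrow> 0"
    and r: "\<And>n. 0 \<le> r n" "r \<longlonglongrightarrow> 0"
    and H: "\<And>n. \<bar>h (z n)\<bar> \<le> H"
    and h: "isCont h x" "0 < h x"
  shows "(\<forall>\<^sub>F n in sequentially. x \<le> y n) \<or> (\<forall>\<^sub>F n in sequentially. y n \<le> x)"
proof -
  have "\<forall>\<^sub>F t in at x. 0 < h t"
    using h order_tendstoD(1) unfolding isCont_def by blast
  then obtain d where d: "0 < d" "\<And>t. t \<noteq> x \<Longrightarrow> dist t x < d \<Longrightarrow> 0 < h t"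
    unfolding eventually_at by auto
  have pos: "0 < h t" if "\<bar>t - x\<bar> < d" for t
    using d(2)[of t] h(2) that by (cases "t = x") (auto simp: dist_real_def)
  have "(\<lambda>n. r n * H) \<longlonglongrightarrow> 0 * H" by (intro tendsto_intros r)
  then have e1: "\<forall>\<^sub>F n in sequentially. r n * H < d / 2"
    using d(1) by (intro order_tendstoD) auto
  have e2: "\<forall>\<^sub>F n in sequentially. \<bar>z n - y n\<bar> < d / 2"
    using tendstoD[OF close, of "d/2"] d(1) by (simp add: dist_real_def)
  have "\<forall>\<^sub>F n in sequentially. x \<le> y n \<longrightarrow> x \<le> y (Suc n)"
    using e1 e2
  proof eventually_elim
    case (elim n)
    show ?case
    proof
      assume x: "x \<le> y n"
      show "x \<le> y (Suc n)"
      proof (cases "y n < x + d / 2")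
        case True
        then have "\<bar>z n - x\<bar> < d" using elim(2) x by linarith
        then have "0 \<le> r n * h (z n)" using pos r(1)[of n] by (simp add: less_imp_le)
        then show ?thesis using rec[of n] x by linarith
      next
        case False
        have "\<bar>r n * h (z n)\<bar> \<le> r n * H"
          using H[of n] r(1)[of n] by (simp add: abs_mult mult_left_mono)
        then show ?thesis using rec[of n] False elim(1) by linarith
      qed
    qed
  qed
  then obtain N where N: "\<And>n. n \<ge> N \<Longrightarrow> x \<le> y n \<Longrightarrow> x \<le> y (Suc n)"
    unfolding eventually_sequentially by blast
  show ?thesis
  proof (cases "\<exists>m\<ge>N. x \<le> y m")
    case True
    then obtain m where m: "m \<ge> N" "x \<le> y m" by blast
    have "x \<le> y n" if "n \<ge> m" for n
      using that by (induction n rule: dec_induct) (use m N in auto)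
    then show ?thesis unfolding eventually_sequentially by blast
  next
    case False
    then show ?thesis unfolding eventually_sequentially
      by (meson linear)
  qed
qed

lemma not_summable_mono_eventually:
  fixes a b :: "nat \<Rightarrow> real"
  assumes "\<not> summable a" "\<forall>\<^sub>F n in sequentially. 0 \<le> a n \<and> a n \<le> b n"
  shows "\<not> summable b"
proof
  assume "summable b"
  moreover have "\<forall>\<^sub>F n in sequentially. norm (a n) \<le> b n"
    using assms(2) by eventually_elim auto
  ultimately show False using assms(1) summable_comparison_test_ev by blast
qed

text \<open>Subtracting the vanishing remainder \<open>s n - l\<close> leaves an exact Euler
  recursion for \<open>y\<close>, driven by \<open>h (z n)\<close>. Every level where
  \<open>h\<close> does not vanish is decided, and finitely many zeros leave such levels
  dense.\<close>

lemma perturbed_Euler_scheme_converges_to_zero: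
  fixes z r s :: "nat \<Rightarrow> real" and h :: "real \<Rightarrow> real"
  assumes z: "\<And>n. \<bar>z n\<bar> \<le> K"
    and r: "\<And>n. 0 \<le> r n" "r \<longlonglongrightarrow> 0" "\<not> summable r"
    and s: "convergent s"
    and rec: "\<And>n. z (Suc n) = z n + r n * h (z n) + (s (Suc n) - s n)"
    and cont: "continuous_on UNIV h"
    and fin: "finite {x. h x = 0}"
  shows "\<exists>p. h p = 0 \<and> z \<longlonglongrightarrow> p"
proof -
  obtain l where l: "s \<longlonglongrightarrow> l" using s unfolding convergent_def by blast
  define y where "y = (\<lambda>n. z n - (s n - l))"
  have yrec: "y (Suc n) = y n + r n * h (z n)" for n
    unfolding y_def using rec[of n] by simp
  have "(\<lambda>n. s n - l) \<longlonglongrightarrow> 0" using l LIM_zero by blast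
  then have zy: "(\<lambda>n. z n - y n) \<longlonglongrightarrow> 0" by (simp add: y_def)
  have "compact (h ` cball 0 K)"
    using cont by (intro compact_continuous_image) (auto intro: continuous_on_subset)
  then have "bounded (h ` cball 0 K)" by (rule compact_imp_bounded)
  then obtain H where "\<And>t. t \<in> cball 0 K \<Longrightarrow> \<bar>h t\<bar> \<le> H"
    unfolding bounded_iff by force
  then have H: "\<bar>h (z n)\<bar> \<le> H" for n using z by simp
  have isCont: "isCont h x" for x
    using cont by (simp add: continuous_on_eq_continuous_at)
  have "Bseq (\<lambda>n. s n - l)"
    using \<open>(\<lambda>n. s n - l) \<longlonglongrightarrow> 0\<close> convergentI convergent_imp_Bseq by blast
  then obtain L where L: "\<forall>n. norm (s n - l) \<le> L" unfolding Bseq_def by blast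
  have ybdd: "\<bar>y n\<bar> \<le> K + L" for n
    using z[of n] L[rule_format, of n] abs_triangle_ineq4[of "z n" "s n - l"]
    unfolding y_def real_norm_def by linarith
  have decided: "(\<forall>\<^sub>F n in sequentially. x \<le> y n) \<or> (\<forall>\<^sub>F n in sequentially. y n \<le> x)"
    if "h x \<noteq> 0" for x
  proof (cases "0 < h x")
    case True
    show ?thesis
      by (rule Euler_scheme_decides_level[OF yrec zy r(1,2) H isCont True])
  next
    \<comment> \<open>Negative drift at \<open>x\<close> becomes positive drift at
      \<open>- x\<close> after negating the path.\<close>
    case False
    let ?h = "\<lambda>t. - h (- t)"
    have "(\<forall>\<^sub>F n in sequentially. - x \<le> - y n) \<or> (\<forall>\<^sub>F n in sequentially. - y n \<le> - x)"
    proof (rule Euler_scheme_decides_level[where r = r and h = ?h and z = "\<lambda>n. - z n" and H = H])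
      show "- y (Suc n) = - y n + r n * ?h (- z n)" for n using yrec[of n] by simp
      show "(\<lambda>n. - z n - - y n) \<longlonglongrightarrow> 0"
        using tendsto_minus[OF zy] by (simp add: algebra_simps)
      show "isCont ?h (- x)"
        by (intro continuous_intros isCont_o2[where f = uminus and g = h]) (use isCont in auto)
    qed (use r H False that in auto)
    then show ?thesis by auto
  qed
  have "convergent y"
  proof (rule convergent_if_dense_levels_decided[OF ybdd])
    fix u v :: real assume "u < v"
    then have "infinite {u<..<v}" by simp
    then have "\<not> {u<..<v} \<subseteq> {x. h x = 0}" using fin finite_subset by blast
    then obtain x where "x \<in> {u<..<v}" "x \<notin> {x. h x = 0}" by blast
    then have "u < x" "x < v" "h x \<noteq> 0" by auto
    then show "\<exists>x. u < x \<and> x < v \<and>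
        ((\<forall>\<^sub>F n in sequentially. x \<le> y n) \<or> (\<forall>\<^sub>F n in sequentially. y n \<le> x))"
      using decided by blast
  qed
  then obtain p where p: "y \<longlonglongrightarrow> p" unfolding convergent_def by blast
  have zp: "z \<longlonglongrightarrow> p" using tendsto_add[OF p zy] by simp
  have hz: "(\<lambda>n. h (z n)) \<longlonglongrightarrow> h p" using isCont zp isCont_tendsto_compose by blast
  \<comment> \<open>The increments of the convergent \<open>y\<close> telescope. If
    \<open>h p\<close> were nonzero, they would eventually be comparable to the non-summable
    \<open>r\<close>.\<close>
  have summ: "summable (\<lambda>n. r n * h (z n))"
  proof -
    have "summable (\<lambda>n. y (Suc n) - y n)"
      using telescope_summable[OF p] .
    then show ?thesis by (simp add: yrec)
  qed
  have "h p = 0"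
  proof (rule ccontr)
    assume hp: "h p \<noteq> 0"
    have "(\<lambda>n. h (z n) / h p) \<longlonglongrightarrow> h p / h p" by (intro tendsto_intros hz hp)
    then have ev: "\<forall>\<^sub>F n in sequentially. 1 / 2 < h (z n) / h p"
      using hp by (intro order_tendstoD) auto
    have "\<forall>\<^sub>F n in sequentially. 0 \<le> r n \<and> r n \<le> 2 * (r n * h (z n) / h p)"
      using ev
    proof eventually_elim
      case (elim n)
      have "r n * (1 / 2) \<le> r n * (h (z n) / h p)"
        using elim r(1)[of n] by (intro mult_left_mono) auto
      then show ?case using r(1)[of n] by (simp add: mult_ac)
    qed
    then have "\<not> summable (\<lambda>n. 2 * (r n * h (z n) / h p))"
      by (rule not_summable_mono_eventually[OF r(3)])
    moreover have "summable (\<lambda>n. 2 * (r n * h (z n) / h p))"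
      by (intro summable_mult summable_divide summ)
    ultimately show False by blast
  qed
  then show ?thesis using zp by blast
qed

text \<open>By \<open>1 - a \<le> exp (- a)\<close> the product is at most the exponential of minus
  a divergent sum. This sends to 0 both a path that only draws zeros and the scale \<open>u\<close>
  of the later test function.\<close>

lemma prod_one_minus_tendsto_0:
  fixes a :: "nat \<Rightarrow> real"
  assumes a: "\<And>n. 0 \<le> a n" "\<And>n. a n \<le> 1" and ns: "\<not> summable a"
  shows "(\<lambda>n. \<Prod>k=m..<n. 1 - a k) \<longlonglongrightarrow> 0"
proof -
  have unbounded: "\<exists>n. C < (\<Sum>k=m..<n. a k)" for C
  proof (rule ccontr)
    assume no: "\<not> ?thesis"
    have "(\<Sum>k<n. a k) \<le> (\<Sum>k<m. a k) + max C 0" for n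
    proof (cases "m \<le> n")
      case True
      then have "(\<Sum>k<n. a k) = (\<Sum>k<m. a k) + (\<Sum>k=m..<n. a k)"
        by (metis atLeast0LessThan sum.atLeastLessThan_concat zero_le)
      moreover have "(\<Sum>k=m..<n. a k) \<le> C" using no by (meson not_le)
      ultimately show ?thesis by simp
    next
      case False
      then have "(\<Sum>k<n. a k) \<le> (\<Sum>k<m. a k)"
        using a by (intro sum_mono2) auto
      then show ?thesis by simp
    qed
    then have "summable a" by (rule summableI_nonneg_bounded[OF a(1)])
    then show False using ns by blast
  qed
  show ?thesis
  proof (rule LIMSEQ_I)
    fix e :: real assume e: "0 < e"
    obtain N where N: "- ln e < (\<Sum>k=m..<N. a k)" using unbounded by blast
    have "norm ((\<Prod>k=m..<n. 1 - a k) - 0) < e" if n: "n \<ge> N" for n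
    proof -
      have "(\<Prod>k=m..<n. 1 - a k) \<le> (\<Prod>k=m..<n. exp (- a k))"
        using a by (intro prod_mono) (use exp_ge_add_one_self[of "- a _"] in auto)
      also have "\<dots> = exp (- (\<Sum>k=m..<n. a k))"
        by (simp add: exp_sum flip: sum_negf)
      also have "\<dots> \<le> exp (- (\<Sum>k=m..<N. a k))"
        using a n by (auto intro!: sum_mono2)
      also have "\<dots> < exp (ln e)" using N by (intro exp_less_mono) linarith
      finally have "(\<Prod>k=m..<n. 1 - a k) < e" using e by simp
      moreover have "0 \<le> (\<Prod>k=m..<n. 1 - a k)" using a by (intro prod_nonneg) auto
      ultimately show ?thesis by simp
    qed
    then show "\<exists>N. \<forall>n\<ge>N. norm ((\<Prod>k=m..<n. 1 - a k) - 0) < e" by blast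
  qed
qed

section \<open>Reinforced urn processes\<close>

text \<open>The filtration is abstract so that the reflected process is an instance without
  recomputing its history. \<open>I_mean\<close> is the conditional probability in weak form, tested
  against bounded variables measurable at time \<open>n\<close>; this is the only form
  needed.\<close>

locale urn_process = prob_space M
  for M :: "'a measure" +
  fixes F :: "nat \<Rightarrow> 'a measure"
    and r :: "nat \<Rightarrow> real"
    and f :: "real \<Rightarrow> real"
    and Z I :: "nat \<Rightarrow> 'a \<Rightarrow> real"
  assumes F_subalgebra: "subalgebra M (F n)"
    and F_mono: "m \<le> n \<Longrightarrow> subalgebra (F n) (F m)"
    and step_range: "r n \<in> {0..1}"
    and step_asymp: "(\<lambda>n. real n * r n) \<longlonglongrightarrow> 1"
    and Z_adapted: "Z n \<in> borel_measurable (F n)"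
    and I_adapted: "I (Suc n) \<in> borel_measurable (F (Suc n))"
    and Z_range: "\<omega> \<in> space M \<Longrightarrow> Z n \<omega> \<in> {0..1}"
    and I_values: "\<omega> \<in> space M \<Longrightarrow> I (Suc n) \<omega> \<in> {0, 1}"
    and Z_step: "\<omega> \<in> space M \<Longrightarrow> Z (Suc n) \<omega> = (1 - r n) * Z n \<omega> + r n * I (Suc n) \<omega>"
    and I_mean: "X \<in> borel_measurable (F n) \<Longrightarrow> (\<And>\<omega>. \<omega> \<in> space M \<Longrightarrow> \<bar>X \<omega>\<bar> \<le> C) \<Longrightarrow>
      (\<integral>\<omega>. X \<omega> * I (Suc n) \<omega> \<partial>M) = (\<integral>\<omega>. X \<omega> * f (Z n \<omega>) \<partial>M)"
    and f_cont: "continuous_on UNIV f"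
    and f_range: "f x \<in> {0<..<1}"
begin

definition noise :: "nat \<Rightarrow> 'a \<Rightarrow> real" where
  "noise n \<omega> = I (Suc n) \<omega> - f (Z n \<omega>)"

lemma measurable_F_mono: "X \<in> borel_measurable (F m) \<Longrightarrow> m \<le> n \<Longrightarrow> X \<in> borel_measurable (F n)"
  using measurable_from_subalg F_mono by blast

lemma measurable_F_M: "X \<in> borel_measurable (F m) \<Longrightarrow> X \<in> borel_measurable M"
  using measurable_from_subalg F_subalgebra by blast

lemma sets_F_M: "A \<in> sets (F n) \<Longrightarrow> A \<in> sets M"
  using F_subalgebra unfolding subalgebra_def by blast

lemma sets_F_mono: "A \<in> sets (F m) \<Longrightarrow> m \<le> n \<Longrightarrow> A \<in> sets (F n)"
  using F_mono unfolding subalgebra_def by blast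

lemma space_F: "space (F n) = space M"
  using F_subalgebra unfolding subalgebra_def by blast

lemma f_borel: "f \<in> borel_measurable borel"
  using f_cont by (rule borel_measurable_continuous_onI)

lemma Z_adapted_mono: "k \<le> n \<Longrightarrow> Z k \<in> borel_measurable (F n)"
  by (rule measurable_F_mono[OF Z_adapted])

lemma fZ_adapted: "(\<lambda>\<omega>. f (Z n \<omega>)) \<in> borel_measurable (F n)"
  using measurable_compose[OF Z_adapted f_borel] .

lemma Z_borel [measurable]: "Z n \<in> borel_measurable M"
  by (rule measurable_F_M[OF Z_adapted])

lemma I_borel [measurable]: "I (Suc n) \<in> borel_measurable M"
  by (rule measurable_F_M[OF I_adapted])

lemma noise_adapted: "k < n \<Longrightarrow> noise k \<in> borel_measurable (F n)"
proof -
  assume "k < n"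
  have "(\<lambda>\<omega>. I (Suc k) \<omega> - f (Z k \<omega>)) \<in> borel_measurable (F (Suc k))"
    by (intro borel_measurable_diff I_adapted measurable_F_mono[OF fZ_adapted]) simp
  then have "noise k \<in> borel_measurable (F (Suc k))" unfolding noise_def[abs_def] .
  then show "noise k \<in> borel_measurable (F n)"
    using \<open>k < n\<close> by (rule measurable_F_mono[OF _ Suc_leI])
qed

lemma noise_borel [measurable]: "noise k \<in> borel_measurable M"
  by (rule measurable_F_M[OF noise_adapted[OF lessI]])

lemma noise_bound: "\<omega> \<in> space M \<Longrightarrow> \<bar>noise n \<omega>\<bar> \<le> 1"
  using I_values[of \<omega> n] f_range[of "Z n \<omega>"] by (auto simp: noise_def)

lemma integrable_bounded:
  fixes X :: "'a \<Rightarrow> real"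
  assumes "X \<in> borel_measurable M" "\<And>\<omega>. \<omega> \<in> space M \<Longrightarrow> \<bar>X \<omega>\<bar> \<le> C"
  shows "integrable M X"
  using assms by (intro integrable_const_bound[where B = C]) auto

lemma noise_mean:
  assumes X: "X \<in> borel_measurable (F n)" and C: "\<And>\<omega>. \<omega> \<in> space M \<Longrightarrow> \<bar>X \<omega>\<bar> \<le> C"
  shows "(\<integral>\<omega>. X \<omega> * noise n \<omega> \<partial>M) = 0"
proof -
  note [measurable] = measurable_F_M[OF X] measurable_F_M[OF fZ_adapted]
  have le: "\<bar>X \<omega> * t\<bar> \<le> C" if "\<omega> \<in> space M" "\<bar>t\<bar> \<le> 1" for \<omega> t
  proof -
    have "\<bar>X \<omega>\<bar> * \<bar>t\<bar> \<le> C * 1" using C[OF that(1)] that(2) by (intro mult_mono) auto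
    then show ?thesis by (simp add: abs_mult)
  qed
  have I1: "\<bar>I (Suc n) \<omega>\<bar> \<le> 1" if "\<omega> \<in> space M" for \<omega>
    using I_values[OF that, of n] by auto
  have fI: "\<bar>f t\<bar> \<le> 1" for t
    using f_range[of t] by auto
  have 1: "integrable M (\<lambda>\<omega>. X \<omega> * I (Suc n) \<omega>)"
    by (rule integrable_bounded[where C = C]) (use I1 le in auto)
  have 2: "integrable M (\<lambda>\<omega>. X \<omega> * f (Z n \<omega>))"
    by (rule integrable_bounded[where C = C]) (use fI le in auto)
  have "(\<integral>\<omega>. X \<omega> * noise n \<omega> \<partial>M) = (\<integral>\<omega>. X \<omega> * I (Suc n) \<omega> - X \<omega> * f (Z n \<omega>) \<partial>M)"
    by (simp add: noise_def algebra_simps)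
  also have "\<dots> = 0" using I_mean[OF X C] by (simp add: Bochner_Integration.integral_diff[OF 1 2])
  finally show ?thesis .
qed

text \<open>Martingale increments are orthogonal: the cross term pairs the next noise with a bounded
  variable known before it, and \<open>noise_mean\<close> makes it vanish. Each diagonal term is
  bounded through \<open>\<bar>noise\<bar> \<le> 1\<close>. The bounds \<open>C k\<close> serve
  integrability only.\<close>

lemma predictable_sum_second_moment:
  assumes g: "\<And>k. g k \<in> borel_measurable (F k)"
    and C: "\<And>k \<omega>. \<omega> \<in> space M \<Longrightarrow> \<bar>g k \<omega>\<bar> \<le> C k"
  shows "(\<integral>\<omega>. (\<Sum>k<n. g k \<omega> * noise k \<omega>)\<^sup>2 \<partial>M) \<le> (\<Sum>k<n. \<integral>\<omega>. (g k \<omega>)\<^sup>2 \<partial>M)"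
proof (induction n)
  case (Suc n)
  note [measurable] = measurable_F_M[OF g]
  define S where "S = (\<lambda>\<omega>. \<Sum>k<n. g k \<omega> * noise k \<omega>)"
  have SF: "S \<in> borel_measurable (F n)"
    unfolding S_def
    by (intro borel_measurable_sum borel_measurable_times noise_adapted measurable_F_mono[OF g]) auto
  note [measurable] = measurable_F_M[OF SF]
  have gn: "\<bar>g k \<omega> * noise k \<omega>\<bar> \<le> C k" if "\<omega> \<in> space M" for k \<omega>
  proof -
    have "\<bar>g k \<omega>\<bar> * \<bar>noise k \<omega>\<bar> \<le> C k * 1"
      using C[OF that] noise_bound[OF that] by (intro mult_mono) (auto intro: order_trans[OF abs_ge_zero])
    then show ?thesis by (simp add: abs_mult)
  qed
  define K where "K = (\<Sum>k<n. C k)"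
  have S: "\<bar>S \<omega>\<bar> \<le> K" if "\<omega> \<in> space M" for \<omega>
    unfolding S_def K_def using gn[OF that] by (intro order_trans[OF sum_abs] sum_mono)
  have Sg: "\<bar>S \<omega> * g n \<omega>\<bar> \<le> K * C n" if "\<omega> \<in> space M" for \<omega>
    using S[OF that] C[OF that] unfolding abs_mult
    by (intro mult_mono) (auto intro: order_trans[OF abs_ge_zero])
  have sq: "\<bar>t\<^sup>2\<bar> \<le> B\<^sup>2" if "\<bar>t\<bar> \<le> B" for t B :: real
    using power_mono[OF that, of 2] by simp
  have i1: "integrable M (\<lambda>\<omega>. (S \<omega>)\<^sup>2)"
    by (rule integrable_bounded[where C = "K\<^sup>2"]) (use S sq in auto)
  have i2: "integrable M (\<lambda>\<omega>. (S \<omega> * g n \<omega>) * noise n \<omega>)"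
  proof (rule integrable_bounded)
    fix \<omega> assume w: "\<omega> \<in> space M"
    have "\<bar>S \<omega>\<bar> * \<bar>g n \<omega> * noise n \<omega>\<bar> \<le> K * C n"
      using S[OF w] gn[OF w, of n]
      by (intro mult_mono) (auto intro: order_trans[OF abs_ge_zero])
    then show "\<bar>(S \<omega> * g n \<omega>) * noise n \<omega>\<bar> \<le> K * C n" by (simp add: abs_mult mult.assoc)
  qed measurable
  have i3: "integrable M (\<lambda>\<omega>. (g n \<omega> * noise n \<omega>)\<^sup>2)"
    by (rule integrable_bounded[where C = "(C n)\<^sup>2"]) (use gn sq in auto)
  have i4: "integrable M (\<lambda>\<omega>. (g n \<omega>)\<^sup>2)"
    by (rule integrable_bounded[where C = "(C n)\<^sup>2"]) (use C sq in auto)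
  have mean0: "(\<integral>\<omega>. (S \<omega> * g n \<omega>) * noise n \<omega> \<partial>M) = 0"
    by (rule noise_mean[where C = "K * C n"]) (use SF g Sg in auto)
  have "(\<integral>\<omega>. (\<Sum>k<Suc n. g k \<omega> * noise k \<omega>)\<^sup>2 \<partial>M)
      = (\<integral>\<omega>. (S \<omega>)\<^sup>2 + 2 * ((S \<omega> * g n \<omega>) * noise n \<omega>) + (g n \<omega> * noise n \<omega>)\<^sup>2 \<partial>M)"
    by (simp add: S_def power2_sum algebra_simps)
  also have "\<dots> = (\<integral>\<omega>. (S \<omega>)\<^sup>2 \<partial>M) + (\<integral>\<omega>. (g n \<omega> * noise n \<omega>)\<^sup>2 \<partial>M)"
    using i1 i2 i3 mean0 by simp
  also have "\<dots> \<le> (\<Sum>k<n. \<integral>\<omega>. (g k \<omega>)\<^sup>2 \<partial>M) + (\<integral>\<omega>. (g n \<omega>)\<^sup>2 \<partial>M)"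
  proof (intro add_mono integral_mono i3 i4)
    show "(\<integral>\<omega>. (S \<omega>)\<^sup>2 \<partial>M) \<le> (\<Sum>k<n. \<integral>\<omega>. (g k \<omega>)\<^sup>2 \<partial>M)"
      using Suc unfolding S_def .
    fix \<omega> assume w: "\<omega> \<in> space M"
    have "\<bar>noise n \<omega>\<bar>\<^sup>2 \<le> 1\<^sup>2" using noise_bound[OF w] by (intro power_mono) auto
    then have "(g n \<omega>)\<^sup>2 * (noise n \<omega>)\<^sup>2 \<le> (g n \<omega>)\<^sup>2 * 1" by (intro mult_left_mono) auto
    then show "(g n \<omega> * noise n \<omega>)\<^sup>2 \<le> (g n \<omega>)\<^sup>2" by (simp add: power_mult_distrib)
  qed
  finally show ?case by simp
qed simp

text \<open>Stopping the sum when it first leaves \<open>(-\<epsilon>, \<epsilon>)\<close> keeps it predictable.\<close>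

lemma noise_maximal_inequality_finite:
  fixes w :: "nat \<Rightarrow> real"
  assumes A: "A \<in> sets (F N)" and e: "0 < \<epsilon>"
  defines "S \<equiv> \<lambda>n \<omega>. \<Sum>k=N..<n. w k * noise k \<omega>"
  shows "prob (A \<inter> {\<omega> \<in> space M. \<exists>n\<in>{N..m}. \<epsilon> \<le> \<bar>S n \<omega>\<bar>}) \<le> prob A * (\<Sum>k=N..<m. (w k)\<^sup>2) / \<epsilon>\<^sup>2"
proof -
  have SF: "S n \<in> borel_measurable (F k)" if "n \<le> k" for n k
    unfolding S_def using that by (intro borel_measurable_sum borel_measurable_times noise_adapted) auto
  \<comment> \<open>\<open>G k\<close> is the event that the sum has not left the interval up to
    time \<open>k\<close>. It is known at time \<open>k\<close>, so multiplying the weight by its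
    indicator keeps the coefficient predictable.\<close>
  define G where "G = (\<lambda>k. {\<omega> \<in> space M. \<forall>j\<in>{N..k}. \<bar>S j \<omega>\<bar> < \<epsilon>})"
  have G: "G k \<in> sets (F k)" for k
  proof -
    have [measurable]: "S j \<in> borel_measurable (F k)" if "j \<in> {N..k}" for j using SF that by auto
    have "{\<omega> \<in> space (F k). \<forall>j\<in>{N..k}. \<bar>S j \<omega>\<bar> < \<epsilon>} \<in> sets (F k)" by measurable
    then show ?thesis by (simp add: G_def space_F)
  qed
  define g where "g = (\<lambda>k \<omega>. if N \<le> k then w k * indicat_real (A \<inter> G k) \<omega> else 0)"
  have gF: "g k \<in> borel_measurable (F k)" for k
    unfolding g_def using sets_F_mono[OF A] G by (cases "N \<le> k") auto
  have gC: "\<bar>g k \<omega>\<bar> \<le> \<bar>w k\<bar>" for k \<omega>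
    by (auto simp: g_def indicator_def)
  define T where "T = (\<lambda>\<omega>. \<Sum>k<m. g k \<omega> * noise k \<omega>)"
  note [measurable] = measurable_F_M[OF gF]
  have [measurable]: "A \<in> sets M" using sets_F_M A by blast
  have Tm: "T \<in> borel_measurable M" unfolding T_def by measurable
  have "\<bar>T \<omega>\<bar> \<le> (\<Sum>k<m. \<bar>w k\<bar>)" if "\<omega> \<in> space M" for \<omega>
    unfolding T_def
  proof (intro order_trans[OF sum_abs] sum_mono)
    fix k
    have "\<bar>g k \<omega>\<bar> * \<bar>noise k \<omega>\<bar> \<le> \<bar>w k\<bar> * 1"
      using gC noise_bound[OF that] by (intro mult_mono) auto
    then show "\<bar>g k \<omega> * noise k \<omega>\<bar> \<le> \<bar>w k\<bar>" by (simp add: abs_mult)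
  qed
  then have Tb: "\<bar>(T \<omega>)\<^sup>2\<bar> \<le> (\<Sum>k<m. \<bar>w k\<bar>)\<^sup>2" if "\<omega> \<in> space M" for \<omega>
    using power_mono[OF _ abs_ge_zero, of "T \<omega>" _ 2] that by simp
  have Ti: "integrable M (\<lambda>\<omega>. (T \<omega>)\<^sup>2)"
    by (rule integrable_bounded[OF _ Tb]) (use Tm in measurable)
  have hit: "\<epsilon>\<^sup>2 \<le> (T \<omega>)\<^sup>2"
    if w: "\<omega> \<in> A" "\<omega> \<in> space M" and ex: "\<exists>n\<in>{N..m}. \<epsilon> \<le> \<bar>S n \<omega>\<bar>" for \<omega>
  proof -
    define n where "n = (LEAST n. n \<in> {N..m} \<and> \<epsilon> \<le> \<bar>S n \<omega>\<bar>)"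
    have "n \<in> {N..m} \<and> \<epsilon> \<le> \<bar>S n \<omega>\<bar>"
      unfolding n_def by (rule LeastI_ex) (use ex in blast)
    then have n: "n \<in> {N..m}" "\<epsilon> \<le> \<bar>S n \<omega>\<bar>" by auto
    have before: "\<bar>S j \<omega>\<bar> < \<epsilon>" if "N \<le> j" "j < n" for j
      using not_less_Least[of j "\<lambda>n. n \<in> {N..m} \<and> \<epsilon> \<le> \<bar>S n \<omega>\<bar>"] that n(1) unfolding n_def[symmetric]
      by auto
    have "g k \<omega> * noise k \<omega> = (if k \<in> {N..<n} then w k * noise k \<omega> else 0)" for k
    proof (cases "k < n")
      case True
      then have "\<omega> \<in> G k" using before w(2) by (auto simp: G_def)
      then show ?thesis using True w(1) by (simp add: g_def)
    next
      \<comment> \<open>From the first exit time \<open>n\<close> on, index \<open>n\<close> itself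
        violates the condition in \<open>G k\<close>; the stopped sum \<open>T\<close> is therefore
        frozen at \<open>S n\<close>.\<close>
      case False
      then have "N \<le> k \<Longrightarrow> \<omega> \<notin> G k" using n by (force simp: G_def)
      then show ?thesis using False by (auto simp: g_def)
    qed
    then have "T \<omega> = (\<Sum>k<m. if k \<in> {N..<n} then w k * noise k \<omega> else 0)"
      unfolding T_def by (rule sum.cong[OF refl])
    also have "\<dots> = (\<Sum>k\<in>{..<m} \<inter> {N..<n}. w k * noise k \<omega>)"
      by (rule sum.inter_restrict[symmetric]) simp
    also have "{..<m} \<inter> {N..<n} = {N..<n}" using n(1) by auto
    finally have "T \<omega> = S n \<omega>" by (simp add: S_def)
    then show ?thesis using n(2) e power_mono[of \<epsilon> "\<bar>S n \<omega>\<bar>" 2] by simp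
  qed
  have "prob (A \<inter> {\<omega> \<in> space M. \<exists>n\<in>{N..m}. \<epsilon> \<le> \<bar>S n \<omega>\<bar>}) \<le> prob {\<omega> \<in> space M. \<epsilon>\<^sup>2 \<le> (T \<omega>)\<^sup>2}"
  proof (rule finite_measure_mono)
    show "A \<inter> {\<omega> \<in> space M. \<exists>n\<in>{N..m}. \<epsilon> \<le> \<bar>S n \<omega>\<bar>} \<subseteq> {\<omega> \<in> space M. \<epsilon>\<^sup>2 \<le> (T \<omega>)\<^sup>2}"
      using hit by blast
    show "{\<omega> \<in> space M. \<epsilon>\<^sup>2 \<le> (T \<omega>)\<^sup>2} \<in> sets M" using Tm by measurable
  qed
  also have "\<dots> \<le> (\<integral>\<omega>. (T \<omega>)\<^sup>2 \<partial>M) / \<epsilon>\<^sup>2"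
    using Ti e by (intro integral_Markov_inequality_measure[where A = "space M"]) auto
  also have "(\<integral>\<omega>. (T \<omega>)\<^sup>2 \<partial>M) \<le> (\<Sum>k<m. \<integral>\<omega>. (g k \<omega>)\<^sup>2 \<partial>M)"
    unfolding T_def by (rule predictable_sum_second_moment[OF gF gC])
  also have "(\<Sum>k<m. \<integral>\<omega>. (g k \<omega>)\<^sup>2 \<partial>M) \<le> (\<Sum>k<m. if k \<in> {N..<m} then prob A * (w k)\<^sup>2 else 0)"
  proof (rule sum_mono)
    fix k assume k: "k \<in> {..<m}"
    show "(\<integral>\<omega>. (g k \<omega>)\<^sup>2 \<partial>M) \<le> (if k \<in> {N..<m} then prob A * (w k)\<^sup>2 else 0)"
    proof (cases "N \<le> k")
      case True
      \<comment> \<open>Dropping \<open>G k\<close> but keeping \<open>A\<close> in the indicator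
        produces the factor \<open>prob A\<close>.\<close>
      have "(\<integral>\<omega>. (g k \<omega>)\<^sup>2 \<partial>M) \<le> (\<integral>\<omega>. (w k)\<^sup>2 * indicat_real A \<omega> \<partial>M)"
      proof (rule integral_mono)
        show "integrable M (\<lambda>\<omega>. (g k \<omega>)\<^sup>2)"
          using power_mono[OF gC abs_ge_zero, of _ _ 2]
          by (intro integrable_bounded[where C = "(w k)\<^sup>2"]) auto
        show "integrable M (\<lambda>\<omega>. (w k)\<^sup>2 * indicat_real A \<omega>)"
          by (intro integrable_mult_right integrable_real_indicator) (auto simp: emeasure_eq_measure)
      qed (auto simp: g_def indicator_def)
      also have "\<dots> = (w k)\<^sup>2 * prob A" by simp
      finally show ?thesis using True k by (simp add: mult.commute)
    qed (simp add: g_def)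
  qed
  also have "\<dots> = (\<Sum>k\<in>{..<m} \<inter> {N..<m}. prob A * (w k)\<^sup>2)"
    by (rule sum.inter_restrict[symmetric]) simp
  also have "{..<m} \<inter> {N..<m} = {N..<m}" by auto
  finally show ?thesis using e by (simp add: sum_distrib_left divide_right_mono)
qed

text \<open>The finite version passes to the limit along increasing events. The factor
  \<open>prob A\<close> makes the bound a conditional one: the bad part is a fixed fraction of
  \<open>A\<close>, however small \<open>A\<close> is.\<close>

lemma noise_maximal_inequality:
  assumes A: "A \<in> sets (F N)" and e: "0 < \<epsilon>" and C: "\<And>m. (\<Sum>k=N..<m. (w k)\<^sup>2) \<le> C"
  shows "prob (A \<inter> {\<omega> \<in> space M. \<exists>n\<ge>N. \<epsilon> \<le> \<bar>\<Sum>k=N..<n. w k * noise k \<omega>\<bar>}) \<le> prob A * C / \<epsilon>\<^sup>2"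
proof -
  define E where "E = (\<lambda>m. A \<inter> {\<omega> \<in> space M. \<exists>n\<in>{N..m}. \<epsilon> \<le> \<bar>\<Sum>k=N..<n. w k * noise k \<omega>\<bar>})"
  have [measurable]: "A \<in> sets M" using sets_F_M A by blast
  have "(\<lambda>m. prob (E m)) \<longlonglongrightarrow> prob (\<Union>m. E m)"
  proof (rule finite_Lim_measure_incseq)
    show "range E \<subseteq> sets M" unfolding E_def by auto
    show "incseq E" unfolding E_def incseq_def by fastforce
  qed
  moreover have "prob (E m) \<le> prob A * C / \<epsilon>\<^sup>2" for m
  proof -
    have "prob (E m) \<le> prob A * (\<Sum>k=N..<m. (w k)\<^sup>2) / \<epsilon>\<^sup>2"
      unfolding E_def by (rule noise_maximal_inequality_finite[OF A e])
    also have "\<dots> \<le> prob A * C / \<epsilon>\<^sup>2"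
      using C[of m] by (intro divide_right_mono mult_left_mono) auto
    finally show ?thesis .
  qed
  ultimately have "prob (\<Union>m. E m) \<le> prob A * C / \<epsilon>\<^sup>2"
    by (intro LIMSEQ_le_const2) auto
  also have "(\<Union>m. E m) = A \<inter> {\<omega> \<in> space M. \<exists>n\<ge>N. \<epsilon> \<le> \<bar>\<Sum>k=N..<n. w k * noise k \<omega>\<bar>}"
    unfolding E_def by (auto 0 3)
  finally show ?thesis .
qed

end

section \<open>Almost sure convergence to a fixed point\<close>

context urn_process
begin

lemma step_bounds:
  "\<forall>\<^sub>F n in sequentially. 0 < n \<and> 1 / (2 * real n) \<le> r n \<and> r n \<le> 2 / real n"
proof -
  have "\<forall>\<^sub>F n in sequentially. 1 / 2 < real n * r n" "\<forall>\<^sub>F n in sequentially. real n * r n < 2"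
    using order_tendstoD(1)[OF step_asymp, of "1/2"] order_tendstoD(2)[OF step_asymp, of 2] by auto
  then show ?thesis using eventually_gt_at_top[of 0]
    by eventually_elim (auto simp: field_simps)
qed

lemma step_nonneg: "0 \<le> r n" and step_le_1: "r n \<le> 1"
  using step_range[of n] by auto

lemma step_tendsto_0: "r \<longlonglongrightarrow> 0"
proof (rule tendsto_sandwich[where f = "\<lambda>_. 0"])
  show "(\<lambda>n. 2 / real n) \<longlonglongrightarrow> 0" by (rule lim_const_over_n)
  show "\<forall>\<^sub>F n in sequentially. r n \<le> 2 / real n" using step_bounds by eventually_elim auto
qed (use step_nonneg in auto)

lemma step_not_summable: "\<not> summable r"
proof (rule not_summable_mono_eventually)
  show "\<not> summable (\<lambda>n. inverse 2 * inverse (real n))"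
    using not_summable_harmonic[where 'a = real] summable_cmult_iff[of "inverse (2::real)" "\<lambda>n. inverse (real n)"]
    by simp
  show "\<forall>\<^sub>F n in sequentially. 0 \<le> inverse 2 * inverse (real n) \<and> inverse 2 * inverse (real n) \<le> r n"
    using step_bounds by eventually_elim (auto simp: field_simps)
qed

text \<open>With \<open>r n\<close> of order \<open>1/n\<close> the terms are of order
  \<open>n powr (-3/2)\<close>. The weight \<open>n powr (1/4)\<close> is the one attached to the
  distance from the barrier later on.\<close>

lemma weighted_step_square_summable: "summable (\<lambda>n. (real (Suc n) powr (1/4) * r n)\<^sup>2)"
proof (rule summable_comparison_test_ev)
  show "summable (\<lambda>n. 8 * real n powr (-3/2))"
    by (intro summable_mult) (simp add: summable_real_powr_iff)
  show "\<forall>\<^sub>F n in sequentially. norm ((real (Suc n) powr (1/4) * r n)\<^sup>2) \<le> 8 * real n powr (-3/2)"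
    using step_bounds
  proof eventually_elim
    case (elim n)
    have n: "real n > 0" using elim by simp
    have "(real (Suc n) powr (1/4))\<^sup>2 = real (Suc n) powr (1/2)"
      by (simp add: power2_eq_square flip: powr_add)
    \<comment> \<open>The crude bound \<open>n + 1 \<le> 4 * n\<close> is chosen for its exact
      square root; together with the square of \<open>2 / n\<close> it gives the constant 8.\<close>
    also have "\<dots> \<le> (4 * real n) powr (1/2)" using elim by (intro powr_mono2) auto
    also have "\<dots> = 2 * real n powr (1/2)" by (simp add: powr_mult powr_half_sqrt)
    finally have 1: "(real (Suc n) powr (1/4))\<^sup>2 \<le> 2 * real n powr (1/2)" .
    have 2: "(r n)\<^sup>2 \<le> (2 / real n)\<^sup>2" using elim step_nonneg by (intro power_mono) auto
    have "(real (Suc n) powr (1/4) * r n)\<^sup>2 \<le> (2 * real n powr (1/2)) * (2 / real n)\<^sup>2"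
      unfolding power_mult_distrib using 1 2 by (intro mult_mono) auto
    also have "\<dots> = 8 * (real n powr (1/2) * real n powr (-2))"
      using n by (simp add: powr_minus divide_simps powr_numeral)
    also have "\<dots> = 8 * real n powr (-3/2)" by (simp flip: powr_add)
    finally show ?case by simp
  qed
qed

lemma step_square_summable: "summable (\<lambda>n. (r n)\<^sup>2)"
proof (rule summable_comparison_test[OF _ weighted_step_square_summable], intro exI allI impI)
  fix n :: nat
  have "1 \<le> real (Suc n) powr (1/4)" by (rule ge_one_powr_ge_zero) auto
  then have "1 * r n \<le> real (Suc n) powr (1/4) * r n" using step_nonneg by (intro mult_right_mono)
  then show "norm ((r n)\<^sup>2) \<le> (real (Suc n) powr (1/4) * r n)\<^sup>2"
    using step_nonneg[of n] power_mono[of "r n" _ 2] by simp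
qed

text \<open>\<open>D j\<close> collects the paths that oscillate by \<open>1 / (j + 1)\<close> after
  every starting time. The maximal inequality on the whole space bounds its probability by a tail of
  the summable squares, hence by 0, and outside all \<open>D j\<close> the partial sums are
  Cauchy.\<close>

lemma noise_series_converges: "AE \<omega> in M. convergent (\<lambda>n. \<Sum>k<n. r k * noise k \<omega>)"
proof -
  define D where "D = (\<lambda>j. {\<omega> \<in> space M. \<forall>N. \<exists>n\<ge>N. 1 / real (Suc j) \<le> \<bar>\<Sum>k=N..<n. r k * noise k \<omega>\<bar>})"
  have D[measurable]: "D j \<in> sets M" for j unfolding D_def by measurable
  have "prob (D j) = 0" for j
  proof -
    have "prob (D j) \<le> e" if e: "0 < e" for e
    proof -
      \<comment> \<open>Scaled so that the maximal inequality returns exactly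
        \<open>e\<close>.\<close>
      define c where "c = e * (1 / real (Suc j))\<^sup>2"
      have "0 < c" using e by (simp add: c_def)
      then obtain N where N: "\<And>m. norm (\<Sum>k=N..<m. (r k)\<^sup>2) < c"
        using step_square_summable unfolding summable_Cauchy by blast
      have "prob (D j) \<le> prob (space M \<inter> {\<omega> \<in> space M. \<exists>n\<ge>N. 1 / real (Suc j) \<le> \<bar>\<Sum>k=N..<n. r k * noise k \<omega>\<bar>})"
        by (intro finite_measure_mono) (auto simp: D_def)
      also have "\<dots> \<le> prob (space M) * c / (1 / real (Suc j))\<^sup>2"
      proof (rule noise_maximal_inequality)
        show "space M \<in> sets (F N)" using sets.top[of "F N"] by (simp add: space_F)
        show "(\<Sum>k=N..<m. (r k)\<^sup>2) \<le> c" for m using N[of m] by simp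
      qed simp
      also have "\<dots> = e" by (simp add: prob_space c_def power2_eq_square)
      finally show ?thesis .
    qed
    then have "\<not> 0 < prob (D j)" by (metis field_sum_of_halves less_add_same_cancel1 half_gt_zero not_less)
    then show ?thesis using measure_nonneg[of M "D j"] by linarith
  qed
  then have "AE \<omega> in M. \<omega> \<notin> D j" for j using prob_eq_0[OF D] by blast
  then have "AE \<omega> in M. \<forall>j. \<omega> \<notin> D j" by (simp add: AE_all_countable)
  then show ?thesis
  proof (rule AE_mp, intro AE_I2 impI)
    fix \<omega> assume w: "\<omega> \<in> space M" "\<forall>j. \<omega> \<notin> D j"
    have D_lt: "\<exists>N. \<forall>n\<ge>N. \<bar>\<Sum>k=N..<n. r k * noise k \<omega>\<bar> < 1 / real (Suc j)" for j
      using w unfolding D_def mem_Collect_eq by (meson not_le)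
    have "Cauchy (\<lambda>n. \<Sum>k<n. r k * noise k \<omega>)"
    proof (rule metric_CauchyI)
      fix e :: real assume "0 < e"
      then obtain j where j: "inverse (real (Suc j)) < e / 2" using reals_Archimedean[of "e/2"] by auto
      obtain N where N: "\<And>n. n \<ge> N \<Longrightarrow> \<bar>\<Sum>k=N..<n. r k * noise k \<omega>\<bar> < 1 / real (Suc j)"
        using D_lt[of j] by blast
      have tail: "\<bar>(\<Sum>k<n. r k * noise k \<omega>) - (\<Sum>k<N. r k * noise k \<omega>)\<bar> < e / 2" if "n \<ge> N" for n
      proof -
        have "(\<Sum>k<n. r k * noise k \<omega>) = (\<Sum>k<N. r k * noise k \<omega>) + (\<Sum>k=N..<n. r k * noise k \<omega>)"
          using sum.atLeastLessThan_concat[of 0 N n "\<lambda>k. r k * noise k \<omega>"] that by (simp add: lessThan_atLeast0)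
        then show ?thesis using N[OF that] j by (simp add: inverse_eq_divide)
      qed
      have "dist (\<Sum>k<m. r k * noise k \<omega>) (\<Sum>k<n. r k * noise k \<omega>) < e" if "m \<ge> N" "n \<ge> N" for m n
        using tail[OF that(1)] tail[OF that(2)] unfolding dist_real_def by linarith
      then show "\<exists>N. \<forall>m\<ge>N. \<forall>n\<ge>N. dist (\<Sum>k<m. r k * noise k \<omega>) (\<Sum>k<n. r k * noise k \<omega>) < e"
        by blast
    qed
    then show "convergent (\<lambda>n. \<Sum>k<n. r k * noise k \<omega>)" by (simp add: Cauchy_convergent_iff)
  qed
qed

lemma Z_drift:
  "\<omega> \<in> space M \<Longrightarrow> Z (Suc n) \<omega> = Z n \<omega> + r n * (f (Z n \<omega>) - Z n \<omega>) + r n * noise n \<omega>"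
  using Z_step[of \<omega> n] by (simp add: noise_def algebra_simps)

lemma AE_limit_is_fixed_point:
  assumes fin: "finite {x. f x = x}"
  shows "AE \<omega> in M. \<exists>p. f p = p \<and> (\<lambda>n. Z n \<omega>) \<longlonglongrightarrow> p"
  using noise_series_converges
proof (rule AE_mp, intro AE_I2 impI)
  fix \<omega> assume w: "\<omega> \<in> space M" and conv: "convergent (\<lambda>n. \<Sum>k<n. r k * noise k \<omega>)"
  have "\<exists>p. f p - p = 0 \<and> (\<lambda>n. Z n \<omega>) \<longlonglongrightarrow> p"
  proof (rule perturbed_Euler_scheme_converges_to_zero[where K = 1 and h = "\<lambda>x. f x - x"
        and r = r and s = "\<lambda>n. \<Sum>k<n. r k * noise k \<omega>"])
    show "\<bar>Z n \<omega>\<bar> \<le> 1" for n using Z_range[OF w, of n] by auto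
    show "continuous_on UNIV (\<lambda>x. f x - x)" by (intro continuous_intros f_cont)
  qed (use step_nonneg step_tendsto_0 step_not_summable conv fin Z_drift[OF w] in auto)
  then show "\<exists>p. f p = p \<and> (\<lambda>n. Z n \<omega>) \<longlonglongrightarrow> p" by simp
qed

text \<open>Compactness makes the bounds uniform. The constant \<open>q\<close> bounds the
  conditional probability of either draw from below, hence the conditional variance of a draw by
  \<open>q\<^sup>2\<close>.\<close>

lemma f_bounded_away:
  obtains q where "0 < q" "\<And>x. x \<in> {0..1} \<Longrightarrow> q \<le> f x \<and> f x \<le> 1 - q"
proof -
  have c: "continuous_on {0..1} f" using f_cont continuous_on_subset by blast
  obtain u where u: "\<forall>x\<in>{0..1}. f u \<le> f x"
    using continuous_attains_inf[OF compact_Icc _ c] by auto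
  obtain v where v: "\<forall>x\<in>{0..1}. f x \<le> f v"
    using continuous_attains_sup[OF compact_Icc _ c] by auto
  show thesis
  proof (rule that[of "min (f u) (1 - f v)"])
    show "0 < min (f u) (1 - f v)" using f_range[of u] f_range[of v] by auto
    show "min (f u) (1 - f v) \<le> f x \<and> f x \<le> 1 - min (f u) (1 - f v)" if "x \<in> {0..1}" for x
      using u[rule_format, OF that] v[rule_format, OF that] by linarith
  qed
qed

lemma Z_le_event: "{\<omega> \<in> space M. Z n \<omega> \<le> e} \<in> sets (F n)"
proof -
  note [measurable] = Z_adapted[of n]
  have "{\<omega> \<in> space (F n). Z n \<omega> \<le> e} \<in> sets (F n)" by measurable
  then show ?thesis by (simp add: space_F)
qed

text \<open>If the first \<open>n\<close> draws are all 0, which has probability at least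
  \<open>q ^ n\<close>, then \<open>Z n\<close> is at most the product of the factors
  \<open>1 - r k\<close>, and this product tends to 0.\<close>

lemma low_state_reachable:
  assumes e: "0 < e"
  shows "\<forall>\<^sub>F n in sequentially. 0 < prob {\<omega> \<in> space M. Z n \<omega> \<le> e}"
proof -
  obtain q where q: "0 < q" "\<And>x. x \<in> {0..1} \<Longrightarrow> q \<le> f x \<and> f x \<le> 1 - q"
    by (rule f_bounded_away) blast
  define E where "E = (\<lambda>n. {\<omega> \<in> space M. \<forall>k\<in>{..<n}. I (Suc k) \<omega> = 0})"
  have EF: "E n \<in> sets (F n)" for n
  proof -
    have [measurable]: "I (Suc k) \<in> borel_measurable (F n)" if "k \<in> {..<n}" for k
      using that by (intro measurable_F_mono[OF I_adapted]) auto
    have "{\<omega> \<in> space (F n). \<forall>k\<in>{..<n}. I (Suc k) \<omega> = 0} \<in> sets (F n)" by measurable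
    then show ?thesis unfolding E_def space_F .
  qed
  then have [measurable]: "E n \<in> sets M" for n using sets_F_M by blast
  have ge: "q ^ n \<le> prob (E n)" for n
  proof (induction n)
    case 0
    then show ?case by (simp add: E_def prob_space)
  next
    case (Suc n)
    note [measurable] = measurable_F_M[OF fZ_adapted]
    have I_abs: "\<bar>I (Suc n) \<omega>\<bar> \<le> 1" if "\<omega> \<in> space M" for \<omega>
      using I_values[OF that, of n] by auto
    have f_abs: "\<bar>f t\<bar> \<le> 1" for t
      using f_range[of t] by auto
    have i1: "integrable M (\<lambda>\<omega>. indicat_real (E n) \<omega> * I (Suc n) \<omega>)"
      by (rule integrable_bounded[where C = 1]) (use I_abs in \<open>auto simp: indicator_def\<close>)
    have i2: "integrable M (\<lambda>\<omega>. indicat_real (E n) \<omega> * f (Z n \<omega>))"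
      by (rule integrable_bounded[where C = 1])
        (use f_abs in \<open>auto simp: indicator_def\<close>)
    have i0: "integrable M (indicat_real (E n))"
      by (rule integrable_real_indicator) (auto simp: emeasure_eq_measure)
    have mean: "(\<integral>\<omega>. indicat_real (E n) \<omega> * I (Suc n) \<omega> \<partial>M) = (\<integral>\<omega>. indicat_real (E n) \<omega> * f (Z n \<omega>) \<partial>M)"
      by (rule I_mean[where C = 1]) (use EF in auto)
    have "q * q ^ n \<le> q * prob (E n)" using Suc q(1) by (intro mult_left_mono) auto
    also have "\<dots> = (\<integral>\<omega>. q * indicat_real (E n) \<omega> \<partial>M)" by simp
    also have "\<dots> \<le> (\<integral>\<omega>. indicat_real (E n) \<omega> - indicat_real (E n) \<omega> * f (Z n \<omega>) \<partial>M)"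
    proof (rule integral_mono)
      fix \<omega> assume "\<omega> \<in> space M"
      then show "q * indicat_real (E n) \<omega> \<le> indicat_real (E n) \<omega> - indicat_real (E n) \<omega> * f (Z n \<omega>)"
        using q(2)[OF Z_range[of \<omega> n]] by (auto simp: indicator_def)
    qed (use i0 i2 in auto)
    also have "\<dots> = (\<integral>\<omega>. indicat_real (E n) \<omega> - indicat_real (E n) \<omega> * I (Suc n) \<omega> \<partial>M)"
      using mean i0 i1 i2 by simp
    also have "\<dots> = (\<integral>\<omega>. indicat_real (E (Suc n)) \<omega> \<partial>M)"
    proof (rule Bochner_Integration.integral_cong[OF refl])
      fix \<omega> assume "\<omega> \<in> space M"
      then show "indicat_real (E n) \<omega> - indicat_real (E n) \<omega> * I (Suc n) \<omega> = indicat_real (E (Suc n)) \<omega>"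
        using I_values[of \<omega> n] by (auto simp: E_def indicator_def less_Suc_eq)
    qed
    also have "\<dots> = prob (E (Suc n))" by simp
    finally show ?case by simp
  qed
  have Zle: "Z n \<omega> \<le> (\<Prod>k=0..<n. 1 - r k)" if "\<omega> \<in> E n" for n \<omega>
    using that
  proof (induction n)
    case 0
    then show ?case using Z_range[of \<omega> 0] by (auto simp: E_def)
  next
    case (Suc n)
    have w: "\<omega> \<in> space M" "I (Suc n) \<omega> = 0" "\<omega> \<in> E n" using Suc.prems by (auto simp: E_def)
    have "(1 - r n) * Z n \<omega> \<le> (1 - r n) * (\<Prod>k=0..<n. 1 - r k)"
      using step_le_1[of n] Suc.IH[OF w(3)] by (intro mult_left_mono) auto
    then show ?case using Z_step[OF w(1), of n] w(2) by (simp add: mult.commute)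
  qed
  have "(\<lambda>n. \<Prod>k=0..<n. 1 - r k) \<longlonglongrightarrow> 0"
    by (rule prod_one_minus_tendsto_0[OF step_nonneg step_le_1 step_not_summable])
  then have "\<forall>\<^sub>F n in sequentially. (\<Prod>k=0..<n. 1 - r k) < e" using e by (rule order_tendstoD)
  then show ?thesis
  proof eventually_elim
    case (elim n)
    have "0 < prob (E n)" using ge[of n] q(1) zero_less_power[of q n] by linarith
    also have "prob (E n) \<le> prob {\<omega> \<in> space M. Z n \<omega> \<le> e}"
    proof (rule finite_measure_mono)
      show "E n \<subseteq> {\<omega> \<in> space M. Z n \<omega> \<le> e}" using Zle[of _ n] elim by (force simp: E_def)
    qed simp
    finally show ?case .
  qed
qed

end

section \<open>Convergence below a barrier\<close>

text \<open>The weight grows per step by a relative amount of about \<open>1 / (4 * n)\<close>,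
  while the barrier drift costs at most \<open>\<rho> / 16 \<le> 1 / (8 * n)\<close>. This surplus
  is what lets the weighted distance survive the drift.\<close>

lemma quarter_power_growth:
  fixes n :: nat and \<rho> :: real
  assumes n: "0 < n" and \<rho>: "\<rho> \<le> 2 / real n"
  shows "real n powr (1/4) \<le> real (Suc n) powr (1/4) * (1 - \<rho> / 16)"
proof -
  \<comment> \<open>Bernoulli gives \<open>t ^ 4 \<ge> 1 - 1 / (2 * n) \<ge> n / (n + 1)\<close>, so
    \<open>t\<close> is an upper bound for the quotient of consecutive quarter powers.\<close>
  define t where "t = 1 - 1 / (8 * real n)"
  have n1: "1 \<le> real n" using n by simp
  then have t: "0 < t" by (simp add: t_def field_simps)
  have "1 + real 4 * (- (1 / (8 * real n))) \<le> (1 + - (1 / (8 * real n))) ^ 4"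
    using n1 by (intro Bernoulli_inequality) (simp add: field_simps)
  then have t4: "1 - 1 / (2 * real n) \<le> t ^ 4" by (simp add: t_def)
  have "real n \<le> real (Suc n) * (1 - 1 / (2 * real n))"
    using n1 by (simp add: field_simps)
  also have "\<dots> \<le> real (Suc n) * t ^ 4" using t4 by (intro mult_left_mono) auto
  finally have "real n powr (1/4) \<le> (real (Suc n) * t ^ 4) powr (1/4)"
    using n1 by (intro powr_mono2) auto
  also have "\<dots> = real (Suc n) powr (1/4) * (t ^ 4) powr (1/4)"
    using t by (simp add: powr_mult)
  also have "(t ^ 4) powr (1/4) = (t powr 4) powr (1/4)" using t by simp
  also have "(t powr 4) powr (1/4) = t powr (4 * (1/4))" by (rule powr_powr)
  also have "t powr (4 * (1/4)) = t" using t by simp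
  also have "real (Suc n) powr (1/4) * t \<le> real (Suc n) powr (1/4) * (1 - \<rho> / 16)"
    using \<rho> by (intro mult_left_mono) (auto simp: t_def)
  finally show ?thesis .
qed

context urn_process
begin

text \<open>With \<open>w n = n powr (1/4)\<close> the weighted distance \<open>w n * (B - Z n)\<close> to the barrier is, up to the
  martingale \<open>S\<close>, nondecreasing on \<open>[B0, B]\<close>, because \<open>1/16 < 1/4\<close>; and \<open>S\<close> is bounded in \<open>L\<^sup>2\<close>,
  because \<open>1/4 < 1/2\<close>. So a process that starts far enough below \<open>B\<close> may never cross \<open>B\<close>,
  even if \<open>B\<close> is a fixed point that repels on its other side.\<close>

lemma stays_below_barrier:
  assumes B: "0 < B0" "B0 < B"
    and drift: "\<And>x. B0 \<le> x \<Longrightarrow> x \<le> B \<Longrightarrow> f x - x \<le> (B - x) / 16"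
  shows "\<exists>N. 0 < prob {\<omega> \<in> space M. \<forall>n\<ge>N. Z n \<omega> \<le> B}"
proof -
  define W where "W = (\<lambda>n::nat. real n powr (1/4))"
  define d where "d = B - B0"
  have d: "0 < d" using B by (simp add: d_def)
  have W0: "0 \<le> W n" for n by (simp add: W_def)
  have "filterlim W at_top sequentially" unfolding W_def by real_asymp
  \<comment> \<open>The 6 makes \<open>W n * (d / 2)\<close> at least 3: one unit is reserved for
    the martingale \<open>S\<close>, and 2 remain for the invariant below.\<close>
  then have e1: "\<forall>\<^sub>F n in sequentially. 6 / d \<le> W n" by (simp add: filterlim_at_top)
  have e2: "\<forall>\<^sub>F n in sequentially. r n < d / 2"
    using step_tendsto_0 d by (intro order_tendstoD(2)) auto
  have "\<forall>\<^sub>F n in sequentially. 6 / d \<le> W n \<and> r n < d / 2 \<and> 0 < n \<and> r n \<le> 2 / real n"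
    using e1 e2 step_bounds by eventually_elim auto
  then obtain N1 where N1: "\<And>n. n \<ge> N1 \<Longrightarrow> 6 / d \<le> W n \<and> r n < d / 2 \<and> 0 < n \<and> r n \<le> 2 / real n"
    unfolding eventually_sequentially by blast
  obtain N2 where N2: "\<And>n. n \<ge> N2 \<Longrightarrow> 0 < prob {\<omega> \<in> space M. Z n \<omega> \<le> B0}"
    using low_state_reachable[OF B(1)] unfolding eventually_sequentially by blast
  \<comment> \<open>A tail of at most 1/2 makes the maximal inequality at level 1 lose at most half
    of the starting event \<open>A\<close>.\<close>
  obtain N3 where N3: "\<And>n m. n \<ge> N3 \<Longrightarrow> norm (\<Sum>k=n..<m. (real (Suc k) powr (1/4) * r k)\<^sup>2) < 1/2"
    using weighted_step_square_summable unfolding summable_Cauchy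
    by (metis half_gt_zero_iff zero_less_one)
  define N where "N = Max {N1, N2, N3}"
  have N: "N \<ge> N1" "N \<ge> N2" "N \<ge> N3" by (auto simp: N_def)
  define A where "A = {\<omega> \<in> space M. Z N \<omega> \<le> B0}"
  define S where "S = (\<lambda>n \<omega>. \<Sum>k=N..<n. (W (Suc k) * r k) * noise k \<omega>)"
  have AF: "A \<in> sets (F N)" unfolding A_def by (rule Z_le_event)
  have bad: "prob (A \<inter> {\<omega> \<in> space M. \<exists>n\<ge>N. 1 \<le> \<bar>S n \<omega>\<bar>}) \<le> prob A * (1/2) / 1\<^sup>2"
    unfolding S_def
  proof (rule noise_maximal_inequality[OF AF])
    show "(\<Sum>k=N..<m. (W (Suc k) * r k)\<^sup>2) \<le> 1 / 2" for m
      using N3[OF N(3), of m] by (simp add: W_def)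
  qed simp
  have stay: "Z n \<omega> \<le> B" if w: "\<omega> \<in> A" "\<omega> \<in> space M" and good: "\<And>n. n \<ge> N \<Longrightarrow> \<bar>S n \<omega>\<bar> < 1" and "n \<ge> N" for n \<omega>
  proof -
    have far: "3 \<le> W n * (d / 2)" if "n \<ge> N" for n
    proof -
      have "6 / d * (d / 2) \<le> W n * (d / 2)" using N1[of n] that N(1) d by (intro mult_right_mono) auto
      then show ?thesis using d by simp
    qed
    \<comment> \<open>As \<open>\<bar>S\<bar> < 1\<close>, the bound 2 leaves a weighted distance
      above 1, so the path is strictly below \<open>B\<close> and the drift hypothesis remains
      applicable.\<close>
    have inv: "2 \<le> W n * (B - Z n \<omega>) + S n \<omega>" if "n \<ge> N" for n
      using that
    proof (induction n rule: dec_induct)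
      case base
      have "W N * (d / 2) \<le> W N * (B - Z N \<omega>)"
        using w d W0 by (intro mult_left_mono) (auto simp: A_def d_def)
      then show ?case using far[of N] by (simp add: S_def)
    next
      case (step n)
      have n: "n \<ge> N1" "n \<ge> N" using step N by auto
      have Snext: "S (Suc n) \<omega> = S n \<omega> + W (Suc n) * (r n * noise n \<omega>)"
        using step by (simp add: S_def mult.assoc)
      show ?case
      proof (cases "B0 \<le> Z n \<omega>")
        case True
        have "1 < W n * (B - Z n \<omega>)" using step.IH good[OF n(2)] by linarith
        then have "0 < B - Z n \<omega>" using W0[of n]
          by (metis less_le_trans less_trans mult_nonneg_nonpos not_le zero_less_one)
        then have ZB: "Z n \<omega> \<le> B" by simp
        have "W n * (B - Z n \<omega>) \<le> W (Suc n) * (1 - r n / 16) * (B - Z n \<omega>)"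
          using quarter_power_growth[of n "r n"] N1[OF n(1)] ZB unfolding W_def
          by (intro mult_right_mono) auto
        also have "\<dots> = W (Suc n) * (B - Z n \<omega> - r n * ((B - Z n \<omega>) / 16))"
          by (simp add: algebra_simps)
        also have "\<dots> \<le> W (Suc n) * (B - Z n \<omega> - r n * (f (Z n \<omega>) - Z n \<omega>))"
          using drift[OF True ZB] step_nonneg[of n] W0
          by (intro mult_left_mono diff_left_mono) auto
        also have "\<dots> = W (Suc n) * (B - Z (Suc n) \<omega>) + W (Suc n) * (r n * noise n \<omega>)"
          unfolding distrib_left[symmetric] using Z_drift[OF w(2), of n] by simp
        finally show ?thesis using step.IH Snext by linarith
      next
        \<comment> \<open>Below \<open>B0\<close> nothing is assumed on the drift. One step is
          shorter than \<open>d / 2\<close>, so the path is still at distance at least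
          \<open>d / 2\<close> from \<open>B\<close> and the invariant holds afresh.\<close>
        case False
        have "Z (Suc n) \<omega> - Z n \<omega> = r n * (I (Suc n) \<omega> - Z n \<omega>)"
          using Z_step[OF w(2), of n] by (simp add: algebra_simps)
        also have "\<dots> \<le> r n * 1"
          using I_values[OF w(2), of n] Z_range[OF w(2), of n] step_nonneg
          by (intro mult_left_mono) auto
        finally have "d / 2 \<le> B - Z (Suc n) \<omega>" using N1[OF n(1)] False by (simp add: d_def)
        then have "W (Suc n) * (d / 2) \<le> W (Suc n) * (B - Z (Suc n) \<omega>)"
          using W0 by (intro mult_left_mono)
        then show ?thesis using far[of "Suc n"] good[of "Suc n"] n(2) by linarith
      qed
    qed
    have "1 < W n * (B - Z n \<omega>)" using inv[OF \<open>n \<ge> N\<close>] good[OF \<open>n \<ge> N\<close>] by linarith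
    then have "0 < B - Z n \<omega>" using W0[of n]
      by (metis less_le_trans less_trans mult_nonneg_nonpos not_le zero_less_one)
    then show ?thesis by simp
  qed
  let ?G = "{\<omega> \<in> space M. \<forall>n\<ge>N. Z n \<omega> \<le> B}" and ?D = "A \<inter> {\<omega> \<in> space M. \<exists>n\<ge>N. 1 \<le> \<bar>S n \<omega>\<bar>}"
  have [measurable]: "S n \<in> borel_measurable M" for n unfolding S_def by measurable
  have [measurable]: "A \<in> sets M" using AF sets_F_M by blast
  have "A \<subseteq> ?D \<union> ?G"
  proof
    fix \<omega> assume A: "\<omega> \<in> A"
    then have w: "\<omega> \<in> space M" by (simp add: A_def)
    show "\<omega> \<in> ?D \<union> ?G"
    proof (cases "\<exists>n\<ge>N. 1 \<le> \<bar>S n \<omega>\<bar>")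
      case False
      then have "\<bar>S n \<omega>\<bar> < 1" if "n \<ge> N" for n using that by (meson not_le)
      then show ?thesis using stay[OF A w] w by blast
    qed (use A w in blast)
  qed
  then have "prob A \<le> prob (?D \<union> ?G)" by (intro finite_measure_mono) auto
  also have "\<dots> \<le> prob ?D + prob ?G" by (intro measure_Un_le) auto
  finally have "prob A / 2 \<le> prob ?G" using bad by simp
  moreover have "0 < prob A" using N2[OF N(2)] by (simp add: A_def)
  ultimately have "0 < prob ?G" by linarith
  then show ?thesis by blast
qed

text \<open>A path that stays below \<open>B\<close> has its limit there too, and \<open>a\<close>
  is the only fixed point available.\<close>

lemma converges_below_barrier:
  assumes "0 < B0" "B0 < B" "\<And>x. B0 \<le> x \<Longrightarrow> x \<le> B \<Longrightarrow> f x - x \<le> (B - x) / 16"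
    and fin: "finite {x. f x = x}"
    and a: "\<And>x. f x = x \<Longrightarrow> x \<le> B \<Longrightarrow> x = a"
  shows "0 < prob {\<omega> \<in> space M. (\<lambda>n. Z n \<omega>) \<longlonglongrightarrow> a}"
proof -
  obtain N where N: "0 < prob {\<omega> \<in> space M. \<forall>n\<ge>N. Z n \<omega> \<le> B}"
    using stays_below_barrier[OF assms(1-3)] by blast
  also have "\<dots> \<le> prob {\<omega> \<in> space M. (\<lambda>n. Z n \<omega>) \<longlonglongrightarrow> a}"
  proof (rule finite_measure_mono_AE)
    show "AE \<omega> in M. \<omega> \<in> {\<omega> \<in> space M. \<forall>n\<ge>N. Z n \<omega> \<le> B} \<longrightarrow> \<omega> \<in> {\<omega> \<in> space M. (\<lambda>n. Z n \<omega>) \<longlonglongrightarrow> a}"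
      using AE_limit_is_fixed_point[OF fin]
    proof (rule AE_mp, intro AE_I2 impI)
      fix \<omega> assume "\<exists>p. f p = p \<and> (\<lambda>n. Z n \<omega>) \<longlonglongrightarrow> p" and w: "\<omega> \<in> {\<omega> \<in> space M. \<forall>n\<ge>N. Z n \<omega> \<le> B}"
      then obtain p where p: "f p = p" "(\<lambda>n. Z n \<omega>) \<longlonglongrightarrow> p" by blast
      have "p \<le> B" using w p(2) by (intro LIMSEQ_le_const2[OF p(2)]) auto
      then show "\<omega> \<in> {\<omega> \<in> space M. (\<lambda>n. Z n \<omega>) \<longlonglongrightarrow> a}" using a[OF p(1)] p(2) w by simp
    qed
  qed measurable
  finally show ?thesis .
qed

end

section \<open>Nonconvergence to unstable fixed points\<close>

text \<open>The second-order expansion of the reciprocal with its exact remainder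
  \<open>D\<^sup>2 / (s\<^sup>2 * (s + D))\<close>; only the last denominator is estimated.\<close>

lemma inverse_expansion_bound:
  fixes s D b :: real
  assumes "0 < b" "0 < s" "b \<le> s + D"
  shows "1 / (s + D) \<le> 1 / s - (1 / s)\<^sup>2 * D + (1 / s)\<^sup>2 * (D\<^sup>2 / b)"
proof -
  have pos: "0 < s + D" using assms by linarith
  have "1 / (s + D) = 1 / s - (1 / s)\<^sup>2 * D + (1 / s)\<^sup>2 * (D\<^sup>2 / (s + D))"
    using assms(2) pos by (simp add: divide_simps) (simp add: algebra_simps power2_eq_square)
  also have "\<dots> \<le> 1 / s - (1 / s)\<^sup>2 * D + (1 / s)\<^sup>2 * (D\<^sup>2 / b)"
    using assms by (intro add_left_mono mult_left_mono divide_left_mono) auto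
  finally show ?thesis .
qed

text \<open>Here \<open>x\<close> is the displacement of the state \<open>z\<close> from the fixed
  point, and the two summands are the outcomes of the draws 1 and 0. In the mean of the quadratic,
  drift gains \<open>2 * \<kappa> * r\<close> relative to \<open>u * x\<^sup>2\<close>, shrinking
  \<open>u\<close> costs \<open>\<kappa> / 4 * r\<close>, and the variance adds at least
  \<open>q\<^sup>2 * r\<^sup>2\<close> times the new scale. The choice
  \<open>b = 36 / \<kappa>\<close> lets the drift absorb the second-order error, so the gain from
  the variance survives even at \<open>x = 0\<close>.\<close>

lemma expected_inverse_quadratic_step:
  fixes x z \<phi> r u \<kappa> q b :: real
  assumes z: "0 \<le> z" "z \<le> 1" and x: "\<bar>x\<bar> \<le> 1"
    and \<phi>: "q \<le> \<phi>" "\<phi> \<le> 1 - q" and q: "0 < q"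
    and drift: "\<kappa> * x\<^sup>2 \<le> (\<phi> - z) * x"
    and \<kappa>: "0 < \<kappa>" "\<kappa> \<le> 1"
    and r: "0 \<le> r" "r \<le> 1" "r \<le> q\<^sup>2"
    and u: "0 < u" "u * r \<le> 2"
  defines "u' \<equiv> (1 - \<kappa> / 4 * r) * u" and "b \<equiv> 36 / \<kappa>"
  shows "\<phi> / (b + u' * (x + r * (1 - z))\<^sup>2) + (1 - \<phi>) / (b + u' * (x - r * z)\<^sup>2)
    \<le> 1 / (b + u * x\<^sup>2) - (1 / (b + u * x\<^sup>2))\<^sup>2 * (u * r\<^sup>2 * q\<^sup>2 / 4)"
proof -
  define Q where "Q = u * x\<^sup>2"
  define V where "V = 1 / (b + Q)"
  \<comment> \<open>The change of the quadratic when the displacement becomes \<open>y\<close> and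
    the scale becomes \<open>u'\<close>.\<close>
  define D where "D = (\<lambda>y. u' * y\<^sup>2 - Q)"
  have b: "0 < b" using \<kappa> by (simp add: b_def)
  have Q: "0 \<le> Q" using u by (simp add: Q_def)
  have \<kappa>r: "0 \<le> \<kappa> * r" "\<kappa> * r \<le> 1" using \<kappa> r mult_mono[of \<kappa> 1 r 1] by auto
  have u': "3/4 * u \<le> u'" "u' \<le> u"
    using \<kappa>r u mult_right_mono[of "3/4" "1 - \<kappa>/4*r" u] mult_right_mono[of "1 - \<kappa>/4*r" 1 u]
    by (auto simp: u'_def)
  have \<phi>01: "0 \<le> \<phi>" "\<phi> \<le> 1" using \<phi> q by auto
  have inv: "1 / (b + u' * y\<^sup>2) \<le> V - V\<^sup>2 * D y + V\<^sup>2 * ((D y)\<^sup>2 / b)" for y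
  proof -
    have "0 \<le> u' * y\<^sup>2" using u u' by (intro mult_nonneg_nonneg) auto
    then show ?thesis
      using inverse_expansion_bound[of b "b + Q" "D y"] b Q by (simp add: V_def D_def)
  qed
  have Dsq: "(D y)\<^sup>2 \<le> 36 * r * Q + 8 * r * (u * r\<^sup>2)" if y: "\<bar>y - x\<bar> \<le> r" for y
  proof -
    have y': "\<bar>y\<bar> \<le> \<bar>x\<bar> + r" using y by linarith
    have "\<bar>y\<^sup>2 - x\<^sup>2\<bar> = \<bar>y - x\<bar> * \<bar>y + x\<bar>" by (simp add: power2_eq_square algebra_simps flip: abs_mult)
    also have "\<dots> \<le> r * (2 * \<bar>x\<bar> + r)" using y y' r by (intro mult_mono) auto
    finally have 1: "\<bar>y\<^sup>2 - x\<^sup>2\<bar> \<le> r * (2 * \<bar>x\<bar> + r)" .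
    have "y\<^sup>2 \<le> (\<bar>x\<bar> + r)\<^sup>2" using power_mono[OF y' abs_ge_zero, of 2] by simp
    also have "\<dots> = \<bar>x\<bar> * \<bar>x\<bar> + 2 * (\<bar>x\<bar> * r) + r * r" by (simp add: power2_eq_square algebra_simps)
    also have "\<dots> \<le> \<bar>x\<bar> * 1 + 2 * (\<bar>x\<bar> * 1) + r * 1"
      using x r by (intro add_mono mult_left_mono) auto
    finally have 2: "y\<^sup>2 \<le> 3 * \<bar>x\<bar> + r" by simp
    have Deq: "D y = u * ((y\<^sup>2 - x\<^sup>2) - \<kappa> * r * y\<^sup>2 / 4)"
      by (simp add: D_def u'_def Q_def algebra_simps)
    have "\<kappa> * r * y\<^sup>2 \<le> r * (3 * \<bar>x\<bar> + r)"
      using 2 \<kappa> r mult_right_mono[of \<kappa> 1 r] by (intro mult_mono) auto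
    moreover have "0 \<le> \<kappa> * r * y\<^sup>2" using \<kappa>r by simp
    ultimately have "\<bar>(y\<^sup>2 - x\<^sup>2) - \<kappa> * r * y\<^sup>2 / 4\<bar> \<le> r * (2 * \<bar>x\<bar> + r) + r * (3 * \<bar>x\<bar> + r) / 4"
      using 1 by linarith
    then have "((y\<^sup>2 - x\<^sup>2) - \<kappa> * r * y\<^sup>2 / 4)\<^sup>2 \<le> (r * (2 * \<bar>x\<bar> + r) + r * (3 * \<bar>x\<bar> + r) / 4)\<^sup>2"
      using power_mono[OF _ abs_ge_zero, of _ _ 2] by fastforce
    also have "\<dots> = r\<^sup>2 * ((11 * \<bar>x\<bar> + 5 * r) / 4)\<^sup>2"
      by (simp add: power2_eq_square field_simps)
    \<comment> \<open>The mixed term is bounded by the two squares, giving 242/16 and 50/16, rounded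
      up to 18 and 4. Doubled through \<open>u * r \<le> 2\<close>, these become the 36 and 8 of
      \<open>Dsq\<close>.\<close>
    also have "((11 * \<bar>x\<bar> + 5 * r) / 4)\<^sup>2 \<le> 18 * x\<^sup>2 + 4 * r\<^sup>2"
    proof -
      have e: "((11 * \<bar>x\<bar> + 5 * r) / 4)\<^sup>2 = (121 * x\<^sup>2 + 25 * r\<^sup>2 + 110 * (\<bar>x\<bar> * r)) / 16"
        by (simp add: power_divide power2_sum power_mult_distrib)
      have "110 * (\<bar>x\<bar> * r) \<le> 121 * x\<^sup>2 + 25 * r\<^sup>2"
        using sum_squares_bound[of "11 * \<bar>x\<bar>" "5 * r"] by (simp add: power_mult_distrib)
      moreover have "(121 * X + 25 * Y + 110 * A) / 16 \<le> 18 * X + 4 * Y"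
        if "110 * A \<le> 121 * X + 25 * Y" "0 \<le> X" "0 \<le> Y" for A X Y :: real
        using that by (simp add: field_simps)
      ultimately show ?thesis unfolding e by (meson zero_le_power2)
    qed
    finally have "((y\<^sup>2 - x\<^sup>2) - \<kappa> * r * y\<^sup>2 / 4)\<^sup>2 \<le> r\<^sup>2 * (18 * x\<^sup>2 + 4 * r\<^sup>2)"
      by (simp add: mult_left_mono)
    then have "(D y)\<^sup>2 \<le> u\<^sup>2 * (r\<^sup>2 * (18 * x\<^sup>2 + 4 * r\<^sup>2))"
      unfolding Deq power_mult_distrib by (intro mult_left_mono) auto
    also have "\<dots> = (u * r) * (r * (18 * Q + 4 * (u * r\<^sup>2)))"
      by (simp add: Q_def power2_eq_square algebra_simps)
    also have "\<dots> \<le> 2 * (r * (18 * Q + 4 * (u * r\<^sup>2)))"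
      using u r Q by (intro mult_right_mono) auto
    finally show ?thesis by (simp add: algebra_simps)
  qed
  define y1 y0 where "y1 = x + r * (1 - z)" and "y0 = x - r * z"
  have y1: "\<bar>y1 - x\<bar> \<le> r" using z r mult_left_mono[of "1 - z" 1 r] by (simp add: y1_def abs_mult)
  have y0: "\<bar>y0 - x\<bar> \<le> r" using z r mult_left_mono[of z 1 r] by (simp add: y0_def abs_mult)
  define E where "E = \<phi> * D y1 + (1 - \<phi>) * D y0"
  have "(x + r * (\<phi> - z))\<^sup>2 = x\<^sup>2 + 2 * r * ((\<phi> - z) * x) + (r * (\<phi> - z))\<^sup>2"
    by (simp add: power2_eq_square algebra_simps)
  also have "\<dots> \<ge> x\<^sup>2 + 2 * r * (\<kappa> * x\<^sup>2) + 0"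
    using drift r by (intro add_mono mult_left_mono) auto
  finally have mean: "x\<^sup>2 + 2 * r * (\<kappa> * x\<^sup>2) \<le> (x + r * (\<phi> - z))\<^sup>2" by simp
  have "q * q \<le> \<phi> * (1 - \<phi>)" using \<phi> q by (intro mult_mono) auto
  then have var: "r\<^sup>2 * q\<^sup>2 \<le> r\<^sup>2 * (\<phi> * (1 - \<phi>))"
    by (intro mult_left_mono) (auto simp: power2_eq_square)
  have "E = u' * ((x + r * (\<phi> - z))\<^sup>2 + r\<^sup>2 * (\<phi> * (1 - \<phi>))) - Q"
    unfolding E_def D_def y1_def y0_def by (simp add: power2_eq_square algebra_simps)
  also have "\<dots> \<ge> u' * ((x\<^sup>2 + 2 * r * (\<kappa> * x\<^sup>2)) + r\<^sup>2 * q\<^sup>2) - Q"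
    using u' u by (intro mean var diff_right_mono mult_left_mono add_mono) auto
  also have "u' * ((x\<^sup>2 + 2 * r * (\<kappa> * x\<^sup>2)) + r\<^sup>2 * q\<^sup>2) = (1 - \<kappa> / 4 * r) * (1 + 2 * (\<kappa> * r)) * Q + u' * (r\<^sup>2 * q\<^sup>2)"
    by (simp add: u'_def Q_def algebra_simps)
  finally have E1: "(1 - \<kappa> / 4 * r) * (1 + 2 * (\<kappa> * r)) * Q + u' * (r\<^sup>2 * q\<^sup>2) - Q \<le> E" .
  have "(\<kappa> * r) * (\<kappa> * r) \<le> (\<kappa> * r) * 1" using \<kappa>r by (intro mult_left_mono) auto
  then have "1 + \<kappa> * r \<le> (1 - \<kappa> / 4 * r) * (1 + 2 * (\<kappa> * r))"
    using \<kappa>r by (simp add: algebra_simps)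
  then have "(1 + \<kappa> * r) * Q \<le> (1 - \<kappa> / 4 * r) * (1 + 2 * (\<kappa> * r)) * Q"
    using Q by (intro mult_right_mono)
  moreover have "3/4 * u * (r\<^sup>2 * q\<^sup>2) \<le> u' * (r\<^sup>2 * q\<^sup>2)" using u' by (intro mult_right_mono) auto
  \<comment> \<open>The drift surplus is kept at exactly \<open>\<kappa> * r * Q\<close>, the amount
    that the second-order term \<open>D2 / b\<close> will consume.\<close>
  ultimately have E2: "\<kappa> * r * Q + 3/4 * (u * r\<^sup>2 * q\<^sup>2) \<le> E"
    using E1 by (simp add: algebra_simps)
  define D2 where "D2 = \<phi> * (D y1)\<^sup>2 + (1 - \<phi>) * (D y0)\<^sup>2"
  have "D2 \<le> \<phi> * (36 * r * Q + 8 * r * (u * r\<^sup>2)) + (1 - \<phi>) * (36 * r * Q + 8 * r * (u * r\<^sup>2))"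
    unfolding D2_def using Dsq[OF y1] Dsq[OF y0] \<phi>01 by (intro add_mono mult_left_mono) auto
  also have "\<dots> = 36 * r * Q + 8 * r * (u * r\<^sup>2)" by (simp add: algebra_simps)
  finally have "D2 / b \<le> (36 * r * Q + 8 * r * (u * r\<^sup>2)) / b" using b by (intro divide_right_mono) auto
  also have "\<dots> = \<kappa> * r * Q + 2/9 * (\<kappa> * (r * (u * r\<^sup>2)))"
    using \<kappa> by (simp add: b_def field_simps)
  \<comment> \<open>This is where \<open>r \<le> q\<^sup>2\<close> enters: the leftover error is 2/9
    of the variance unit against a gain of 3/4, and the difference exceeds 1/4.\<close>
  also have "\<kappa> * (r * (u * r\<^sup>2)) \<le> 1 * (q\<^sup>2 * (u * r\<^sup>2))"
    using \<kappa> r u by (intro mult_mono) auto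
  finally have "D2 / b \<le> \<kappa> * r * Q + 2/9 * (u * r\<^sup>2 * q\<^sup>2)" by (simp add: mult_ac)
  moreover have "0 \<le> u * r\<^sup>2 * q\<^sup>2" using u by simp
  ultimately have gain: "u * r\<^sup>2 * q\<^sup>2 / 4 \<le> E - D2 / b" using E2 by linarith
  have "\<phi> / (b + u' * y1\<^sup>2) + (1 - \<phi>) / (b + u' * y0\<^sup>2)
      = \<phi> * (1 / (b + u' * y1\<^sup>2)) + (1 - \<phi>) * (1 / (b + u' * y0\<^sup>2))" by simp
  also have "\<dots> \<le> \<phi> * (V - V\<^sup>2 * D y1 + V\<^sup>2 * ((D y1)\<^sup>2 / b)) + (1 - \<phi>) * (V - V\<^sup>2 * D y0 + V\<^sup>2 * ((D y0)\<^sup>2 / b))"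
    using inv \<phi>01 by (intro add_mono mult_left_mono) auto
  also have "\<dots> = V - V\<^sup>2 * (E - D2 / b)"
    using b by (simp add: E_def D2_def field_simps)
  also have "\<dots> \<le> V - V\<^sup>2 * (u * r\<^sup>2 * q\<^sup>2 / 4)"
    using gain by (intro diff_left_mono mult_left_mono) auto
  finally show ?thesis by (simp add: V_def Q_def y1_def y0_def)
qed

context urn_process
begin

text \<open>The one-step estimate is integrated over an event known at time \<open>k\<close> on
  which the path is near \<open>p\<close>. Its quadratic gain is replaced by an affine one, so that
  the means obey a linear recursion.\<close>

lemma expectation_next_inverse_quadratic:
  assumes B: "B \<in> sets (F k)" and near: "\<And>\<omega>. \<omega> \<in> B \<Longrightarrow> \<bar>Z k \<omega> - p\<bar> \<le> d" and d: "d \<le> 1"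
    and q: "0 < q" "\<And>x. x \<in> {0..1} \<Longrightarrow> q \<le> f x \<and> f x \<le> 1 - q"
    and drift: "\<And>x. \<bar>x - p\<bar> \<le> d \<Longrightarrow> \<kappa> * (x - p)\<^sup>2 \<le> (f x - x) * (x - p)"
    and \<kappa>: "0 < \<kappa>" "\<kappa> \<le> 1"
    and r: "r k \<le> q\<^sup>2" and u: "0 < u" "u * r k \<le> 2"
  defines "u' \<equiv> (1 - \<kappa> / 4 * r k) * u" and "b \<equiv> 36 / \<kappa>" and "\<eta> \<equiv> u * (r k)\<^sup>2 * q\<^sup>2 / 4"
  shows "(\<integral>\<omega>. indicat_real B \<omega> / (b + u' * (Z (Suc k) \<omega> - p)\<^sup>2) \<partial>M)
    \<le> (1 - \<eta> / b) * (\<integral>\<omega>. indicat_real B \<omega> / (b + u * (Z k \<omega> - p)\<^sup>2) \<partial>M) + \<eta> * prob B / (4 * b\<^sup>2)"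
proof -
  have b: "0 < b" using \<kappa> by (simp add: b_def)
  have "\<kappa> / 4 * r k \<le> 1 / 4 * 1" using \<kappa> step_le_1[of k] step_nonneg[of k] by (intro mult_mono) auto
  then have u': "0 \<le> u'" using u by (auto simp: u'_def)
  have \<eta>: "0 \<le> \<eta>" using u by (simp add: \<eta>_def)
  define X where "X = (\<lambda>\<omega>. Z k \<omega> - p)"
  define G where "G = (\<lambda>y. 1 / (b + u' * y\<^sup>2))"
  define V where "V = (\<lambda>\<omega>. 1 / (b + u * (X \<omega>)\<^sup>2))"
  define J where "J = (indicat_real B :: 'a \<Rightarrow> real)"
  \<comment> \<open>\<open>G1\<close> and \<open>G0\<close> are the values after drawing 1 and 0,
    both known at time \<open>k\<close>. The next value is affine in the draw, so
    \<open>I_mean\<close> may replace the draw by \<open>f (Z k)\<close>.\<close>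
  define G1 where "G1 = (\<lambda>\<omega>. J \<omega> * G (X \<omega> + r k * (1 - Z k \<omega>)))"
  define G0 where "G0 = (\<lambda>\<omega>. J \<omega> * G (X \<omega> - r k * Z k \<omega>))"
  have ZF: "Z k \<in> borel_measurable (F k)" by (rule Z_adapted)
  have JF: "J \<in> borel_measurable (F k)" unfolding J_def using B by simp
  have XF: "X \<in> borel_measurable (F k)" unfolding X_def using ZF by measurable
  have GF: "(\<lambda>\<omega>. G (Y \<omega>)) \<in> borel_measurable (F k)" if [measurable]: "Y \<in> borel_measurable (F k)" for Y
    unfolding G_def by measurable
  have G1F: "G1 \<in> borel_measurable (F k)"
    unfolding G1_def by (intro borel_measurable_times JF GF borel_measurable_add borel_measurable_diff XF ZF) auto
  have G0F: "G0 \<in> borel_measurable (F k)"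
    unfolding G0_def by (intro borel_measurable_times JF GF borel_measurable_diff XF ZF) auto
  have VF: "V \<in> borel_measurable (F k)"
    unfolding V_def using XF by measurable
  note M = measurable_F_M[OF G1F] measurable_F_M[OF G0F] measurable_F_M[OF VF] measurable_F_M[OF JF]
    measurable_F_M[OF fZ_adapted[of k]]
  note [measurable] = M
  have J01: "J \<omega> = 0 \<or> J \<omega> = 1" for \<omega> by (auto simp: J_def indicator_def)
  have Gb: "0 \<le> G y" "G y \<le> 1 / b" for y
  proof -
    have *: "0 \<le> u' * y\<^sup>2" using u' by simp
    show "0 \<le> G y" using * b by (simp add: G_def)
    show "G y \<le> 1 / b" unfolding G_def using * b by (intro divide_left_mono) auto
  qed
  have Vb: "0 \<le> V \<omega>" "V \<omega> \<le> 1 / b" for \<omega>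
  proof -
    have *: "0 \<le> u * (X \<omega>)\<^sup>2" using u by simp
    show "0 \<le> V \<omega>" using * b by (simp add: V_def)
    show "V \<omega> \<le> 1 / b" unfolding V_def using * b by (intro divide_left_mono) auto
  qed
  have G1b: "0 \<le> G1 \<omega>" "G1 \<omega> \<le> 1 / b" for \<omega> using J01[of \<omega>] Gb b by (auto simp: G1_def)
  have G0b: "0 \<le> G0 \<omega>" "G0 \<omega> \<le> 1 / b" for \<omega> using J01[of \<omega>] Gb b by (auto simp: G0_def)
  have diffb: "\<bar>G1 \<omega> - G0 \<omega>\<bar> \<le> 1 / b" for \<omega>
    using G1b[of \<omega>] G0b[of \<omega>] by linarith
  have prodb: "\<bar>(G1 \<omega> - G0 \<omega>) * t\<bar> \<le> 1 / b" if "\<bar>t\<bar> \<le> 1" for \<omega> t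
    using mult_mono[OF diffb[of \<omega>] that] b by (simp add: abs_mult)
  have I1: "\<bar>I (Suc k) \<omega>\<bar> \<le> 1" if "\<omega> \<in> space M" for \<omega>
    using I_values[OF that, of k] by auto
  have f1: "\<bar>f t\<bar> \<le> 1" for t
    using f_range[of t] by auto
  have i1: "integrable M (\<lambda>\<omega>. (G1 \<omega> - G0 \<omega>) * I (Suc k) \<omega>)"
    by (rule integrable_bounded[where C = "1/b"]) (use prodb I1 in auto)
  have i2: "integrable M (\<lambda>\<omega>. (G1 \<omega> - G0 \<omega>) * f (Z k \<omega>))"
    by (rule integrable_bounded[where C = "1/b"]) (use prodb f1 in auto)
  have i0: "integrable M G0"
    by (rule integrable_bounded[where C = "1/b"]) (use G0b in auto)
  have Jb: "\<bar>J \<omega>\<bar> \<le> 1" and JVb: "\<bar>J \<omega> * V \<omega>\<bar> \<le> 1 / b" for \<omega>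
    using J01[of \<omega>] Vb[of \<omega>] b by auto
  have iJ: "integrable M J"
    by (rule integrable_bounded[where C = 1]) (use M Jb in auto)
  have iV: "integrable M (\<lambda>\<omega>. J \<omega> * V \<omega>)"
    by (rule integrable_bounded[where C = "1/b"]) (use M JVb in auto)
  have split: "indicat_real B \<omega> / (b + u' * (Z (Suc k) \<omega> - p)\<^sup>2) = (G1 \<omega> - G0 \<omega>) * I (Suc k) \<omega> + G0 \<omega>"
    if w: "\<omega> \<in> space M" for \<omega>
  proof -
    have "I (Suc k) \<omega> = 0 \<or> I (Suc k) \<omega> = 1" using I_values[OF w, of k] by auto
    then show ?thesis
    proof
      assume 0: "I (Suc k) \<omega> = 0"
      have "Z (Suc k) \<omega> - p = X \<omega> - r k * Z k \<omega>"
        using Z_step[OF w, of k] 0 by (simp add: X_def algebra_simps)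
      then show ?thesis by (simp add: 0 G0_def G_def J_def)
    next
      assume 1: "I (Suc k) \<omega> = 1"
      have "Z (Suc k) \<omega> - p = X \<omega> + r k * (1 - Z k \<omega>)"
        using Z_step[OF w, of k] 1 by (simp add: X_def algebra_simps)
      then show ?thesis by (simp add: 1 G1_def G_def J_def)
    qed
  qed
  have point: "(G1 \<omega> - G0 \<omega>) * f (Z k \<omega>) + G0 \<omega> \<le> (1 - \<eta> / b) * (J \<omega> * V \<omega>) + \<eta> / (4 * b\<^sup>2) * J \<omega>"
    if w: "\<omega> \<in> space M" for \<omega>
  proof (cases "\<omega> \<in> B")
    case False
    then show ?thesis by (simp add: G1_def G0_def J_def)
  next
    case True
    let ?z = "Z k \<omega>"
    have "f ?z / (b + u' * (X \<omega> + r k * (1 - ?z))\<^sup>2) + (1 - f ?z) / (b + u' * (X \<omega> - r k * ?z)\<^sup>2)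
        \<le> 1 / (b + u * (X \<omega>)\<^sup>2) - (1 / (b + u * (X \<omega>)\<^sup>2))\<^sup>2 * (u * (r k)\<^sup>2 * q\<^sup>2 / 4)"
      unfolding u'_def b_def
    proof (rule expected_inverse_quadratic_step)
      show "\<bar>X \<omega>\<bar> \<le> 1" using near[OF True] d by (simp add: X_def)
      show "\<kappa> * (X \<omega>)\<^sup>2 \<le> (f ?z - ?z) * X \<omega>" using drift[OF near[OF True]] by (simp add: X_def)
    qed (use Z_range[OF w, of k] q \<kappa> r u step_nonneg step_le_1 in auto)
    moreover have "(G1 \<omega> - G0 \<omega>) * f ?z + G0 \<omega>
        = f ?z / (b + u' * (X \<omega> + r k * (1 - ?z))\<^sup>2) + (1 - f ?z) / (b + u' * (X \<omega> - r k * ?z)\<^sup>2)"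
      using True by (simp add: G1_def G0_def J_def G_def left_diff_distrib diff_divide_distrib)
    ultimately have "(G1 \<omega> - G0 \<omega>) * f ?z + G0 \<omega> \<le> V \<omega> - (V \<omega>)\<^sup>2 * \<eta>"
      by (simp add: V_def \<eta>_def)
    \<comment> \<open>The tangent to the square at \<open>1 / (2 * b)\<close>, half the maximum of
      \<open>V\<close>, linearises the gain.\<close>
    moreover have "V \<omega> / b - 1 / (4 * b\<^sup>2) \<le> (V \<omega>)\<^sup>2"
    proof -
      have "0 \<le> (V \<omega> - 1 / (2 * b))\<^sup>2" by simp
      also have "\<dots> = (V \<omega>)\<^sup>2 - (V \<omega> / b - 1 / (4 * b\<^sup>2))"
        using b by (simp add: power2_eq_square field_simps)
      finally show ?thesis by simp
    qed
    then have "(V \<omega> / b - 1 / (4 * b\<^sup>2)) * \<eta> \<le> (V \<omega>)\<^sup>2 * \<eta>" using \<eta> by (rule mult_right_mono)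
    ultimately have "(G1 \<omega> - G0 \<omega>) * f ?z + G0 \<omega> \<le> V \<omega> - (V \<omega> / b - 1 / (4 * b\<^sup>2)) * \<eta>" by linarith
    then show ?thesis using True by (simp add: J_def algebra_simps)
  qed
  have "(\<integral>\<omega>. indicat_real B \<omega> / (b + u' * (Z (Suc k) \<omega> - p)\<^sup>2) \<partial>M)
      = (\<integral>\<omega>. (G1 \<omega> - G0 \<omega>) * I (Suc k) \<omega> + G0 \<omega> \<partial>M)"
    by (rule Bochner_Integration.integral_cong[OF refl split])
  also have "\<dots> = (\<integral>\<omega>. (G1 \<omega> - G0 \<omega>) * I (Suc k) \<omega> \<partial>M) + (\<integral>\<omega>. G0 \<omega> \<partial>M)"
    by (rule Bochner_Integration.integral_add[OF i1 i0])
  also have "(\<integral>\<omega>. (G1 \<omega> - G0 \<omega>) * I (Suc k) \<omega> \<partial>M) = (\<integral>\<omega>. (G1 \<omega> - G0 \<omega>) * f (Z k \<omega>) \<partial>M)"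
    by (rule I_mean[where C = "1/b", OF borel_measurable_diff[OF G1F G0F]]) (use diffb in auto)
  also have "(\<integral>\<omega>. (G1 \<omega> - G0 \<omega>) * f (Z k \<omega>) \<partial>M) + (\<integral>\<omega>. G0 \<omega> \<partial>M)
      = (\<integral>\<omega>. (G1 \<omega> - G0 \<omega>) * f (Z k \<omega>) + G0 \<omega> \<partial>M)"
    by (rule Bochner_Integration.integral_add[OF i2 i0, symmetric])
  also have "\<dots> \<le> (\<integral>\<omega>. (1 - \<eta> / b) * (J \<omega> * V \<omega>) + \<eta> / (4 * b\<^sup>2) * J \<omega> \<partial>M)"
    by (rule integral_mono[OF _ _ point]) (intro Bochner_Integration.integrable_add i2 i0 integrable_mult_right iV iJ)+
  also have "\<dots> = (1 - \<eta> / b) * (\<integral>\<omega>. J \<omega> * V \<omega> \<partial>M) + \<eta> / (4 * b\<^sup>2) * (\<integral>\<omega>. J \<omega> \<partial>M)"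
    using iV iJ by simp
  also have "(\<integral>\<omega>. J \<omega> \<partial>M) = prob B" using sets_F_M[OF B] by (simp add: J_def)
  also have "(\<lambda>\<omega>. J \<omega> * V \<omega>) = (\<lambda>\<omega>. indicat_real B \<omega> / (b + u * (Z k \<omega> - p)\<^sup>2))"
    by (simp add: J_def V_def X_def)
  finally show ?thesis by simp
qed

text \<open>At time \<open>m\<close> the function \<open>1 / (b + u k * (Z k - p)\<^sup>2)\<close> with \<open>u m = m\<close> sees the scale
  \<open>m powr (-1/2)\<close> of the noise still to come, which lowers its mean by a fixed factor before time
  \<open>2 m\<close>. As \<open>u k\<close> decreases to \<open>0\<close>, the function tends to its maximum \<open>1 / b\<close> on the
  paths that stay near \<open>p\<close>, so those paths cannot carry all the mass.\<close>

lemma leaves_unstable_point_with_uniform_probability: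
  assumes d: "d \<le> 1"
    and drift: "\<And>x. \<bar>x - p\<bar> \<le> d \<Longrightarrow> \<kappa> * (x - p)\<^sup>2 \<le> (f x - x) * (x - p)"
    and \<kappa>: "0 < \<kappa>" "\<kappa> \<le> 1"
  shows "\<exists>\<gamma><1. \<forall>n. \<forall>\<^sub>F m in sequentially.
    prob {\<omega> \<in> space M. \<forall>j\<ge>n. \<bar>Z j \<omega> - p\<bar> \<le> d} \<le> \<gamma> * prob {\<omega> \<in> space M. \<forall>j\<in>{n..m}. \<bar>Z j \<omega> - p\<bar> \<le> d}"
proof -
  obtain q where q: "0 < q" "\<And>x. x \<in> {0..1} \<Longrightarrow> q \<le> f x \<and> f x \<le> 1 - q"
    by (rule f_bounded_away) blast
  have q1: "q \<le> 1" using q(2)[of 0] q(1) by auto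
  define b where "b = 36 / \<kappa>"
  have b: "36 \<le> b" using \<kappa> by (simp add: b_def field_simps)
  \<comment> \<open>On the block from \<open>m\<close> to \<open>2 * m\<close> one has
    \<open>u k \<ge> m / 2\<close> and \<open>r k \<ge> 1 / (4 * m)\<close>, hence
    \<open>\<eta> k / b \<ge> q\<^sup>2 / (128 * b * m)\<close>; the \<open>m\<close> steps of the
    block add up to \<open>s\<close>.\<close>
  define s where "s = q\<^sup>2 / (128 * b)"
  have s: "0 < s" using q b by (simp add: s_def)
  \<comment> \<open>The 1/4 is the fixed level of the affine recursion, and the remaining 3/4
    shrinks by \<open>exp (- s)\<close> over one block.\<close>
  define \<gamma> where "\<gamma> = (1 + 3 * exp (- s)) / 4"
  have "\<forall>\<^sub>F n in sequentially. r n < q\<^sup>2"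
    using step_tendsto_0 q by (intro order_tendstoD(2)) auto
  then have "\<forall>\<^sub>F n in sequentially. r n \<le> q\<^sup>2 \<and> 0 < n \<and> 1 / (2 * real n) \<le> r n \<and> r n \<le> 2 / real n"
    using step_bounds by eventually_elim auto
  then obtain N where N: "\<And>k. k \<ge> N \<Longrightarrow> r k \<le> q\<^sup>2 \<and> 0 < k \<and> 1 / (2 * real k) \<le> r k \<and> r k \<le> 2 / real k"
    unfolding eventually_sequentially by blast
  have "prob {\<omega> \<in> space M. \<forall>j\<ge>n. \<bar>Z j \<omega> - p\<bar> \<le> d} \<le> \<gamma> * prob {\<omega> \<in> space M. \<forall>j\<in>{n..m}. \<bar>Z j \<omega> - p\<bar> \<le> d}"
    if m: "m \<ge> N" "m \<ge> n" for m n
  proof -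
    define B where "B = (\<lambda>k. {\<omega> \<in> space M. \<forall>j\<in>{n..k}. \<bar>Z j \<omega> - p\<bar> \<le> d})"
    define P where "P = prob (B m)"
    let ?Binf = "{\<omega> \<in> space M. \<forall>j\<ge>n. \<bar>Z j \<omega> - p\<bar> \<le> d}"
    have BF: "B k \<in> sets (F k)" for k
    proof -
      have [measurable]: "Z j \<in> borel_measurable (F k)" if "j \<in> {n..k}" for j
        using that Z_adapted_mono by auto
      have "{\<omega> \<in> space (F k). \<forall>j\<in>{n..k}. \<bar>Z j \<omega> - p\<bar> \<le> d} \<in> sets (F k)" by measurable
      then show ?thesis unfolding B_def space_F .
    qed
    have [measurable]: "B k \<in> sets M" for k by (rule sets_F_M[OF BF])
    have Bmono: "B (Suc k) \<subseteq> B k" for k by (auto simp: B_def)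
    have Bsub: "B k \<subseteq> B m" if "k \<ge> m" for k using that by (auto simp: B_def)
    have m0: "0 < m" using N[OF m(1)] by simp
    define a where "a = (\<lambda>j. \<kappa> / 4 * r j)"
    have a: "0 \<le> a j" "a j \<le> 1/4" for j
      using \<kappa> step_nonneg[of j] step_le_1[of j] mult_mono[of \<kappa> 1 "r j" 1] by (auto simp: a_def)
    have a1: "a j < 1" for j using a(2)[of j] by linarith
    have "\<not> summable a"
      using step_not_summable \<kappa> summable_cmult_iff[of "\<kappa> / 4" r] by (simp add: a_def)
    \<comment> \<open>The decay rate \<open>\<kappa> / 4\<close> is what the drift can pay for. It
      halves \<open>u\<close> at most once over the block, yet drives it to 0 because
      \<open>r\<close> is not summable.\<close>
    define u where "u = (\<lambda>k. real m * (\<Prod>j=m..<k. 1 - a j))"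
    have u0: "(\<lambda>k. u k) \<longlonglongrightarrow> real m * 0"
      unfolding u_def using a order_trans[OF a(2)]
      by (intro tendsto_intros prod_one_minus_tendsto_0 \<open>\<not> summable a\<close>) auto
    have upos: "0 < u k" for k
      unfolding u_def using m0 a1 by (intro mult_pos_pos prod_pos) auto
    have um: "u k \<le> real m" for k
    proof -
      have "(\<Prod>j=m..<k. 1 - a j) \<le> 1" using a order_trans[OF a(2)] by (intro prod_le_1) auto
      then show ?thesis using m0 by (simp add: u_def)
    qed
    have uSuc: "u (Suc k) = (1 - \<kappa> / 4 * r k) * u k" if "k \<ge> m" for k
      using that by (simp add: u_def a_def)
    have ur: "u k * r k \<le> 2" if "k \<ge> m" for k
    proof -
      have "u k * r k \<le> real k * (2 / real k)"
        using um[of k] that N[of k] m step_nonneg[of k] by (intro mult_mono) auto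
      then show ?thesis using that m0 by simp
    qed
    define \<eta> where "\<eta> = (\<lambda>k. u k * (r k)\<^sup>2 * q\<^sup>2 / 4)"
    have \<eta>0: "0 \<le> \<eta> k" for k using upos[of k] by (simp add: \<eta>_def)
    have \<eta>1: "\<eta> k / b \<le> 1" if "k \<ge> m" for k
    proof -
      have "\<eta> k = (u k * r k) * (r k * q\<^sup>2) / 4" by (simp add: \<eta>_def power2_eq_square)
      also have "\<dots> \<le> 2 * (1 * 1\<^sup>2) / 4"
        using ur[OF that] step_le_1[of k] step_nonneg[of k] q q1
        by (intro divide_right_mono mult_mono power_mono) auto
      finally show ?thesis using b by simp
    qed
    have \<eta>s: "s / real m \<le> \<eta> k / b" if k: "k \<in> {m..<2*m}" for k
    proof -
      have "(\<Sum>j=m..<k. a j) \<le> (\<Sum>j=m..<k. 1 / (2 * real m))"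
      proof (rule sum_mono)
        fix j assume j: "j \<in> {m..<k}"
        have "a j \<le> 1 / 4 * (2 / real j)"
          unfolding a_def using \<kappa> N[of j] m j step_nonneg[of j] by (intro mult_mono) auto
        also have "\<dots> = 1 / (2 * real j)" by simp
        also have "\<dots> \<le> 1 / (2 * real m)" using j m0 by (intro divide_left_mono) auto
        finally show "a j \<le> 1 / (2 * real m)" .
      qed
      also have "\<dots> \<le> 1 / 2" using k m0 by (auto simp: field_simps of_nat_diff)
      finally have "1 / 2 \<le> 1 - (\<Sum>j=m..<k. a j)" by simp
      \<comment> \<open>The Weierstrass product inequality: a product of factors
        \<open>1 - a j\<close> is at least 1 minus the sum.\<close>
      also have "\<dots> \<le> (\<Prod>j=m..<k. 1 - a j)"
        using a order_trans[OF a(2)] by (intro Weierstrass_prod_ineq) auto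
      finally have "real m * (1 / 2) \<le> u k" unfolding u_def by (intro mult_left_mono) auto
      moreover have "1 / (4 * real m) \<le> r k"
      proof -
        have "1 / (4 * real m) \<le> 1 / (2 * real k)"
          using k m0 by (intro divide_left_mono) auto
        then show ?thesis using N[of k] k m by auto
      qed
      then have "(1 / (4 * real m))\<^sup>2 \<le> (r k)\<^sup>2" by (intro power_mono) auto
      ultimately have e1: "real m * (1 / 2) * (1 / (4 * real m))\<^sup>2 * q\<^sup>2 / 4 \<le> \<eta> k"
        unfolding \<eta>_def using upos[of k] by (intro divide_right_mono mult_mono) (auto intro: less_imp_le)
      have e2: "real m * (1 / 2) * (1 / (4 * real m))\<^sup>2 * q\<^sup>2 / 4 = s / real m * b"
        using m0 b by (simp add: s_def power2_eq_square field_simps)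
      have "0 < b" using b by simp
      then show ?thesis using e1 unfolding e2 by (simp only: pos_le_divide_eq)
    qed
    define e where "e = (\<lambda>k. \<integral>\<omega>. indicat_real (B k) \<omega> / (b + u k * (Z k \<omega> - p)\<^sup>2) \<partial>M)"
    have den: "b \<le> b + u k * y\<^sup>2" for k y using upos[of k] by simp
    have frac: "0 \<le> indicat_real A \<omega> / (b + u k * y\<^sup>2)" "indicat_real A \<omega> / (b + u k * y\<^sup>2) \<le> indicat_real A \<omega> / b"
      for A \<omega> k y
      using den[of k y] b by (auto intro!: divide_left_mono simp: indicator_def)
    have int: "integrable M (\<lambda>\<omega>. indicat_real (B i) \<omega> / (b + u k * (Z j \<omega> - p)\<^sup>2))" for i j k
    proof (rule integrable_bounded)
      show "\<bar>indicat_real (B i) \<omega> / (b + u k * (Z j \<omega> - p)\<^sup>2)\<bar> \<le> 1 / b" for \<omega>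
        using frac[of "B i" \<omega> k "Z j \<omega> - p"] b by (auto simp: indicator_def split: if_splits)
    qed measurable
    have intB: "integrable M (\<lambda>\<omega>. indicat_real A \<omega> / c)" if "A \<in> sets M" for A c
      using that by (intro Bochner_Integration.integrable_divide integrable_real_indicator) (auto simp: emeasure_eq_measure)
    have em: "e k \<le> P / b" if "k \<ge> m" for k
    proof -
      have "e k \<le> (\<integral>\<omega>. indicat_real (B k) \<omega> / b \<partial>M)"
        unfolding e_def by (intro integral_mono int intB frac) auto
      also have "\<dots> = prob (B k) / b" by simp
      also have "\<dots> \<le> P / b" unfolding P_def using Bsub[OF that] b
        by (intro divide_right_mono finite_measure_mono) auto
      finally show ?thesis .
    qed
    have P0: "0 \<le> P" by (simp add: P_def)
    have estep: "e (Suc k) - P / (4 * b) \<le> (1 - \<eta> k / b) * (e k - P / (4 * b))" if k: "k \<ge> m" for k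
    proof -
      \<comment> \<open>Shrinking the event from \<open>B k\<close> to \<open>B (Suc k)\<close> only
        lowers the integral, and enlarging it back gives an event known at time
        \<open>k\<close>.\<close>
      have "e (Suc k) \<le> (\<integral>\<omega>. indicat_real (B k) \<omega> / (b + u (Suc k) * (Z (Suc k) \<omega> - p)\<^sup>2) \<partial>M)"
        unfolding e_def
      proof (intro integral_mono int divide_right_mono)
        show "indicat_real (B (Suc k)) \<omega> \<le> indicat_real (B k) \<omega>" for \<omega>
          using Bmono[of k] by (auto simp: indicator_def)
        show "0 \<le> b + u (Suc k) * (Z (Suc k) \<omega> - p)\<^sup>2" for \<omega>
          using den[of "Suc k" "Z (Suc k) \<omega> - p"] b by linarith
      qed
      also have "\<dots> \<le> (1 - \<eta> k / b) * e k + \<eta> k * prob (B k) / (4 * b\<^sup>2)"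
        unfolding uSuc[OF k] e_def \<eta>_def b_def
      proof (rule expectation_next_inverse_quadratic[where d = d])
        show "\<bar>Z k \<omega> - p\<bar> \<le> d" if "\<omega> \<in> B k" for \<omega> using that k m(2) by (auto simp: B_def)
      qed (use BF d q drift \<kappa> N[of k] k m upos ur in auto)
      also have "\<eta> k * prob (B k) / (4 * b\<^sup>2) \<le> \<eta> k * P / (4 * b\<^sup>2)"
        unfolding P_def using Bsub[OF k] \<eta>0
        by (intro divide_right_mono mult_left_mono finite_measure_mono) auto
      \<comment> \<open>Centred at its fixed level \<open>P / (4 * b)\<close>, the affine recursion
        becomes a contraction.\<close>
      also have "(1 - \<eta> k / b) * e k + \<eta> k * P / (4 * b\<^sup>2)
          = (1 - \<eta> k / b) * (e k - P / (4 * b)) + P / (4 * b)"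
        using b by (simp add: power2_eq_square field_simps)
      finally show ?thesis by simp
    qed
    have eprod: "e k - P / (4 * b) \<le> (\<Prod>j=m..<k. 1 - \<eta> j / b) * (3 * P / (4 * b))" if "k \<ge> m" for k
      using that
    proof (induction k rule: dec_induct)
      case base
      show ?case using em[of m] b by (simp add: field_simps)
    next
      case (step k)
      have "e (Suc k) - P / (4 * b) \<le> (1 - \<eta> k / b) * (e k - P / (4 * b))"
        using estep step by simp
      also have "\<dots> \<le> (1 - \<eta> k / b) * ((\<Prod>j=m..<k. 1 - \<eta> j / b) * (3 * P / (4 * b)))"
        using step \<eta>1[of k] by (intro mult_left_mono) auto
      finally show ?case using step.hyps by (simp add: mult_ac)
    qed
    have eg: "e k \<le> \<gamma> * P / b" if k: "k \<ge> 2 * m" for k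
    proof -
      have km: "k \<ge> m" using k by simp
      have "(\<Prod>j=m..<k. 1 - \<eta> j / b) = (\<Prod>j=m..<2*m. 1 - \<eta> j / b) * (\<Prod>j=2*m..<k. 1 - \<eta> j / b)"
        using prod.atLeastLessThan_concat[of m "2*m" k "\<lambda>j. 1 - \<eta> j / b"] k by simp
      also have "\<dots> \<le> exp (- s) * 1"
      proof (intro mult_mono)
        have "(\<Prod>j=m..<2*m. 1 - \<eta> j / b) \<le> (\<Prod>j=m..<2*m. exp (- (s / real m)))"
        proof (intro prod_mono conjI)
          fix j assume j: "j \<in> {m..<2*m}"
          show "0 \<le> 1 - \<eta> j / b" using \<eta>1[of j] j by auto
          have "1 - \<eta> j / b \<le> 1 + - (s / real m)" using \<eta>s[OF j] by simp
          also have "\<dots> \<le> exp (- (s / real m))" by (rule exp_ge_add_one_self)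
          finally show "1 - \<eta> j / b \<le> exp (- (s / real m))" .
        qed
        also have "\<dots> = exp (- s)" using m0 by (simp flip: exp_of_nat_mult)
        finally show "(\<Prod>j=m..<2*m. 1 - \<eta> j / b) \<le> exp (- s)" .
        show "(\<Prod>j=2*m..<k. 1 - \<eta> j / b) \<le> 1"
          using \<eta>0 \<eta>1 b by (intro prod_le_1) auto
        show "0 \<le> (\<Prod>j=2*m..<k. 1 - \<eta> j / b)"
          using \<eta>1 by (intro prod_nonneg) auto
      qed auto
      finally have pr: "(\<Prod>j=m..<k. 1 - \<eta> j / b) \<le> exp (- s)" by simp
      have "e k - P / (4 * b) \<le> exp (- s) * (3 * P / (4 * b))"
        using b P0 by (intro order_trans[OF eprod[OF km]] mult_right_mono pr) auto
      moreover have "\<gamma> * P / b = P / (4 * b) + exp (- s) * (3 * P / (4 * b))"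
        using b by (simp add: \<gamma>_def field_simps)
      ultimately show ?thesis by linarith
    qed
    \<comment> \<open>On \<open>?Binf\<close> the integrand is at least
      \<open>1 / (b + u k)\<close>. As \<open>u k\<close> tends to 0, this lower bound approaches
      the maximum \<open>1 / b\<close>, while the mean stays below
      \<open>\<gamma> * P / b\<close>.\<close>
    have "prob ?Binf \<le> (b + u k) * (\<gamma> * P / b)" if k: "k \<ge> 2 * m" for k
    proof -
      have bu: "0 < b + u k" using b upos[of k] by linarith
      have "prob ?Binf / (b + u k) = (\<integral>\<omega>. indicat_real ?Binf \<omega> / (b + u k) \<partial>M)" by simp
      also have "\<dots> \<le> e k"
        unfolding e_def
      proof (intro integral_mono int intB)
        fix \<omega>
        show "indicat_real ?Binf \<omega> / (b + u k) \<le> indicat_real (B k) \<omega> / (b + u k * (Z k \<omega> - p)\<^sup>2)"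
        proof (cases "\<omega> \<in> ?Binf")
          case True
          then have "\<omega> \<in> B k" by (auto simp: B_def)
          have "n \<le> k" using k m by simp
          then have "\<bar>Z k \<omega> - p\<bar> \<le> d" using True by blast
          then have "\<bar>Z k \<omega> - p\<bar> \<le> 1" using d by linarith
          then have "(Z k \<omega> - p)\<^sup>2 \<le> 1" using power_mono[of "\<bar>Z k \<omega> - p\<bar>" 1 2] by simp
          then have "u k * (Z k \<omega> - p)\<^sup>2 \<le> u k * 1" using upos[of k] by (intro mult_left_mono) auto
          then have "1 / (b + u k) \<le> 1 / (b + u k * (Z k \<omega> - p)\<^sup>2)"
            using den[of k "Z k \<omega> - p"] b bu by (intro divide_left_mono mult_pos_pos) auto
          then show ?thesis using True \<open>\<omega> \<in> B k\<close> by simp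
        next
          case False
          then show ?thesis using frac(1)[of "B k" \<omega> k "Z k \<omega> - p"] by simp
        qed
      qed measurable
      also have "\<dots> \<le> \<gamma> * P / b" by (rule eg[OF k])
      finally show ?thesis using bu by (simp add: divide_le_eq mult.commute)
    qed
    moreover have "(\<lambda>k. (b + u k) * (\<gamma> * P / b)) \<longlonglongrightarrow> (b + real m * 0) * (\<gamma> * P / b)"
      by (intro tendsto_intros u0)
    ultimately have "prob ?Binf \<le> (b + real m * 0) * (\<gamma> * P / b)"
      by (intro LIMSEQ_le_const) auto
    then show ?thesis using b by (simp add: P_def B_def)
  qed
  moreover have "\<gamma> < 1" using s by (simp add: \<gamma>_def)
  ultimately show ?thesis
    unfolding eventually_sequentially by (intro exI[of _ \<gamma>]) (meson nle_le order_trans)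
qed

text \<open>Let \<open>P\<close> be the probability of staying within \<open>d'\<close> of
  \<open>p\<close> from time \<open>n\<close> on. As \<open>m\<close> grows, the finite-horizon
  probabilities decrease to \<open>P\<close>, so the preceding lemma yields
  \<open>P \<le> \<gamma> * P\<close> with \<open>\<gamma> < 1\<close>. Convergence to
  \<open>p\<close> lies in the countable union over \<open>n\<close> of these null events.\<close>

lemma unstable_point_not_limit:
  assumes d: "0 < d" and \<kappa>: "0 < \<kappa>"
    and drift: "\<And>x. \<bar>x - p\<bar> \<le> d \<Longrightarrow> \<kappa> * (x - p)\<^sup>2 \<le> (f x - x) * (x - p)"
  shows "AE \<omega> in M. \<not> (\<lambda>n. Z n \<omega>) \<longlonglongrightarrow> p"
proof -
  define d' \<kappa>' where "d' = min d 1" and "\<kappa>' = min \<kappa> 1"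
  have drift': "\<kappa>' * (x - p)\<^sup>2 \<le> (f x - x) * (x - p)" if "\<bar>x - p\<bar> \<le> d'" for x
  proof -
    have "\<kappa>' * (x - p)\<^sup>2 \<le> \<kappa> * (x - p)\<^sup>2" by (intro mult_right_mono) (auto simp: \<kappa>'_def)
    then show ?thesis using drift[of x] that by (auto simp: d'_def)
  qed
  have d'1: "d' \<le> 1" and \<kappa>'1: "0 < \<kappa>'" "\<kappa>' \<le> 1"
    using \<kappa> by (auto simp: d'_def \<kappa>'_def)
  obtain \<gamma> where \<gamma>: "\<gamma> < 1" "\<And>n. \<forall>\<^sub>F m in sequentially.
      prob {\<omega> \<in> space M. \<forall>j\<ge>n. \<bar>Z j \<omega> - p\<bar> \<le> d'} \<le> \<gamma> * prob {\<omega> \<in> space M. \<forall>j\<in>{n..m}. \<bar>Z j \<omega> - p\<bar> \<le> d'}"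
    using leaves_unstable_point_with_uniform_probability[OF d'1 drift' \<kappa>'1] by blast
  have null: "AE \<omega> in M. \<omega> \<notin> {\<omega> \<in> space M. \<forall>j\<ge>n. \<bar>Z j \<omega> - p\<bar> \<le> d'}" for n
  proof -
    let ?B = "\<lambda>m. {\<omega> \<in> space M. \<forall>j\<in>{n..m}. \<bar>Z j \<omega> - p\<bar> \<le> d'}"
    let ?Binf = "{\<omega> \<in> space M. \<forall>j\<ge>n. \<bar>Z j \<omega> - p\<bar> \<le> d'}"
    have meas: "?Binf \<in> sets M" by measurable
    have "(\<lambda>m. prob (?B m)) \<longlonglongrightarrow> prob (\<Inter>m. ?B m)"
    proof (rule finite_Lim_measure_decseq)
      show "range ?B \<subseteq> sets M" by auto
      show "decseq ?B" by (auto simp: decseq_def)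
    qed
    also have "(\<Inter>m. ?B m) = ?Binf" by auto (metis atLeastAtMost_iff order_refl)
    finally have "(\<lambda>m. \<gamma> * prob (?B m)) \<longlonglongrightarrow> \<gamma> * prob ?Binf" by (intro tendsto_intros)
    then have "prob ?Binf \<le> \<gamma> * prob ?Binf"
      using \<gamma>(2)[of n] by (rule tendsto_lowerbound) simp
    then have "(1 - \<gamma>) * prob ?Binf \<le> 0" by (simp add: algebra_simps)
    then have "prob ?Binf = 0"
      using \<gamma>(1) measure_nonneg[of M ?Binf] by (simp add: mult_le_0_iff)
    then show ?thesis using prob_eq_0[OF meas] by simp
  qed
  have "AE \<omega> in M. \<forall>n. \<omega> \<notin> {\<omega> \<in> space M. \<forall>j\<ge>n. \<bar>Z j \<omega> - p\<bar> \<le> d'}"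
    using null by (simp add: AE_all_countable)
  then show ?thesis
  proof (rule AE_mp, intro AE_I2 impI notI)
    fix \<omega> assume w: "\<omega> \<in> space M" "\<forall>n. \<omega> \<notin> {\<omega> \<in> space M. \<forall>j\<ge>n. \<bar>Z j \<omega> - p\<bar> \<le> d'}"
      and lim: "(\<lambda>n. Z n \<omega>) \<longlonglongrightarrow> p"
    have "0 < d'" using d by (simp add: d'_def)
    then obtain n where "\<forall>j\<ge>n. \<bar>Z j \<omega> - p\<bar> < d'"
      using LIMSEQ_D[OF lim] by auto
    then have "\<forall>j\<ge>n. \<bar>Z j \<omega> - p\<bar> \<le> d'" by (meson less_imp_le)
    then show False using w by blast
  qed
qed

end

section \<open>The single-unit process\<close>

text \<open>The filtration is unchanged and the draws swap roles, so every statement about a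
  left-hand limit also yields one about a right-hand limit.\<close>

lemma (in urn_process) reflected_urn_process:
  "urn_process M F r (\<lambda>x. 1 - f (1 - x)) (\<lambda>n \<omega>. 1 - Z n \<omega>) (\<lambda>n \<omega>. 1 - I n \<omega>)"
proof (intro urn_process.intro prob_space_axioms urn_process_axioms.intro)
  fix n C and X :: "'a \<Rightarrow> real"
  assume X: "X \<in> borel_measurable (F n)" and C: "\<And>\<omega>. \<omega> \<in> space M \<Longrightarrow> \<bar>X \<omega>\<bar> \<le> C"
  note [measurable] = measurable_F_M[OF X] measurable_F_M[OF fZ_adapted]
  have le: "\<bar>X \<omega> * t\<bar> \<le> C" if "\<omega> \<in> space M" "\<bar>t\<bar> \<le> 1" for \<omega> t
    using mult_mono[OF C[OF that(1)] that(2)] order_trans[OF abs_ge_zero C[OF that(1)]]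
    by (simp add: abs_mult)
  have I1: "\<bar>I (Suc n) \<omega>\<bar> \<le> 1" if "\<omega> \<in> space M" for \<omega> using I_values[OF that, of n] by auto
  have f1: "\<bar>f t\<bar> \<le> 1" for t using f_range[of t] by auto
  have 0: "integrable M X" by (rule integrable_bounded[OF _ C]) auto
  have 1: "integrable M (\<lambda>\<omega>. X \<omega> * I (Suc n) \<omega>)"
    by (rule integrable_bounded[where C = C]) (use le I1 in auto)
  have 2: "integrable M (\<lambda>\<omega>. X \<omega> * f (Z n \<omega>))"
    by (rule integrable_bounded[where C = C]) (use le f1 in auto)
  show "(\<integral>\<omega>. X \<omega> * (1 - I (Suc n) \<omega>) \<partial>M) = (\<integral>\<omega>. X \<omega> * (1 - f (1 - (1 - Z n \<omega>))) \<partial>M)"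
    using I_mean[OF X C] 0 1 2 by (simp add: right_diff_distrib)
next
  show "continuous_on UNIV (\<lambda>x. 1 - f (1 - x))"
    by (intro continuous_intros continuous_on_compose2[OF f_cont]) auto
next
  fix n \<omega> assume w: "\<omega> \<in> space M"
  show "1 - Z (Suc n) \<omega> = (1 - r n) * (1 - Z n \<omega>) + r n * (1 - I (Suc n) \<omega>)"
    using Z_step[OF w, of n] by (simp add: algebra_simps)
  show "1 - Z n \<omega> \<in> {0..1}" using Z_range[OF w, of n] by auto
  show "1 - I (Suc n) \<omega> \<in> {0, 1}" using I_values[OF w, of n] by auto
next
  fix n show "(\<lambda>\<omega>. 1 - Z n \<omega>) \<in> borel_measurable (F n)"
    by (intro borel_measurable_diff Z_adapted) auto
  show "(\<lambda>\<omega>. 1 - I (Suc n) \<omega>) \<in> borel_measurable (F (Suc n))"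
    by (intro borel_measurable_diff I_adapted) auto
next
  fix x show "1 - f (1 - x) \<in> {0<..<1}" using f_range[of "1 - x"] by auto
qed (use F_subalgebra F_mono step_range step_asymp in auto)

section \<open>The natural filtration and the conditional mean of a draw\<close>

context single_unit_process
begin

lemma generator_sets:
  assumes "X \<in> insert (Z 0) (I ` {1..n})"
  shows "sets (vimage_algebra (space M) X borel) \<subseteq> sets M"
proof -
  have "X \<in> borel_measurable M"
  proof (cases "X = Z 0")
    case False
    then obtain k where "k \<in> {1..n}" "X = I k" using assms by auto
    \<comment> \<open>Draws in the history have index at least 1, so \<open>k\<close> is the
      successor of \<open>k - 1\<close>.\<close>
    then show ?thesis using I_measurable[of "k - 1"] by simp
  qed (simp add: Z0_measurable)
  then show ?thesis by (auto simp: sets_vimage_algebra2 intro: measurable_sets)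
qed

lemma space_history: "space (history M Z I n) = space M"
  unfolding history_def by (rule space_measure_of_conv)

lemma sets_history:
  "sets (history M Z I n) =
     sigma_sets (space M) (\<Union>X\<in>insert (Z 0) (I ` {1..n}). sets (vimage_algebra (space M) X borel))"
  unfolding history_def
proof (rule sets_measure_of)
  show "(\<Union>X\<in>insert (Z 0) (I ` {1..n}). sets (vimage_algebra (space M) X borel)) \<subseteq> Pow (space M)"
    using generator_sets sets.sets_into_space by (fastforce simp del: sets_vimage_algebra_space)
qed

lemma history_subalgebra: "subalgebra M (history M Z I n)"
  unfolding subalgebra_def space_history sets_history
  using generator_sets by (auto intro!: sets.sigma_sets_subset)

lemma history_mono: "m \<le> n \<Longrightarrow> subalgebra (history M Z I n) (history M Z I m)"
  unfolding subalgebra_def space_history sets_history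
  by (auto intro!: sigma_sets_mono')

lemma generator_measurable:
  assumes "X \<in> insert (Z 0) (I ` {1..n})"
  shows "X \<in> borel_measurable (history M Z I n)"
proof (rule measurableI)
  fix A :: "real set" assume "A \<in> sets borel"
  then have "X -` A \<inter> space M \<in> sets (vimage_algebra (space M) X borel)"
    by (rule in_vimage_algebra)
  then show "X -` A \<inter> space (history M Z I n) \<in> sets (history M Z I n)"
    unfolding space_history sets_history using assms by (intro sigma_sets.Basic) blast
qed auto

lemma Z_in_range: "\<omega> \<in> space M \<Longrightarrow> Z n \<omega> \<in> {0..1}"
proof (induction n)
  case (Suc n)
  have r: "0 \<le> r n" "r n \<le> 1" using r_range[of n] by auto
  have "(1 - r n) * Z n \<omega> \<le> (1 - r n) * 1" "0 \<le> (1 - r n) * Z n \<omega>"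
    using Suc r mult_left_mono[of "Z n \<omega>" 1 "1 - r n"] by auto
  then show ?case using Z_Suc[OF Suc.prems, of n] I_range[OF Suc.prems, of n] r by auto
qed (use Z0_range in auto)

lemma Z_measurable_history: "Z n \<in> borel_measurable (history M Z I n)"
proof (induction n)
  case 0
  then show ?case by (rule generator_measurable) simp
next
  case (Suc n)
  have "Z n \<in> borel_measurable (history M Z I (Suc n))"
    using measurable_from_subalg[OF history_mono Suc] by simp
  moreover have "I (Suc n) \<in> borel_measurable (history M Z I (Suc n))"
    by (rule generator_measurable) auto
  ultimately have "(\<lambda>\<omega>. (1 - r n) * Z n \<omega> + r n * I (Suc n) \<omega>) \<in> borel_measurable (history M Z I (Suc n))"
    by (intro borel_measurable_add borel_measurable_times) auto
  then show ?case
    using Z_Suc by (subst measurable_cong) (auto simp: space_history)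
qed

text \<open>A draw is the indicator of the event that it equals 1. The characterising property of
  \<open>real_cond_exp\<close>, tested with \<open>X\<close>, replaces this indicator by its
  conditional probability.\<close>

lemma mean_I_eq_mean_f:
  assumes X: "X \<in> borel_measurable (history M Z I n)" and C: "\<And>\<omega>. \<omega> \<in> space M \<Longrightarrow> \<bar>X \<omega>\<bar> \<le> C"
    and f: "f \<in> borel_measurable borel"
  shows "(\<integral>\<omega>. X \<omega> * I (Suc n) \<omega> \<partial>M) = (\<integral>\<omega>. X \<omega> * f (Z n \<omega>) \<partial>M)"
proof -
  interpret H: finite_measure_subalgebra M "history M Z I n"
    by unfold_locales (rule history_subalgebra)
  define A where "A = {\<omega> \<in> space M. I (Suc n) \<omega> = 1}"
  have XM: "X \<in> borel_measurable M" using measurable_from_subalg[OF history_subalgebra X] .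
  have ZM: "(\<lambda>\<omega>. f (Z n \<omega>)) \<in> borel_measurable M"
    by (rule measurable_compose[OF measurable_from_subalg[OF history_subalgebra Z_measurable_history] f])
  have A: "A \<in> sets M" unfolding A_def using I_measurable[of n] by measurable
  have iA: "indicat_real A \<in> borel_measurable M" using A by simp
  have int: "integrable M (\<lambda>\<omega>. X \<omega> * indicat_real A \<omega>)"
  proof (rule integrable_const_bound[where B = C])
    show "AE \<omega> in M. norm (X \<omega> * indicat_real A \<omega>) \<le> C"
      using C by (intro AE_I2) (auto simp: indicator_def intro: order_trans[OF abs_ge_zero])
  qed (use XM iA in measurable)
  have "(\<integral>\<omega>. X \<omega> * I (Suc n) \<omega> \<partial>M) = (\<integral>\<omega>. X \<omega> * indicat_real A \<omega> \<partial>M)"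
  proof (rule Bochner_Integration.integral_cong[OF refl])
    fix \<omega> assume "\<omega> \<in> space M"
    then show "X \<omega> * I (Suc n) \<omega> = X \<omega> * indicat_real A \<omega>"
      using I_range[of \<omega> n] by (auto simp: A_def indicator_def)
  qed
  also have "\<dots> = (\<integral>\<omega>. X \<omega> * real_cond_exp M (history M Z I n) (indicat_real A) \<omega> \<partial>M)"
    by (rule H.real_cond_exp_intg(2)[OF int X iA, symmetric])
  also have "\<dots> = (\<integral>\<omega>. X \<omega> * f (Z n \<omega>) \<partial>M)"
  proof (rule integral_cong_AE)
    show "AE \<omega> in M. X \<omega> * real_cond_exp M (history M Z I n) (indicat_real A) \<omega> = X \<omega> * f (Z n \<omega>)"
      using I_cond_prob[of n] unfolding A_def by eventually_elim simp
    show "(\<lambda>\<omega>. X \<omega> * real_cond_exp M (history M Z I n) (indicat_real A) \<omega>) \<in> borel_measurable M"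
      using XM by (intro borel_measurable_times) auto
    show "(\<lambda>\<omega>. X \<omega> * f (Z n \<omega>)) \<in> borel_measurable M"
      using XM ZM by (intro borel_measurable_times)
  qed
  finally show ?thesis .
qed

lemma is_urn_process:
  assumes "continuous_on UNIV f" "\<And>x. f x \<in> {0<..<1}"
  shows "urn_process M (history M Z I) r f Z I"
proof (intro urn_process.intro prob_space_axioms urn_process_axioms.intro)
  show "I (Suc n) \<in> borel_measurable (history M Z I (Suc n))" for n
    by (rule generator_measurable) auto
  show "(\<integral>\<omega>. X \<omega> * I (Suc n) \<omega> \<partial>M) = (\<integral>\<omega>. X \<omega> * f (Z n \<omega>) \<partial>M)"
    if "X \<in> borel_measurable (history M Z I n)" "\<And>\<omega>. \<omega> \<in> space M \<Longrightarrow> \<bar>X \<omega>\<bar> \<le> C" for X n C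
    using that borel_measurable_continuous_onI[OF assms(1)] by (rule mean_I_eq_mean_f)
qed (use assms history_subalgebra history_mono r_range r_asymp Z_measurable_history Z_in_range I_range Z_Suc in auto)

end

section \<open>Limit configurations and predictability\<close>

context prob_space
begin

text \<open>By uniqueness of limits, any point outside an almost surely exhaustive set
  \<open>S\<close> is the limit with probability 0.\<close>

lemma limit_configs_eq:
  assumes "AE \<omega> in M. \<exists>z\<in>S. (\<lambda>n. Z n \<omega>) \<longlonglongrightarrow> z"
    and "\<And>z. z \<in> S \<Longrightarrow> 0 < prob {\<omega> \<in> space M. (\<lambda>n. Z n \<omega>) \<longlonglongrightarrow> z}"
  shows "limit_configs M Z = S"
proof -
  have "prob {\<omega> \<in> space M. (\<lambda>n. Z n \<omega>) \<longlonglongrightarrow> z} = 0" if z: "z \<notin> S" for z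
  proof (rule prob_eq_0_AE)
    show "AE \<omega> in M. \<not> (\<lambda>n. Z n \<omega>) \<longlonglongrightarrow> z"
      using assms(1) by eventually_elim (use z LIMSEQ_unique in blast)
  qed
  then show ?thesis using assms(2) unfolding limit_configs_def by force
qed

lemma not_predictable_if_two_configs:
  assumes "a \<in> limit_configs M Z" "b \<in> limit_configs M Z" "a \<noteq> b"
  shows "\<not> predictable M Z"
proof
  assume "predictable M Z"
  then obtain z where z: "AE \<omega> in M. (\<lambda>n. Z n \<omega>) \<longlonglongrightarrow> z" unfolding predictable_def by blast
  have "y = z" if "y \<in> limit_configs M Z" for y
  proof (rule ccontr)
    assume "y \<noteq> z"
    have "prob {\<omega> \<in> space M. (\<lambda>n. Z n \<omega>) \<longlonglongrightarrow> y} = 0"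
    proof (rule prob_eq_0_AE)
      show "AE \<omega> in M. \<not> (\<lambda>n. Z n \<omega>) \<longlonglongrightarrow> y"
        using z by eventually_elim (use \<open>y \<noteq> z\<close> LIMSEQ_unique in blast)
    qed
    then show False using that by (simp add: limit_configs_def)
  qed
  then show False using assms by blast
qed

end

context urn_process
begin

lemma unique_fixed_point_is_limit:
  assumes z: "\<And>x. f x = x \<longleftrightarrow> x = z"
  shows "AE \<omega> in M. (\<lambda>n. Z n \<omega>) \<longlonglongrightarrow> z" and "limit_configs M Z = {z}"
proof -
  have "{x. f x = x} = {z}" using z by auto
  then have "AE \<omega> in M. \<exists>p. f p = p \<and> (\<lambda>n. Z n \<omega>) \<longlonglongrightarrow> p"
    by (intro AE_limit_is_fixed_point) simp
  then show lim: "AE \<omega> in M. (\<lambda>n. Z n \<omega>) \<longlonglongrightarrow> z"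
    by eventually_elim (use z in auto)
  show "limit_configs M Z = {z}"
  proof (rule limit_configs_eq)
    show "AE \<omega> in M. \<exists>y\<in>{z}. (\<lambda>n. Z n \<omega>) \<longlonglongrightarrow> y" using lim by simp
    have "AE \<omega> in M. \<omega> \<in> {\<omega> \<in> space M. (\<lambda>n. Z n \<omega>) \<longlonglongrightarrow> z}"
      using lim AE_space by eventually_elim simp
    moreover have "{\<omega> \<in> space M. (\<lambda>n. Z n \<omega>) \<longlonglongrightarrow> z} \<in> sets M" by measurable
    ultimately have "prob {\<omega> \<in> space M. (\<lambda>n. Z n \<omega>) \<longlonglongrightarrow> z} = 1"
      using AE_in_set_eq_1 by blast
    then show "0 < prob {\<omega> \<in> space M. (\<lambda>n. Z n \<omega>) \<longlonglongrightarrow> y}" if "y \<in> {z}" for y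
      using that by simp
  qed
qed

end

section \<open>The logistic response function\<close>

lemma logistic_range: "logistic \<theta> c x \<in> {0<..<1}"
  using exp_gt_zero[of "- \<theta> * (x - c)"] by (auto simp: logistic_def divide_less_eq simp del: exp_gt_zero)

lemma logistic_center: "logistic \<theta> c c = 1/2"
  by (simp add: logistic_def)

lemma logistic_reflect: "logistic \<theta> (1 - c) x = 1 - logistic \<theta> c (1 - x)"
proof -
  define E where "E = exp (\<theta> * (1 - x - c))"
  have E: "0 < E" by (simp add: E_def)
  have e1: "exp (- \<theta> * (x - (1 - c))) = E"
    unfolding E_def by (rule arg_cong[where f = exp]) (simp add: algebra_simps)
  have e2: "exp (- \<theta> * (1 - x - c)) = 1 / E"
    by (simp add: E_def exp_minus inverse_eq_divide)
  show ?thesis unfolding logistic_def e1 e2 using E by (simp add: divide_simps)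
qed

lemma logistic_strict_mono:
  assumes "0 < \<theta>"
  shows "logistic \<theta> c x < logistic \<theta> c y \<longleftrightarrow> x < y"
proof -
  have inv: "1 / (1 + a) < 1 / (1 + b) \<longleftrightarrow> b < a" if "0 < a" "0 < b" for a b :: real
    using that by (simp add: field_simps)
  have "logistic \<theta> c x < logistic \<theta> c y \<longleftrightarrow> exp (- \<theta> * (y - c)) < exp (- \<theta> * (x - c))"
    unfolding logistic_def by (rule inv[OF exp_gt_zero exp_gt_zero])
  also have "\<dots> \<longleftrightarrow> x < y" using assms by simp
  finally show ?thesis .
qed

text \<open>Writing the slope through the value of the function reduces questions about
  \<open>f'\<close> to the distance of that value from 1/2.\<close>

lemma logistic_has_derivative:
  "(logistic \<theta> c has_real_derivative \<theta> * (logistic \<theta> c x * (1 - logistic \<theta> c x))) (at x)"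
proof -
  define E where "E = exp (- \<theta> * (x - c))"
  have E: "0 < E" by (simp add: E_def)
  have "((\<lambda>x. 1 / (1 + exp (- \<theta> * (x - c)))) has_real_derivative \<theta> * E / (1 + E)\<^sup>2) (at x)"
    unfolding E_def using exp_gt_zero[of "- \<theta> * (x - c)"]
    by (auto intro!: derivative_eq_intros simp: power2_eq_square simp del: exp_gt_zero)
  also have "\<theta> * E / (1 + E)\<^sup>2 = \<theta> * (1 / (1 + E) * (1 - 1 / (1 + E)))"
    using E by (simp add: power2_eq_square divide_simps)
  finally show ?thesis unfolding logistic_def[abs_def] E_def .
qed

lemma deriv_logistic: "deriv (logistic \<theta> c) x = \<theta> * (logistic \<theta> c x * (1 - logistic \<theta> c x))"
  using logistic_has_derivative by (rule DERIV_imp_deriv)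

lemma logistic_continuous: "continuous_on S (logistic \<theta> c)"
  by (intro continuous_at_imp_continuous_on ballI DERIV_isCont[OF logistic_has_derivative])

lemma logistic_gap_has_derivative:
  "((\<lambda>x. logistic \<theta> c x - x) has_real_derivative deriv (logistic \<theta> c) x - 1) (at x)"
  unfolding deriv_logistic by (intro derivative_intros logistic_has_derivative)

text \<open>The slope condition is confined to the open interval, so intervals may end at
  \<open>c - d\<close> or \<open>c + d\<close>, where the slope is exactly 1.\<close>

lemma logistic_gap_decreasing:
  assumes "u < v" "\<And>x. u < x \<Longrightarrow> x < v \<Longrightarrow> deriv (logistic \<theta> c) x < 1"
  shows "logistic \<theta> c v - v < logistic \<theta> c u - u"
proof (rule DERIV_neg_imp_decreasing_open[OF assms(1)])
  show "\<exists>y. ((\<lambda>x. logistic \<theta> c x - x) has_real_derivative y) (at x) \<and> y < 0" if "u < x" "x < v" for x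
    using logistic_gap_has_derivative[of \<theta> c x] assms(2)[OF that]
    by (intro exI[of _ "deriv (logistic \<theta> c) x - 1"]) simp
  show "continuous_on {u..v} (\<lambda>x. logistic \<theta> c x - x)"
    by (intro continuous_intros logistic_continuous)
qed

lemma logistic_gap_increasing:
  assumes "u < v" "\<And>x. u < x \<Longrightarrow> x < v \<Longrightarrow> 1 < deriv (logistic \<theta> c) x"
  shows "logistic \<theta> c u - u < logistic \<theta> c v - v"
proof (rule DERIV_pos_imp_increasing_open[OF assms(1)])
  show "\<exists>y. ((\<lambda>x. logistic \<theta> c x - x) has_real_derivative y) (at x) \<and> 0 < y" if "u < x" "x < v" for x
    using logistic_gap_has_derivative[of \<theta> c x] assms(2)[OF that]
    by (intro exI[of _ "deriv (logistic \<theta> c) x - 1"]) simp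
  show "continuous_on {u..v} (\<lambda>x. logistic \<theta> c x - x)"
    by (intro continuous_intros logistic_continuous)
qed

lemma logistic_fixed_point_between:
  assumes "u \<le> v" "u \<le> logistic \<theta> c u" "logistic \<theta> c v \<le> v"
  obtains x where "u \<le> x" "x \<le> v" "logistic \<theta> c x = x"
proof -
  have "\<exists>x. u \<le> x \<and> x \<le> v \<and> logistic \<theta> c x - x = 0"
    by (rule IVT2') (use assms in \<open>auto intro!: continuous_intros logistic_continuous\<close>)
  then show thesis using that by auto
qed

lemma logistic_fixed_point_range: "logistic \<theta> c x = x \<Longrightarrow> 0 < x \<and> x < 1"
  using logistic_range[of \<theta> c x] by auto

lemma deriv_logistic_less_1:
  assumes "0 < \<theta>" "\<theta> \<le> 4" "x \<noteq> c"
  shows "deriv (logistic \<theta> c) x < 1"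
proof -
  let ?L = "logistic \<theta> c x"
  have "?L \<noteq> 1/2"
    using logistic_strict_mono[OF assms(1), of c x c] logistic_strict_mono[OF assms(1), of c c x]
      logistic_center[of \<theta> c] assms(3) by linarith
  then have "0 < (?L - 1/2)\<^sup>2" by simp
  then have lt: "?L * (1 - ?L) < 1/4" by (simp add: power2_eq_square algebra_simps)
  have "\<theta> * (?L * (1 - ?L)) < \<theta> * (1/4)" using lt assms(1) by (rule mult_strict_left_mono)
  then show ?thesis using assms(2) by (simp add: deriv_logistic)
qed

text \<open>With \<open>s = sqrt (1/4 - 1/\<theta>)\<close> one has
  \<open>f' = 1 + \<theta> * (s\<^sup>2 - (f - 1/2)\<^sup>2)\<close>, so \<open>f' > 1\<close> means
  that \<open>f\<close> is within \<open>s\<close> of 1/2. The width \<open>d\<close> is defined by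
  \<open>f (c + d) = 1/2 + s\<close>, and monotonicity transfers the comparison to \<open>x\<close>.
  Nothing yet says that \<open>c - d\<close> and \<open>c + d\<close> lie in the unit
  interval.\<close>

lemma deriv_logistic_half_width:
  assumes "4 < \<theta>"
  shows "\<exists>d>0. \<forall>x. (1 < deriv (logistic \<theta> c) x \<longleftrightarrow> \<bar>x - c\<bar> < d) \<and>
    (deriv (logistic \<theta> c) x < 1 \<longleftrightarrow> d < \<bar>x - c\<bar>) \<and> (deriv (logistic \<theta> c) x = 1 \<longleftrightarrow> \<bar>x - c\<bar> = d)"
proof -
  have \<theta>: "0 < \<theta>" using assms by simp
  define s where "s = sqrt (1/4 - 1/\<theta>)"
  have s2: "s\<^sup>2 = 1/4 - 1/\<theta>" using assms by (simp add: s_def field_simps)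
  have s0: "0 < s" using assms by (simp add: s_def field_simps)
  have "s\<^sup>2 < 1/4" unfolding s2 using \<theta> by simp
  then have "s\<^sup>2 < (1/2)\<^sup>2" by (simp add: power_divide)
  then have s1: "s < 1/2" by (rule power_less_imp_less_base) simp
  define d where "d = ln ((1/2 + s) / (1/2 - s)) / \<theta>"
  have rpos: "0 < (1/2 + s) / (1/2 - s)" using s0 s1 by simp
  have "1 < (1/2 + s) / (1/2 - s)" using s0 s1 by (simp add: field_simps)
  then have d0: "0 < d" using \<theta> by (simp add: d_def)
  have \<theta>d: "\<theta> * d = ln ((1/2 + s) / (1/2 - s))" using \<theta> by (simp add: d_def)
  have ed: "exp (\<theta> * d) = (1/2 + s) / (1/2 - s)" unfolding \<theta>d using rpos by (rule exp_ln)
  have up: "logistic \<theta> c (c + d) = 1/2 + s"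
    using s0 s1 by (simp add: logistic_def exp_minus ed field_simps)
  have dn: "logistic \<theta> c (c - d) = 1/2 - s"
    using s0 s1 by (simp add: logistic_def ed field_simps)
  have val: "deriv (logistic \<theta> c) x = 1 + \<theta> * (s\<^sup>2 - (logistic \<theta> c x - 1/2)\<^sup>2)" for x
    using \<theta> unfolding deriv_logistic s2 by (simp add: power2_eq_square field_simps)
  have lt: "(logistic \<theta> c x - 1/2)\<^sup>2 < s\<^sup>2 \<longleftrightarrow> \<bar>x - c\<bar> < d" for x
  proof -
    have "(logistic \<theta> c x - 1/2)\<^sup>2 < s\<^sup>2 \<longleftrightarrow> \<bar>logistic \<theta> c x - 1/2\<bar> < \<bar>s\<bar>"
      using abs_le_square_iff[of s "logistic \<theta> c x - 1/2"] by (simp add: not_le[symmetric])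
    also have "\<dots> \<longleftrightarrow> logistic \<theta> c (c - d) < logistic \<theta> c x \<and> logistic \<theta> c x < logistic \<theta> c (c + d)"
      unfolding up dn using s0 by linarith
    also have "\<dots> \<longleftrightarrow> \<bar>x - c\<bar> < d" unfolding logistic_strict_mono[OF \<theta>] by linarith
    finally show ?thesis .
  qed
  have gt: "s\<^sup>2 < (logistic \<theta> c x - 1/2)\<^sup>2 \<longleftrightarrow> d < \<bar>x - c\<bar>" for x
  proof -
    have "s\<^sup>2 < (logistic \<theta> c x - 1/2)\<^sup>2 \<longleftrightarrow> \<bar>s\<bar> < \<bar>logistic \<theta> c x - 1/2\<bar>"
      using abs_le_square_iff[of "logistic \<theta> c x - 1/2" s] by (simp add: not_le[symmetric])
    also have "\<dots> \<longleftrightarrow> logistic \<theta> c x < logistic \<theta> c (c - d) \<or> logistic \<theta> c (c + d) < logistic \<theta> c x"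
      unfolding up dn using s0 by linarith
    also have "\<dots> \<longleftrightarrow> d < \<bar>x - c\<bar>" unfolding logistic_strict_mono[OF \<theta>] using d0 by linarith
    finally show ?thesis .
  qed
  have g: "1 < deriv (logistic \<theta> c) x \<longleftrightarrow> \<bar>x - c\<bar> < d" for x
    using \<theta> by (simp add: val lt[symmetric] zero_less_mult_iff)
  have l: "deriv (logistic \<theta> c) x < 1 \<longleftrightarrow> d < \<bar>x - c\<bar>" for x
    using \<theta> by (simp add: val gt[symmetric] mult_less_0_iff)
  have "deriv (logistic \<theta> c) x = 1 \<longleftrightarrow> \<bar>x - c\<bar> = d" for x
    using g[of x] l[of x] by linarith
  then show ?thesis using d0 g l by blast
qed

text \<open>The gap \<open>f x - x\<close> is strictly decreasing on the half-line that contains all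
  fixed points. Existence comes from its signs at 0 and 1.\<close>

lemma logistic_unique_fixed_point_if_ge:
  assumes "\<And>x. u < x \<Longrightarrow> deriv (logistic \<theta> c) x < 1"
    and "\<And>x. logistic \<theta> c x = x \<Longrightarrow> u \<le> x"
  shows "\<exists>z. \<forall>x. logistic \<theta> c x = x \<longleftrightarrow> x = z"
proof -
  obtain z where z: "logistic \<theta> c z = z"
    using logistic_fixed_point_between[of 0 1 \<theta> c] logistic_range[of \<theta> c 0] logistic_range[of \<theta> c 1] by auto
  have no: "\<not> x < y" if "logistic \<theta> c x = x" "logistic \<theta> c y = y" for x y
    using logistic_gap_decreasing[of x y \<theta> c] assms that by fastforce
  have "x = z" if "logistic \<theta> c x = x" for x
    using no[OF that z] no[OF z that] by linarith
  then show ?thesis using z by blast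
qed

lemma logistic_unique_fixed_point_if_le:
  assumes "\<And>x. x < u \<Longrightarrow> deriv (logistic \<theta> c) x < 1"
    and "\<And>x. logistic \<theta> c x = x \<Longrightarrow> x \<le> u"
  shows "\<exists>z. \<forall>x. logistic \<theta> c x = x \<longleftrightarrow> x = z"
proof -
  obtain z where z: "logistic \<theta> c z = z"
    using logistic_fixed_point_between[of 0 1 \<theta> c] logistic_range[of \<theta> c 0] logistic_range[of \<theta> c 1] by auto
  have no: "\<not> x < y" if "logistic \<theta> c x = x" "logistic \<theta> c y = y" for x y
    using logistic_gap_decreasing[of x y \<theta> c] assms that by fastforce
  have "x = z" if "logistic \<theta> c x = x" for x
    using no[OF that z] no[OF z that] by linarith
  then show ?thesis using z by blast
qed

lemma logistic_unique_fixed_point_small_slope: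
  assumes "0 < \<theta>" "\<theta> \<le> 4"
  shows "\<exists>z. \<forall>x. logistic \<theta> c x = x \<longleftrightarrow> x = z"
proof -
  obtain z where z: "logistic \<theta> c z = z"
    using logistic_fixed_point_between[of 0 1 \<theta> c] logistic_range[of \<theta> c 0] logistic_range[of \<theta> c 1] by auto
  \<comment> \<open>At \<open>\<theta> = 4\<close> the slope equals 1 at \<open>c\<close>, so the
    gap is compared on the two sides of \<open>c\<close> separately and then chained through
    \<open>c\<close>.\<close>
  have dec: "logistic \<theta> c v - v < logistic \<theta> c u - u" if "u < v" "v \<le> c \<or> c \<le> u" for u v
    by (rule logistic_gap_decreasing[OF that(1)], rule deriv_logistic_less_1) (use assms that in auto)
  have no: "\<not> x < y" if "logistic \<theta> c x = x" "logistic \<theta> c y = y" for x y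
    using dec[of x y] dec[of x c] dec[of c y] that by (cases "x < c"; cases "c < y") auto
  have "x = z" if "logistic \<theta> c x = x" for x
    using no[OF that z] no[OF z that] by linarith
  then show ?thesis using z by blast
qed

lemma gap_difference_quotient_tendsto:
  assumes "((\<lambda>x. g x - x) has_real_derivative D) (at p)"
  shows "((\<lambda>x. ((g x - x) - (g p - p)) / (x - p)) \<longlongrightarrow> D) (at p)"
  using assms by (simp add: has_field_derivative_iff)

section \<open>Limits of a process with logistic response\<close>

context urn_process
begin

text \<open>Slope 1 at \<open>B\<close> means that the gap has derivative 0 there, so near
  \<open>B\<close> its difference quotient exceeds \<open>-1/16\<close>. With
  \<open>f B \<le> B\<close> this is the drift condition of the barrier lemma, including the
  tangency \<open>f B = B\<close>.\<close>

lemma logistic_left_limit_has_positive_probability: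
  assumes f: "f = logistic \<theta> c" and B: "0 < B" "deriv (logistic \<theta> c) B = 1" "f B \<le> B"
    and fin: "finite {x. f x = x}" and a: "\<And>x. f x = x \<Longrightarrow> x \<le> B \<Longrightarrow> x = a"
  shows "0 < prob {\<omega> \<in> space M. (\<lambda>n. Z n \<omega>) \<longlonglongrightarrow> a}"
proof -
  have "((\<lambda>x. ((f x - x) - (f B - B)) / (x - B)) \<longlongrightarrow> 1 - 1) (at B)"
    using gap_difference_quotient_tendsto[OF logistic_gap_has_derivative[of \<theta> c B]] B(2) by (simp add: f)
  then have "\<forall>\<^sub>F x in at B. - 1/16 < ((f x - x) - (f B - B)) / (x - B)"
    by (rule order_tendstoD) simp
  then obtain e where e: "0 < e" "\<And>x. x \<noteq> B \<Longrightarrow> dist x B < e \<Longrightarrow> - 1/16 < ((f x - x) - (f B - B)) / (x - B)"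
    unfolding eventually_at by auto
  define B0 where "B0 = max (B / 2) (B - e / 2)"
  show ?thesis
  proof (rule converges_below_barrier[OF _ _ _ fin a])
    show "0 < B0" "B0 < B" using B e(1) by (auto simp: B0_def)
    fix x assume x: "B0 \<le> x" "x \<le> B"
    show "f x - x \<le> (B - x) / 16"
    proof (cases "x = B")
      case False
      have "dist x B < e" using x e(1) by (auto simp: B0_def dist_real_def)
      then have "- 1/16 < ((f x - x) - (f B - B)) / (x - B)" using e(2) False by blast
      moreover have "x - B < 0" using x False by simp
      ultimately have "(f x - x) - (f B - B) < - 1/16 * (x - B)" by (simp add: less_divide_eq)
      then show ?thesis using B(3) by (simp add: field_simps)
    qed (use B(3) in simp)
  qed
qed

text \<open>Near \<open>p\<close> the drift quotient exceeds \<open>\<kappa>\<close>, half the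
  excess of the slope over 1; multiplied by \<open>(x - p)\<^sup>2\<close> this is the repulsion
  hypothesis.\<close>

lemma logistic_steep_fixed_point_not_limit:
  assumes f: "f = logistic \<theta> c" and p: "f p = p" "1 < deriv (logistic \<theta> c) p"
  shows "AE \<omega> in M. \<not> (\<lambda>n. Z n \<omega>) \<longlonglongrightarrow> p"
proof -
  define \<kappa> where "\<kappa> = (deriv (logistic \<theta> c) p - 1) / 2"
  have \<kappa>: "0 < \<kappa>" using p(2) by (simp add: \<kappa>_def)
  have "((\<lambda>x. ((f x - x) - (f p - p)) / (x - p)) \<longlongrightarrow> deriv (logistic \<theta> c) p - 1) (at p)"
    using gap_difference_quotient_tendsto[OF logistic_gap_has_derivative[of \<theta> c p]] by (simp add: f)
  then have "\<forall>\<^sub>F x in at p. \<kappa> < ((f x - x) - (f p - p)) / (x - p)"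
    by (rule order_tendstoD) (use p(2) in \<open>simp add: \<kappa>_def\<close>)
  then obtain e where e: "0 < e" "\<And>x. x \<noteq> p \<Longrightarrow> dist x p < e \<Longrightarrow> \<kappa> < ((f x - x) - (f p - p)) / (x - p)"
    unfolding eventually_at by auto
  show ?thesis
  proof (rule unstable_point_not_limit[OF _ \<kappa>])
    show "0 < e / 2" using e(1) by simp
    fix x assume x: "\<bar>x - p\<bar> \<le> e / 2"
    show "\<kappa> * (x - p)\<^sup>2 \<le> (f x - x) * (x - p)"
    proof (cases "x = p")
      case False
      have "dist x p < e" using x e(1) by (simp add: dist_real_def)
      then have "\<kappa> < (f x - x) / (x - p)" using e(2)[OF False] p(1) by simp
      then have "\<kappa> * (x - p)\<^sup>2 \<le> (f x - x) / (x - p) * (x - p)\<^sup>2" by (intro mult_right_mono) auto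
      then show ?thesis using False by (simp add: power2_eq_square)
    qed simp
  qed
qed

text \<open>The gap falls up to \<open>c - d\<close>, rises to \<open>c + d\<close> and falls again.
  The sign conditions put exactly one fixed point on each falling branch. The uniqueness clause for
  \<open>b\<close> is exported so that the symmetric case can identify \<open>b\<close> with
  \<open>1 - a\<close>.\<close>

lemma logistic_bistable:
  assumes f: "f = logistic \<theta> c" and d: "0 < d" "0 < c - d" "c + d < 1"
    and gt: "\<And>x. 1 < deriv (logistic \<theta> c) x \<longleftrightarrow> \<bar>x - c\<bar> < d"
    and lt: "\<And>x. deriv (logistic \<theta> c) x < 1 \<longleftrightarrow> d < \<bar>x - c\<bar>"
    and left: "f (c - d) \<le> c - d" and right: "c + d \<le> f (c + d)"
  shows "\<exists>a b. 0 < a \<and> a \<le> c - d \<and> c + d \<le> b \<and> b < 1 \<and> f a = a \<and> f b = b \<and>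
    (\<forall>x. f x = x \<longrightarrow> c + d \<le> x \<longrightarrow> x = b) \<and>
    limit_configs M Z = {a, b} \<and> (AE \<omega> in M. \<exists>z\<in>{a, b}. (\<lambda>n. Z n \<omega>) \<longlonglongrightarrow> z) \<and> \<not> predictable M Z"
proof -
  have dec_left: "f v - v < f u - u" if "u < v" "v \<le> c - d" for u v
    unfolding f by (rule logistic_gap_decreasing[OF that(1)]) (use that(2) d lt in auto)
  have dec_right: "f v - v < f u - u" if "u < v" "c + d \<le> u" for u v
    unfolding f by (rule logistic_gap_decreasing[OF that(1)]) (use that(2) d lt in auto)
  have inc: "f u - u < f v - v" if "u < v" "c - d \<le> u" "v \<le> c + d" for u v
    unfolding f by (rule logistic_gap_increasing[OF that(1)]) (use that(2,3) d gt in auto)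
  obtain a where a: "0 \<le> a" "a \<le> c - d" "f a = a"
    using logistic_fixed_point_between[of 0 "c - d" \<theta> c] logistic_range[of \<theta> c 0] d left by (auto simp: f)
  obtain b where b: "c + d \<le> b" "b \<le> 1" "f b = b"
    using logistic_fixed_point_between[of "c + d" 1 \<theta> c] logistic_range[of \<theta> c 1] d right by (auto simp: f)
  have a01: "0 < a" using logistic_fixed_point_range a(3) f by blast
  have b01: "b < 1" using logistic_fixed_point_range b(3) f by blast
  have ua: "x = a" if "f x = x" "x \<le> c - d" for x
    using dec_left[of x a] dec_left[of a x] that a by fastforce
  have ub: "x = b" if "f x = x" "c + d \<le> x" for x
    using dec_right[of x b] dec_right[of b x] that b by fastforce
  \<comment> \<open>Both endpoints are excluded: a tangency there is \<open>a\<close> or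
    \<open>b\<close> itself and does occur as a limit, whereas everything in \<open>S\<close> has
    slope above 1.\<close>
  define S where "S = {x. f x = x \<and> c - d < x \<and> x < c + d}"
  have fixS: "{x. f x = x} = {a, b} \<union> S"
  proof (rule set_eqI)
    show "x \<in> {x. f x = x} \<longleftrightarrow> x \<in> {a, b} \<union> S" for x
      using ua[of x] ub[of x] a(3) b(3) unfolding S_def
      by (cases "x \<le> c - d"; cases "c + d \<le> x") auto
  qed
  have "x = y" if "x \<in> S" "y \<in> S" for x y
    using inc[of x y] inc[of y x] that unfolding S_def by fastforce
  then have finS: "finite S" by (metis finite.simps subsetI finite_subset insertCI is_singletonI' is_singleton_def finite.emptyI)
  then have fin: "finite {x. f x = x}" by (simp add: fixS)
  have "AE \<omega> in M. \<forall>p\<in>S. \<not> (\<lambda>n. Z n \<omega>) \<longlonglongrightarrow> p"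
  proof (rule AE_finite_allI[OF finS])
    fix p assume "p \<in> S"
    then show "AE \<omega> in M. \<not> (\<lambda>n. Z n \<omega>) \<longlonglongrightarrow> p"
      using gt[of p] by (intro logistic_steep_fixed_point_not_limit[OF f]) (auto simp: S_def)
  qed
  then have lim: "AE \<omega> in M. \<exists>z\<in>{a, b}. (\<lambda>n. Z n \<omega>) \<longlonglongrightarrow> z"
    using AE_limit_is_fixed_point[OF fin] by eventually_elim (use fixS in blast)
  have one: "deriv (logistic \<theta> c) (c - d) = 1" "deriv (logistic \<theta> c) (c + d) = 1"
    using gt[of "c - d"] lt[of "c - d"] gt[of "c + d"] lt[of "c + d"] d(1) by auto
  have Pa: "0 < prob {\<omega> \<in> space M. (\<lambda>n. Z n \<omega>) \<longlonglongrightarrow> a}"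
    by (rule logistic_left_limit_has_positive_probability[OF f d(2) one(1) left fin ua])
  have Pb: "0 < prob {\<omega> \<in> space M. (\<lambda>n. Z n \<omega>) \<longlonglongrightarrow> b}"
  proof -
    \<comment> \<open>Reflection turns \<open>b\<close> into the lower fixed point of the logistic
      function centred at \<open>1 - c\<close>, with barrier \<open>1 - (c + d)\<close>.\<close>
    interpret R: urn_process M F r "\<lambda>x. 1 - f (1 - x)" "\<lambda>n \<omega>. 1 - Z n \<omega>" "\<lambda>n \<omega>. 1 - I n \<omega>"
      by (rule reflected_urn_process)
    have fR: "(\<lambda>x. 1 - f (1 - x)) = logistic \<theta> (1 - c)"
      by (rule ext) (simp add: f logistic_reflect)
    have "0 < prob {\<omega> \<in> space M. (\<lambda>n. 1 - Z n \<omega>) \<longlonglongrightarrow> 1 - b}"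
    proof (rule R.logistic_left_limit_has_positive_probability[OF fR])
      show "0 < 1 - (c + d)" using d by simp
      show "deriv (logistic \<theta> (1 - c)) (1 - (c + d)) = 1"
        using one(2) by (simp add: deriv_logistic logistic_reflect mult.commute)
      show "1 - f (1 - (1 - (c + d))) \<le> 1 - (c + d)" using right by simp
      have "{x. 1 - f (1 - x) = x} = (\<lambda>x. 1 - x) ` {x. f x = x}"
        by (auto simp: image_iff algebra_simps) (metis add_diff_cancel_left' diff_add_cancel)
      then show "finite {x. 1 - f (1 - x) = x}" using fin by simp
      show "x = 1 - b" if "1 - f (1 - x) = x" "x \<le> 1 - (c + d)" for x
        using ub[of "1 - x"] that by simp
    qed
    also have "{\<omega> \<in> space M. (\<lambda>n. 1 - Z n \<omega>) \<longlonglongrightarrow> 1 - b} = {\<omega> \<in> space M. (\<lambda>n. Z n \<omega>) \<longlonglongrightarrow> b}"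
      using tendsto_diff[OF tendsto_const[of 1]] by (intro Collect_cong conj_cong refl iffI) force+
    finally show ?thesis .
  qed
  have configs: "limit_configs M Z = {a, b}"
    by (rule limit_configs_eq[OF lim]) (use Pa Pb in auto)
  have "\<not> predictable M Z"
    by (rule not_predictable_if_two_configs[of a Z b]) (use configs a b d in auto)
  then show ?thesis using a b a01 b01 ub configs lim by blast
qed

end

section \<open>Fixed points under the conditions U1, U2, U3\<close>

lemma xhat_eq:
  assumes d: "0 < d" "0 < c - d" "c + d < 1"
    and eq: "\<And>x. deriv (logistic \<theta> c) x = 1 \<longleftrightarrow> \<bar>x - c\<bar> = d"
  shows "xhat1 \<theta> c = c - d" "xhat2 \<theta> c = c + d"
    "{x \<in> {0..1}. deriv (logistic \<theta> c) x = 1} = {c - d, c + d}"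
proof -
  show "xhat1 \<theta> c = c - d"
    unfolding xhat1_def by (rule the_equality) (use d eq in auto)
  show "xhat2 \<theta> c = c + d"
    unfolding xhat2_def by (rule the_equality) (use d eq in auto)
  show "{x \<in> {0..1}. deriv (logistic \<theta> c) x = 1} = {c - d, c + d}"
    using d unfolding eq by auto
qed

text \<open>For \<open>\<theta> > 4\<close> the gap has a local minimum at \<open>c - d\<close> and
  a local maximum at \<open>c + d\<close>. If both lie in (0,1), then U2 fails and U3 says that the
  minimum is positive or the maximum negative. Otherwise one of the falling branches misses (0,1).
  In each case the fixed points are confined to a single falling branch.\<close>

lemma logistic_unique_fixed_point:
  assumes c: "0 < c" "c < 1" and \<theta>: "0 < \<theta>" and U: "U1 \<theta> c \<or> U2 \<theta> c \<or> U3 \<theta> c"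
  shows "\<exists>z. \<forall>x. logistic \<theta> c x = x \<longleftrightarrow> x = z"
proof (cases "\<theta> \<le> 4")
  case True
  then show ?thesis using logistic_unique_fixed_point_small_slope \<theta> by blast
next
  case False
  let ?L = "logistic \<theta> c"
  have "4 < \<theta>" using False by simp
  then obtain d where d: "0 < d" and all: "\<forall>x. (1 < deriv ?L x \<longleftrightarrow> \<bar>x - c\<bar> < d) \<and>
    (deriv ?L x < 1 \<longleftrightarrow> d < \<bar>x - c\<bar>) \<and> (deriv ?L x = 1 \<longleftrightarrow> \<bar>x - c\<bar> = d)"
    using deriv_logistic_half_width by blast
  have gt: "1 < deriv ?L x \<longleftrightarrow> \<bar>x - c\<bar> < d" and lt: "deriv ?L x < 1 \<longleftrightarrow> d < \<bar>x - c\<bar>"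
    and eq: "deriv ?L x = 1 \<longleftrightarrow> \<bar>x - c\<bar> = d" for x
    using all[rule_format, of x] by simp_all
  have dec_left: "?L v - v < ?L u - u" if "u < v" "v \<le> c - d" for u v
    by (rule logistic_gap_decreasing[OF that(1)]) (use that(2) d lt in auto)
  have dec_right: "?L v - v < ?L u - u" if "u < v" "c + d \<le> u" for u v
    by (rule logistic_gap_decreasing[OF that(1)]) (use that(2) d lt in auto)
  have inc: "?L u - u < ?L v - v" if "u < v" "c - d \<le> u" "v \<le> c + d" for u v
    by (rule logistic_gap_increasing[OF that(1)]) (use that(2,3) d gt in auto)
  have h0: "0 < ?L 0 - 0" and h1: "?L 1 - 1 < 0"
    using logistic_range[of \<theta> c 0] logistic_range[of \<theta> c 1] by auto
  \<comment> \<open>A gap that is positive up to \<open>c + d\<close> forces every fixed point onto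
    the right falling branch.\<close>
  have right: ?thesis if no: "\<And>x. 0 < x \<Longrightarrow> x < c + d \<Longrightarrow> 0 < ?L x - x"
  proof (rule logistic_unique_fixed_point_if_ge)
    show "deriv ?L x < 1" if "c + d < x" for x using that lt d by auto
    show "c + d \<le> x" if "?L x = x" for x
      using no[of x] that logistic_fixed_point_range[OF that] by fastforce
  qed
  have left: ?thesis if no: "\<And>x. c - d < x \<Longrightarrow> x < 1 \<Longrightarrow> ?L x - x < 0"
  proof (rule logistic_unique_fixed_point_if_le)
    show "deriv ?L x < 1" if "x < c - d" for x using that lt d by auto
    show "x \<le> c - d" if "?L x = x" for x
      using no[of x] that logistic_fixed_point_range[OF that] by fastforce
  qed
  consider "c - d \<le> 0" | "1 \<le> c + d"
    | "0 < c - d" "c + d < 1" "c - d < ?L (c - d)" | "0 < c - d" "c + d < 1" "?L (c + d) < c + d"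
  proof -
    have "\<not> U1 \<theta> c" using False by (simp add: U1_def)
    then show thesis
    proof (cases "0 < c - d \<and> c + d < 1")
      case True
      have "deriv ?L 0 < 1" "deriv ?L 1 < 1" using lt[of 0] lt[of 1] True c by auto
      then have "\<not> U2 \<theta> c" by (simp add: U2_def)
      then have "U3 \<theta> c" using U \<open>\<not> U1 \<theta> c\<close> by blast
      then show thesis using that(3,4) True xhat_eq[OF d _ _ eq] by (auto simp: U3_def)
    next
      case False
      then show thesis using that(1,2) by linarith
    qed
  qed
  then show ?thesis
  proof cases
    case 1
    show ?thesis
    proof (rule right)
      \<comment> \<open>The left falling branch lies outside (0,1): the gap is positive at 0 and
        rises from there.\<close>
      show "0 < ?L x - x" if "0 < x" "x < c + d" for x using inc[of 0 x] that 1 h0 by linarith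
    qed
  next
    case 2
    show ?thesis
    proof (rule left)
      show "?L x - x < 0" if "c - d < x" "x < 1" for x using inc[of x 1] that 2 h1 by linarith
    qed
  next
    case 3
    show ?thesis
    proof (rule right)
      show "0 < ?L x - x" if "0 < x" "x < c + d" for x
        using inc[of "c - d" x] dec_left[of x "c - d"] that 3 by (cases x "c - d" rule: linorder_cases) auto
    qed
  next
    case 4
    show ?thesis
    proof (rule left)
      show "?L x - x < 0" if "c - d < x" "x < 1" for x
        using inc[of x "c + d"] dec_right[of "c + d" x] that 4 by (cases x "c + d" rule: linorder_cases) auto
    qed
  qed
qed

lemma logistic_half:
  assumes "0 < \<theta>"
  shows "c < 1/2 \<Longrightarrow> 1/2 < logistic \<theta> c (1/2)" and "1/2 < c \<Longrightarrow> logistic \<theta> c (1/2) < 1/2"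
  using logistic_strict_mono[OF assms, of c c "1/2"] logistic_strict_mono[OF assms, of c "1/2" c]
  by (simp_all add: logistic_center)

text \<open>The sign of the gap at 1/2 depends on the side of 1/2 on which \<open>c\<close> lies,
  and the intermediate value theorem finds a fixed point on the opposite side; by uniqueness it is
  \<open>z\<close>. Since \<open>f c = 1/2\<close>, the point \<open>c\<close> is fixed only when it
  equals 1/2.\<close>

lemma unique_logistic_fixed_point_location:
  assumes \<theta>: "0 < \<theta>" and z: "\<And>x. logistic \<theta> c x = x \<longleftrightarrow> x = z"
  shows "0 < z" "z < 1" "1/2 < c \<Longrightarrow> z < 1/2" "c < 1/2 \<Longrightarrow> 1/2 < z" "c \<noteq> 1/2 \<Longrightarrow> z \<noteq> c"
proof -
  have fz: "logistic \<theta> c z = z" using z by simp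
  show "0 < z" "z < 1" using logistic_fixed_point_range[OF fz] by auto
  show "z < 1/2" if c: "1/2 < c"
  proof -
    obtain x where "0 \<le> x" "x \<le> 1/2" "logistic \<theta> c x = x"
      using logistic_fixed_point_between[of 0 "1/2" \<theta> c] logistic_range[of \<theta> c 0] logistic_half(2)[OF \<theta> c] by auto
    then show ?thesis using z fz logistic_half(2)[OF \<theta> c] by (cases "z = 1/2") auto
  qed
  show "1/2 < z" if c: "c < 1/2"
  proof -
    obtain x where "1/2 \<le> x" "x \<le> 1" "logistic \<theta> c x = x"
      using logistic_fixed_point_between[of "1/2" 1 \<theta> c] logistic_range[of \<theta> c 1] logistic_half(1)[OF \<theta> c] by auto
    then show ?thesis using z fz logistic_half(1)[OF \<theta> c] by (cases "z = 1/2") auto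
  qed
  show "z \<noteq> c" if "c \<noteq> 1/2" using fz that logistic_center[of \<theta> c] by auto
qed

theorem mainTheorem9:
  fixes M :: "'a measure" and r :: "nat \<Rightarrow> real" and Z I :: "nat \<Rightarrow> 'a \<Rightarrow> real"
    and \<theta> c :: real
  assumes "0 < c" and "c < 1" and "\<theta> > 0"
    and "single_unit_process M r (logistic \<theta> c) Z I"
  shows
    "(c = 1/2 \<longrightarrow>
       (\<theta> \<le> 4 \<longrightarrow>
          predictable M Z \<and>
          (AE \<omega> in M. (\<lambda>n. Z n \<omega>) \<longlonglongrightarrow> 1/2) \<and>
          limit_configs M Z = {1/2}) \<and>
       (\<theta> > 4 \<longrightarrow>
          {x \<in> {0..1}. deriv (logistic \<theta> c) x = 1} = {xhat1 \<theta> c, xhat2 \<theta> c} \<and>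
          xhat1 \<theta> c < 1/2 \<and> 1/2 < xhat2 \<theta> c \<and> xhat2 \<theta> c = 1 - xhat1 \<theta> c \<and>
          {0<..xhat1 \<theta> c} \<union> {xhat2 \<theta> c..<1} \<subseteq> {0<..<1} - {1/2} \<and>
          (AE \<omega> in M. convergent (\<lambda>n. Z n \<omega>)) \<and>
          \<not> predictable M Z \<and>
          (\<exists>a b. a \<noteq> b \<and>
             limit_configs M Z = {a, b} \<and>
             (AE \<omega> in M. \<exists>z \<in> {a, b}. (\<lambda>n. Z n \<omega>) \<longlonglongrightarrow> z) \<and>
             {a, b} \<subseteq> {0<..xhat1 \<theta> c} \<union> {xhat2 \<theta> c..<1} \<and>
             b = 1 - a))) \<and>
     (c \<noteq> 1/2 \<longrightarrow>
       (max (deriv (logistic \<theta> c) 0) (deriv (logistic \<theta> c) 1) < 1 \<and> 1 < \<theta> / 4 \<longrightarrow>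
          {x \<in> {0..1}. deriv (logistic \<theta> c) x = 1} = {xhat1 \<theta> c, xhat2 \<theta> c} \<and>
          xhat1 \<theta> c \<in> {0<..<c} \<and> xhat2 \<theta> c \<in> {c<..<1} \<and>
          xhat2 \<theta> c = 2 * c - xhat1 \<theta> c) \<and>
       (U1 \<theta> c \<or> U2 \<theta> c \<or> U3 \<theta> c \<longrightarrow>
          predictable M Z \<and>
          (\<exists>z. (AE \<omega> in M. (\<lambda>n. Z n \<omega>) \<longlonglongrightarrow> z) \<and>
             limit_configs M Z = {z} \<and>
             z \<in> {0<..<1} - {c, 1/2} \<and>
             (c > 1/2 \<longrightarrow> z < 1/2) \<and>
             (c < 1/2 \<longrightarrow> z > 1/2))) \<and>
       (\<not> (U1 \<theta> c \<or> U2 \<theta> c \<or> U3 \<theta> c) \<longrightarrow>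
          {0<..xhat1 \<theta> c} - {1/2} \<subseteq> {0<..<c} - {1/2} \<and>
          {xhat2 \<theta> c..<1} - {1/2} \<subseteq> {c<..<1} - {1/2} \<and>
          (AE \<omega> in M. convergent (\<lambda>n. Z n \<omega>)) \<and>
          \<not> predictable M Z \<and>
          (\<exists>a b. a \<noteq> b \<and>
             limit_configs M Z = {a, b} \<and>
             (AE \<omega> in M. \<exists>z \<in> {a, b}. (\<lambda>n. Z n \<omega>) \<longlonglongrightarrow> z) \<and>
             {a, b} \<subseteq> {0<..<1} - {c, 1/2} \<and>
             a \<in> {0<..xhat1 \<theta> c} - {1/2} \<and>
             b \<in> {xhat2 \<theta> c..<1} - {1/2} \<and>
             a < 1/2 \<and> 1/2 < b)))"
proof -
  let ?L = "logistic \<theta> c"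
  interpret S: single_unit_process M r ?L Z I by (rule assms(4))
  interpret urn_process M "history M Z I" r ?L Z I
    by (rule S.is_urn_process[OF logistic_continuous logistic_range])
  note c = assms(1,2) and \<theta> = assms(3)
  have single: "predictable M Z \<and> (AE \<omega> in M. (\<lambda>n. Z n \<omega>) \<longlonglongrightarrow> z) \<and> limit_configs M Z = {z}"
    if "\<And>x. ?L x = x \<longleftrightarrow> x = z" for z
    using unique_fixed_point_is_limit[OF that] unfolding predictable_def by blast
  have width: "\<exists>d>0. \<forall>x. (1 < deriv ?L x \<longleftrightarrow> \<bar>x - c\<bar> < d) \<and> (deriv ?L x < 1 \<longleftrightarrow> d < \<bar>x - c\<bar>) \<and>
      (deriv ?L x = 1 \<longleftrightarrow> \<bar>x - c\<bar> = d)" if "4 < \<theta>"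
    by (rule deriv_logistic_half_width[OF that])
  have conv: "AE \<omega> in M. convergent (\<lambda>n. Z n \<omega>)"
    if "AE \<omega> in M. \<exists>z\<in>A. (\<lambda>n. Z n \<omega>) \<longlonglongrightarrow> z" for A
    using that by eventually_elim (auto intro: convergentI)
  have A1: "predictable M Z \<and> (AE \<omega> in M. (\<lambda>n. Z n \<omega>) \<longlonglongrightarrow> 1/2) \<and> limit_configs M Z = {1/2}"
    if half: "c = 1/2" and "\<theta> \<le> 4"
  proof (rule single)
    obtain z where z: "\<And>x. ?L x = x \<longleftrightarrow> x = z"
      using logistic_unique_fixed_point_small_slope[OF \<theta> \<open>\<theta> \<le> 4\<close>, of c] by auto
    have "?L (1/2) = 1/2" using logistic_center[of \<theta> c] unfolding half .
    then have "1/2 = z" unfolding z .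
    then show "?L x = x \<longleftrightarrow> x = 1/2" for x unfolding z by (simp only:)
  qed
  have A2: "{x \<in> {0..1}. deriv ?L x = 1} = {xhat1 \<theta> c, xhat2 \<theta> c} \<and>
      xhat1 \<theta> c < 1/2 \<and> 1/2 < xhat2 \<theta> c \<and> xhat2 \<theta> c = 1 - xhat1 \<theta> c \<and>
      {0<..xhat1 \<theta> c} \<union> {xhat2 \<theta> c..<1} \<subseteq> {0<..<1} - {1/2} \<and>
      (AE \<omega> in M. convergent (\<lambda>n. Z n \<omega>)) \<and> \<not> predictable M Z \<and>
      (\<exists>a b. a \<noteq> b \<and> limit_configs M Z = {a, b} \<and>
         (AE \<omega> in M. \<exists>z \<in> {a, b}. (\<lambda>n. Z n \<omega>) \<longlonglongrightarrow> z) \<and>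
         {a, b} \<subseteq> {0<..xhat1 \<theta> c} \<union> {xhat2 \<theta> c..<1} \<and> b = 1 - a)"
    if half: "c = 1/2" and "4 < \<theta>"
  proof -
    obtain d where d: "0 < d" and all: "\<forall>x. (1 < deriv ?L x \<longleftrightarrow> \<bar>x - c\<bar> < d) \<and>
        (deriv ?L x < 1 \<longleftrightarrow> d < \<bar>x - c\<bar>) \<and> (deriv ?L x = 1 \<longleftrightarrow> \<bar>x - c\<bar> = d)"
      using width[OF \<open>4 < \<theta>\<close>] by blast
    have gt: "1 < deriv ?L x \<longleftrightarrow> \<bar>x - c\<bar> < d" and lt: "deriv ?L x < 1 \<longleftrightarrow> d < \<bar>x - c\<bar>"
      and eq: "deriv ?L x = 1 \<longleftrightarrow> \<bar>x - c\<bar> = d" for x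
      using all[rule_format, of x] by simp_all
    have Lc: "?L c = c" using logistic_center[of \<theta> c] half by linarith
    have inc: "?L u - u < ?L v - v" if "u < v" "c - d \<le> u" "v \<le> c + d" for u v
      by (rule logistic_gap_increasing[OF that(1)]) (use that(2,3) d gt in auto)
    \<comment> \<open>Were \<open>c - d \<le> 0\<close>, the gap would rise on [0, c] from a
      positive value at 0 to the value 0 at \<open>c\<close>.\<close>
    have d1: "0 < c - d"
      using inc[of 0 c] logistic_range[of \<theta> c 0] Lc c d by (cases "0 < c - d") auto
    then have d2: "c + d < 1" using half by simp
    have left: "?L (c - d) \<le> c - d" using inc[of "c - d" c] Lc d by simp
    have right: "c + d \<le> ?L (c + d)" using inc[of c "c + d"] Lc d by simp
    obtain a b where ab: "0 < a" "a \<le> c - d" "c + d \<le> b" "b < 1" "?L a = a" "?L b = b"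
        "\<forall>x. ?L x = x \<longrightarrow> c + d \<le> x \<longrightarrow> x = b"
        "limit_configs M Z = {a, b}" "AE \<omega> in M. \<exists>z\<in>{a, b}. (\<lambda>n. Z n \<omega>) \<longlonglongrightarrow> z" "\<not> predictable M Z"
      using logistic_bistable[OF refl d d1 d2 gt lt left right] by blast
    \<comment> \<open>For \<open>c = 1/2\<close> reflection maps fixed points to fixed points, and
      \<open>1 - a\<close> lies at or above \<open>c + d\<close>, where \<open>b\<close> is the only
      one.\<close>
    have "?L (1 - a) = 1 - a" using logistic_reflect[of \<theta> c "1 - a"] ab(5) unfolding half by simp
    then have b: "b = 1 - a" using ab(2,7) half by auto
    note x = xhat_eq[OF d d1 d2 eq]
    have ex: "\<exists>a b. a \<noteq> b \<and> limit_configs M Z = {a, b} \<and>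
         (AE \<omega> in M. \<exists>z \<in> {a, b}. (\<lambda>n. Z n \<omega>) \<longlonglongrightarrow> z) \<and>
         {a, b} \<subseteq> {0<..c - d} \<union> {c + d..<1} \<and> b = 1 - a"
    proof (rule exI[of _ a], rule exI[of _ b], intro conjI)
      show "a \<noteq> b" "{a, b} \<subseteq> {0<..c - d} \<union> {c + d..<1}" using ab(1-4) d by auto
    qed (fact ab(8) ab(9) b)+
    have loc: "c - d < 1/2" "1/2 < c + d" "c + d = 1 - (c - d)"
      "{0<..c - d} \<union> {c + d..<1} \<subseteq> {0<..<1} - {1/2}"
      using d d1 d2 half by auto
    show ?thesis
      unfolding x by (intro conjI) (rule refl loc conv[OF ab(9)] ab(10) ex)+
  qed
  have B0: "{x \<in> {0..1}. deriv ?L x = 1} = {xhat1 \<theta> c, xhat2 \<theta> c} \<and>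
      xhat1 \<theta> c \<in> {0<..<c} \<and> xhat2 \<theta> c \<in> {c<..<1} \<and> xhat2 \<theta> c = 2 * c - xhat1 \<theta> c"
    if slopes: "max (deriv ?L 0) (deriv ?L 1) < 1 \<and> 1 < \<theta> / 4"
  proof -
    have "4 < \<theta>" using slopes by simp
    then obtain d where d: "0 < d" and all: "\<forall>x. (1 < deriv ?L x \<longleftrightarrow> \<bar>x - c\<bar> < d) \<and>
        (deriv ?L x < 1 \<longleftrightarrow> d < \<bar>x - c\<bar>) \<and> (deriv ?L x = 1 \<longleftrightarrow> \<bar>x - c\<bar> = d)"
      using width by blast
    \<comment> \<open>Slopes below 1 at 0 and 1 place both endpoints outside the band of width
      \<open>d\<close> around \<open>c\<close>, so the solutions of \<open>f' = 1\<close> are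
      interior.\<close>
    have "d < \<bar>0 - c\<bar>" "d < \<bar>1 - c\<bar>" using slopes all by auto
    then have d1: "0 < c - d" and d2: "c + d < 1" using c by auto
    have eq: "deriv ?L x = 1 \<longleftrightarrow> \<bar>x - c\<bar> = d" for x using all by simp
    show ?thesis unfolding xhat_eq[OF d d1 d2 eq] using d d1 d2 by auto
  qed
  have B1: "predictable M Z \<and>
      (\<exists>z. (AE \<omega> in M. (\<lambda>n. Z n \<omega>) \<longlonglongrightarrow> z) \<and> limit_configs M Z = {z} \<and>
         z \<in> {0<..<1} - {c, 1/2} \<and> (c > 1/2 \<longrightarrow> z < 1/2) \<and> (c < 1/2 \<longrightarrow> z > 1/2))"
    if half: "c \<noteq> 1/2" and U: "U1 \<theta> c \<or> U2 \<theta> c \<or> U3 \<theta> c"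
  proof -
    obtain z where z: "\<And>x. ?L x = x \<longleftrightarrow> x = z"
      using logistic_unique_fixed_point[OF c \<theta> U] by auto
    note loc = unique_logistic_fixed_point_location[OF \<theta> z]
    have "z \<noteq> 1/2" using loc(3,4) half by linarith
    then show ?thesis using single[OF z] loc half by (intro conjI exI[of _ z]) auto
  qed
  have B2: "{0<..xhat1 \<theta> c} - {1/2} \<subseteq> {0<..<c} - {1/2} \<and>
      {xhat2 \<theta> c..<1} - {1/2} \<subseteq> {c<..<1} - {1/2} \<and>
      (AE \<omega> in M. convergent (\<lambda>n. Z n \<omega>)) \<and> \<not> predictable M Z \<and>
      (\<exists>a b. a \<noteq> b \<and> limit_configs M Z = {a, b} \<and>
         (AE \<omega> in M. \<exists>z \<in> {a, b}. (\<lambda>n. Z n \<omega>) \<longlonglongrightarrow> z) \<and>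
         {a, b} \<subseteq> {0<..<1} - {c, 1/2} \<and>
         a \<in> {0<..xhat1 \<theta> c} - {1/2} \<and> b \<in> {xhat2 \<theta> c..<1} - {1/2} \<and> a < 1/2 \<and> 1/2 < b)"
    if half: "c \<noteq> 1/2" and U: "\<not> (U1 \<theta> c \<or> U2 \<theta> c \<or> U3 \<theta> c)"
  proof -
    have \<theta>4: "4 < \<theta>" using U by (simp add: U1_def)
    have slopes: "deriv ?L 0 < 1" "deriv ?L 1 < 1" using U by (auto simp: U2_def)
    obtain d where d: "0 < d" and all: "\<forall>x. (1 < deriv ?L x \<longleftrightarrow> \<bar>x - c\<bar> < d) \<and>
        (deriv ?L x < 1 \<longleftrightarrow> d < \<bar>x - c\<bar>) \<and> (deriv ?L x = 1 \<longleftrightarrow> \<bar>x - c\<bar> = d)"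
      using width[OF \<theta>4] by blast
    have gt: "1 < deriv ?L x \<longleftrightarrow> \<bar>x - c\<bar> < d" and lt: "deriv ?L x < 1 \<longleftrightarrow> d < \<bar>x - c\<bar>"
      and eq: "deriv ?L x = 1 \<longleftrightarrow> \<bar>x - c\<bar> = d" for x
      using all[rule_format, of x] by simp_all
    have "d < \<bar>0 - c\<bar>" "d < \<bar>1 - c\<bar>" using slopes lt by auto
    then have d1: "0 < c - d" and d2: "c + d < 1" using c by auto
    note x = xhat_eq[OF d d1 d2 eq]
    \<comment> \<open>U1 and U2 being excluded, the failure of U3 leaves precisely these two
      inequalities, with equality allowed.\<close>
    have left: "?L (c - d) \<le> c - d" and right: "c + d \<le> ?L (c + d)"
      using U slopes \<theta>4 unfolding U3_def x by auto
    obtain a b where ab: "0 < a" "a \<le> c - d" "c + d \<le> b" "b < 1" "?L a = a" "?L b = b"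
        "limit_configs M Z = {a, b}" "AE \<omega> in M. \<exists>z\<in>{a, b}. (\<lambda>n. Z n \<omega>) \<longlonglongrightarrow> z" "\<not> predictable M Z"
      using logistic_bistable[OF refl d d1 d2 gt lt left right] by blast
    \<comment> \<open>Otherwise \<open>1/2 \<le> a \<le> c - d\<close>, so \<open>c > 1/2\<close>
      and the gap is negative at 1/2; but it falls up to \<open>c - d\<close> and vanishes at
      \<open>a\<close>. The bound on \<open>b\<close> is the mirror image.\<close>
    have a2: "a < 1/2"
    proof (rule ccontr)
      assume "\<not> a < 1/2"
      then have "1/2 < c" using ab(2) d by simp
      then have h: "?L (1/2) < 1/2" by (rule logistic_half(2)[OF \<theta>])
      have "?L a - a < ?L (1/2) - 1/2" if "1/2 < a"
        by (rule logistic_gap_decreasing[OF that]) (use ab(2) lt in auto)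
      then show False using h ab(5) \<open>\<not> a < 1/2\<close> by (cases "a = 1/2") auto
    qed
    have b2: "1/2 < b"
    proof (rule ccontr)
      assume "\<not> 1/2 < b"
      then have "c < 1/2" using ab(3) d by simp
      then have h: "1/2 < ?L (1/2)" by (rule logistic_half(1)[OF \<theta>])
      have "?L (1/2) - 1/2 < ?L b - b" if "b < 1/2"
        by (rule logistic_gap_decreasing[OF that]) (use ab(3) lt in auto)
      then show False using h ab(6) \<open>\<not> 1/2 < b\<close> by (cases "b = 1/2") auto
    qed
    have ex: "\<exists>a b. a \<noteq> b \<and> limit_configs M Z = {a, b} \<and>
         (AE \<omega> in M. \<exists>z \<in> {a, b}. (\<lambda>n. Z n \<omega>) \<longlonglongrightarrow> z) \<and>
         {a, b} \<subseteq> {0<..<1} - {c, 1/2} \<and>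
         a \<in> {0<..c - d} - {1/2} \<and> b \<in> {c + d..<1} - {1/2} \<and> a < 1/2 \<and> 1/2 < b"
    proof (rule exI[of _ a], rule exI[of _ b], intro conjI)
      show "a \<noteq> b" "{a, b} \<subseteq> {0<..<1} - {c, 1/2}" "a \<in> {0<..c - d} - {1/2}" "b \<in> {c + d..<1} - {1/2}"
        using ab(1-4) a2 b2 d by auto
    qed (fact ab(7) ab(8) a2 b2)+
    have loc: "{0<..c - d} - {1/2} \<subseteq> {0<..<c} - {1/2}" "{c + d..<1} - {1/2} \<subseteq> {c<..<1} - {1/2}"
      using d by auto
    show ?thesis
      unfolding x by (intro conjI) (rule loc conv[OF ab(8)] ab(9) ex)+
  qed
  show ?thesis
    by (rule conjI,
        rule impI, rule conjI, rule impI, erule (1) A1, rule impI, erule (1) A2,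
        rule impI, rule conjI, rule impI, erule B0,
        rule conjI, rule impI, erule (1) B1, rule impI, erule (1) B2)
qed

end
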